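(* Let $(X_i)_{i\ge 1}$ be i.i.d. standard normal random variables and $X_{(n)}=\max_{1\le i\le n}X_i$. Let $\Lambda$ be the standard Gumbel distribution, with distribution function $\Lambda(x)=e^{-e^{-x}}$. For $n\ge 2$ put $a_n=\sqrt{2\log n}$ and $c_n=\log(\sqrt{2\pi}\,a_n)$. (1) Let $\widetilde b_n>0$ satisfy $2\pi\widetilde b_n^2\exp(\widetilde b_n^2)=n^2$ and let $\widetilde Y_n=\widetilde b_n(X_{(n)}-\widetilde b_n)$. Then, as $n\to\infty$, $$\sup_{x\in\mathbb{R}}\Big|\mathbb{P}\Big(X_{(n)}\le\widetilde b_n+\frac{x}{\widetilde b_n}\Big)-e^{-e^{-x}}\Big|=\frac{d_1}{4\log n}(1+o(1)),$$ $$W_1(\mathcal{L}(\widetilde Y_n),\Lambda)=\frac{6(\gamma^2+2\gamma+2)+\pi^2}{24\log n}(1+o(1)),$$ where $d_1=\sup_{x\in\mathbb{R}}(x^2+2x+2)e^{-e^{-x}}e^{-x}$ (numerically $d_1\approx 1.3$). (2) Let $$\widehat b_n=a_n-\frac{c_n}{a_n}-\frac{c_n^2-2c_n}{2a_n^3}$$ and $\widehat Y_n=a_n(X_{(n)}-\widehat b_n)$. Then, as $n\to\infty$, $$\sup_{x\in\mathbb{R}}\Big|\mathbb{P}\Big(X_{(n)}\le\widehat b_n+\frac{x}{a_n}\Big)-e^{-e^{-x}}\Big|=\frac{d_2\log\log n}{4\log n}(1+o(1)),$$ $$W_1(\mathcal{L}(\widehat Y_n),\Lambda)=\frac{(\gamma+2E_1(1))\log\log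 n}{4\log n}(1+o(1)),$$ where $d_2=\sup_{x\in\mathbb{R}}|x|e^{-e^{-x}}e^{-x}$ (numerically $d_2\approx 0.3$) and $\gamma+2E_1(1)=\int_0^{+\infty}e^{-t}|\log t|\,dt$ (numerically $\approx 1$).
   Context: $\gamma$ is the Euler–Mascheroni constant and $E_1(z)=\int_z^\infty t^{-1}e^{-t}\,dt$ is the exponential integral. $\mathcal{L}(Z)$ denotes the distribution of the random variable $Z$. For distributions $\mu,\nu$ on $\mathbb{R}$ with distribution functions $F_\mu,F_\nu$, $W_1(\mu,\nu)=\int_{\mathbb{R}}|F_\mu(x)-F_\nu(x)|\,dx$. *)

theory Defs
  imports "HOL-Probability.Probability" "HOL-Library.Landau_Symbols"
begin

definition sample_max :: "(nat \<Rightarrow> 'a \<Rightarrow> real) \<Rightarrow> nat \<Rightarrow> 'a \<Rightarrow> real" where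
  "sample_max X n \<omega> = Max ((\<lambda>i. X i \<omega>) ` {1..n})"

definition gumbel :: "real measure" where
  "gumbel = interval_measure (\<lambda>x. exp (- exp (- x)))"

lemma
  shows real_distribution_gumbel: "real_distribution gumbel"
    and cdf_gumbel: "cdf gumbel x = exp (- exp (- x))"
proof -
  let ?F = "\<lambda>x::real. exp (- exp (- x))"
  have mono: "?F x \<le> ?F y" if "x \<le> y" for x y
    using that by simp
  have cont: "continuous (at_right a) ?F" for a
    by (intro continuous_intros)
  have e_top: "filterlim (\<lambda>x::real. exp (- x)) at_top at_bot"
    by (rule filterlim_compose[OF exp_at_top filterlim_uminus_at_top_at_bot])
  have bot: "(?F \<longlongrightarrow> 0) at_bot"
    by (rule filterlim_compose[OF exp_at_bot])
       (use e_top in \<open>simp add: filterlim_uminus_at_top\<close>)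
  have "((\<lambda>x::real. exp (- x)) \<longlongrightarrow> 0) at_top"
    by (rule filterlim_compose[OF exp_at_bot filterlim_uminus_at_bot_at_top])
  from tendsto_exp[OF tendsto_minus[OF this]] have top: "(?F \<longlongrightarrow> 1) at_top"
    by simp
  show "real_distribution gumbel"
    unfolding gumbel_def by (rule real_distribution_interval_measure[OF mono cont bot top])
  show "cdf gumbel x = exp (- exp (- x))"
    unfolding gumbel_def cdf_def by (rule measure_interval_measure_Iic[OF mono cont bot])
qed

(* The Bochner integral is 0 for an integrand that is not integrable. A nonzero value, hence
   asymptotic equivalence to a positive sequence, therefore (eventually) includes integrability. *)
definition W1 :: "real measure \<Rightarrow> real measure \<Rightarrow> real" where
  "W1 \<mu> \<nu> = (LBINT x. \<bar>cdf \<mu> x - cdf \<nu> x\<bar>)"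

(* meant for z > 0 *)
definition E1 :: "real \<Rightarrow> real" where
  "E1 z = (LBINT t:{z<..}. exp (- t) / t)"

definition a_seq :: "nat \<Rightarrow> real" where
  "a_seq n = sqrt (2 * ln (real n))"

definition c_seq :: "nat \<Rightarrow> real" where
  "c_seq n = ln (sqrt (2 * pi) * a_seq n)"

definition bhat :: "nat \<Rightarrow> real" where
  "bhat n = a_seq n - c_seq n / a_seq n - ((c_seq n)\<^sup>2 - 2 * c_seq n) / (2 * a_seq n ^ 3)"

definition d1 :: real where
  "d1 = (SUP x::real. (x\<^sup>2 + 2 * x + 2) * exp (- exp (- x)) * exp (- x))"

definition d2 :: real where
  "d2 = (SUP x::real. \<bar>x\<bar> * exp (- exp (- x)) * exp (- x))"

end

theory Submission
  imports Defs "HOL-Real_Asymp.Real_Asymp"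
begin

text \<open>
  By independence \<open>P (sample_max X n \<le> u) = \<Phi> u ^ n\<close>, so both parts compare a power of the normal
  distribution function \<open>\<Phi>\<close>, with density \<open>\<phi>\<close>, to \<open>\<Lambda> x = exp (- exp (- x))\<close>.

  The equation \<open>2 \<pi> b\<^sup>2 exp (b\<^sup>2) = n\<^sup>2\<close> says exactly that \<open>n \<phi>(b) / b = 1\<close>. With it, and with Mills'
  ratio to second order, \<open>n (1 - \<Phi> (b + x / b)) = exp (- x) (1 - (x\<^sup>2 / 2 + x + 1) / b\<^sup>2 + O(1 / b\<^sup>4))\<close>:
  the three summands of the polynomial come from the Gaussian factor \<open>exp (- x\<^sup>2 / (2 b\<^sup>2))\<close>, from the
  factor \<open>1 / u\<close> at \<open>u = b + x / b\<close>, and from the correction \<open>1 - 1 / u\<^sup>2\<close> in Mills' ratio. Hence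
  \<open>\<Phi> (b + x / b) ^ n - \<Lambda> x\<close> is \<open>(x\<^sup>2 / 2 + x + 1) \<Lambda>'(x) / b\<^sup>2\<close> up to \<open>O(1 / b\<^sup>4)\<close>, and \<open>b\<^sup>2 \<sim> 2 ln n\<close>. The
  polynomial is positive, so no absolute value appears in the constants of the first part.

  The error term is controlled for every real \<open>x\<close> by a multiple of \<open>exp (- \<bar>x\<bar> / 2)\<close>
  (\<open>power_cdf_expansion\<close>). Such a weighted bound serves both metrics at once: if
  \<open>\<bar>f\<^sub>n - r\<^sub>n g\<bar> \<le> \<rho>\<^sub>n w\<close> with \<open>w\<close> bounded and integrable and \<open>\<rho>\<^sub>n = o(r\<^sub>n)\<close>, then the triangle inequality
  gives \<open>sup \<bar>f\<^sub>n\<bar> / r\<^sub>n \<rightarrow> sup \<bar>g\<bar>\<close> and the same for integrals (\<open>sup_and_L1_limits\<close>).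

  For the second part, write the location \<open>bhat n + x / a_seq n\<close> as \<open>b + y / b\<close> with \<open>y = p + (1 + s) x\<close>.
  Here \<open>1 + s = b / a_seq n\<close>, and \<open>s \<sim> - ln (ln n) / (4 ln n)\<close>, whereas \<open>bhat\<close> approximates \<open>b\<close> so well
  that \<open>p = o(s)\<close> (\<open>shifts_asymptotics\<close>). Replacing \<open>\<Phi> (b + y / b) ^ n\<close> by \<open>\<Lambda> y\<close> costs only
  \<open>O(1 / ln n) = o(s)\<close>; what remains is \<open>\<Lambda> (p + (1 + s) x) - \<Lambda> x\<close>, that is, \<open>s x \<Lambda>'(x)\<close> to first order. The
  error is therefore dominated by the use of a slightly wrong scale.

  The constants of the Wasserstein distances are moments of the Gumbel distribution. The substitution
  \<open>t = exp (- x)\<close> turns its Laplace transform into \<open>Gamma (1 + s)\<close>, whose first two derivatives at \<open>0\<close>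
  give the mean and the second moment; the absolute first moment becomes the integral of
  \<open>exp (- t) \<bar>ln t\<bar>\<close>, and integration by parts on \<open>t > 1\<close> produces the exponential integral.
\<close>

section \<open>Weighted approximation in the supremum and L1 norms\<close>

lemma bounded_of_limits:
  fixes f :: "real \<Rightarrow> real"
  assumes cont: "continuous_on UNIV f" and top: "(f \<longlongrightarrow> 0) at_top" and bot: "(f \<longlongrightarrow> 0) at_bot"
  obtains C where "C > 0" "\<And>x. \<bar>f x\<bar> \<le> C"
proof -
  have "\<forall>\<^sub>F x in at_top. \<bar>f x\<bar> < 1" "\<forall>\<^sub>F x in at_bot. \<bar>f x\<bar> < 1"
    using top bot by (auto simp: tendsto_iff)
  then obtain a b where a: "\<And>x. x \<ge> a \<Longrightarrow> \<bar>f x\<bar> < 1" and b: "\<And>x. x \<le> b \<Longrightarrow> \<bar>f x\<bar> < 1"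
    by (auto simp: eventually_at_top_linorder eventually_at_bot_linorder)
  have "bounded (f ` {b..a})"
    by (intro compact_imp_bounded compact_continuous_image continuous_on_subset[OF cont]) auto
  then obtain D where D: "\<And>x. x \<in> {b..a} \<Longrightarrow> \<bar>f x\<bar> \<le> D"
    unfolding bounded_iff by (metis image_eqI real_norm_def)
  show thesis
  proof (rule that[of "max 1 D"])
    show "\<bar>f x\<bar> \<le> max 1 D" for x
      using a[of x] b[of x] D[of x] by (cases "x \<ge> a"; cases "x \<le> b") (auto simp: le_max_iff_disj)
  qed auto
qed

lemma integrable_exp_abs: "c > 0 \<Longrightarrow> integrable lborel (\<lambda>x::real. exp (- c * \<bar>x\<bar>))"
proof -
  assume c: "c > 0"
  have "(\<integral>\<^sup>+x. ennreal (exp (- c * x)) * indicator {0..} x \<partial>lborel) = ennreal (0 - (- exp (- c * 0) / c))"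
    using c by (intro nn_integral_FTC_atLeast[where F = "\<lambda>x. - exp (- c * x) / c"])
      (auto intro!: derivative_eq_intros simp: divide_simps, real_asymp)
  then have "set_integrable lborel {0..} (\<lambda>x. exp (- c * x))"
    unfolding set_integrable_def
    by (intro integrableI_nonneg) (auto simp: mult.commute indicator_mult_ennreal nn_integral_set_ennreal)
  then have 1: "set_integrable lborel {0..} (\<lambda>x. exp (- c * \<bar>x\<bar>))"
    by (subst set_integrable_cong[where f' = "\<lambda>x. exp (- c * x)"]) auto
  then have 2: "integrable lborel (\<lambda>x. indicator {0..} (0 + (-1) * x) *\<^sub>R exp (- c * \<bar>0 + (-1) * x\<bar>))"
    unfolding set_integrable_def by (subst lborel_integrable_real_affine_iff) auto
  have "(\<lambda>x::real. indicator {0..} (0 + (-1) * x) *\<^sub>R exp (- c * \<bar>0 + (-1) * x\<bar>)) =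
     (\<lambda>x. indicator {..0} x *\<^sub>R exp (- c * \<bar>x\<bar>))"
    by (auto simp: fun_eq_iff split: split_indicator)
  with 2 have "set_integrable lborel {..0} (\<lambda>x. exp (- c * \<bar>x\<bar>))"
    unfolding set_integrable_def by simp
  from set_integrable_Un[OF 1 this] have "set_integrable lborel ({0..} \<union> {..0}) (\<lambda>x. exp (- c * \<bar>x\<bar>))"
    by auto
  moreover have "{0::real..} \<union> {..0} = UNIV" by auto
  ultimately show ?thesis by (simp add: set_integrable_def)
qed

text \<open>
  The weight \<open>exp (- c \<bar>x\<bar>)\<close> is at most \<open>1\<close> and integrable, so a single weighted bound controls the
  difference of \<open>f n / r n\<close> and \<open>g\<close> in both norms, and both norms are continuous.
\<close>
lemma sup_and_L1_limits:
  fixes f :: "nat \<Rightarrow> real \<Rightarrow> real" and g :: "real \<Rightarrow> real" and r \<rho> :: "nat \<Rightarrow> real"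
  assumes c: "c > 0"
    and close: "\<forall>\<^sub>F n in sequentially. \<forall>x. \<bar>f n x - r n * g x\<bar> \<le> \<rho> n * exp (- c * \<bar>x\<bar>)"
    and small: "(\<lambda>n. \<rho> n / r n) \<longlonglongrightarrow> 0"
    and pos: "\<forall>\<^sub>F n in sequentially. r n > 0"
    and g: "g \<in> borel_measurable borel" "\<And>x. \<bar>g x\<bar> \<le> K * exp (- c * \<bar>x\<bar>)"
    and f: "\<forall>\<^sub>F n in sequentially. f n \<in> borel_measurable borel"
  shows "(\<lambda>n. (SUP x. \<bar>f n x\<bar>) / r n) \<longlonglongrightarrow> (SUP x. \<bar>g x\<bar>)"
    and "(\<lambda>n. (LBINT x. \<bar>f n x\<bar>) / r n) \<longlonglongrightarrow> (LBINT x. \<bar>g x\<bar>)"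
proof -
  let ?w = "\<lambda>x::real. exp (- c * \<bar>x\<bar>)"
  have w1: "?w x \<le> 1" for x using c by simp
  have K: "K \<ge> 0" using g(2)[of 0] by simp
  have w: "integrable lborel ?w" by (rule integrable_exp_abs[OF c])
  have bdd_g: "bdd_above (range (\<lambda>x. \<bar>g x\<bar>))"
  proof (rule bdd_aboveI2)
    show "\<bar>g x\<bar> \<le> K" for x
      using order_trans[OF g(2)[of x] mult_left_mono[OF w1 K]] by simp
  qed
  have int_g: "integrable lborel (\<lambda>x. \<bar>g x\<bar>)"
    by (rule Bochner_Integration.integrable_bound[OF integrable_mult_right[OF w, of K]])
       (use g order_trans[OF g(2) abs_ge_self] in auto)
  have main: "\<bar>(SUP x. \<bar>f n x\<bar>) / r n - (SUP x. \<bar>g x\<bar>)\<bar> \<le> \<rho> n / r n \<and>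
      \<bar>(LBINT x. \<bar>f n x\<bar>) / r n - (LBINT x. \<bar>g x\<bar>)\<bar> \<le> \<rho> n / r n * (LBINT x. ?w x)"
    if r: "r n > 0" and f: "f n \<in> borel_measurable borel"
      and cl: "\<forall>x. \<bar>f n x - r n * g x\<bar> \<le> \<rho> n * ?w x" for n
  proof -
    have \<rho>: "\<rho> n \<ge> 0" using cl[rule_format, of 0] by simp
    have d: "\<bar>\<bar>f n x\<bar> / r n - \<bar>g x\<bar>\<bar> \<le> \<rho> n / r n * ?w x" for x
    proof -
      have "\<bar>\<bar>f n x\<bar> / r n - \<bar>g x\<bar>\<bar> = \<bar>\<bar>f n x\<bar> - \<bar>r n * g x\<bar>\<bar> / r n"
        using r by (simp add: field_simps abs_mult)
      also have "\<dots> \<le> \<rho> n * ?w x / r n"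
        using r cl[rule_format, of x] by (intro divide_right_mono) auto
      finally show ?thesis by simp
    qed
    have d1: "\<bar>\<bar>f n x\<bar> / r n - \<bar>g x\<bar>\<bar> \<le> \<rho> n / r n" for x
      using order_trans[OF d mult_left_mono[OF w1]] \<rho> r by simp
    have fle: "\<bar>f n x\<bar> \<le> r n * ((SUP x. \<bar>g x\<bar>) + \<rho> n / r n)" for x
    proof -
      have "\<bar>f n x\<bar> / r n \<le> (SUP x. \<bar>g x\<bar>) + \<rho> n / r n"
        using d1[of x] cSUP_upper[OF _ bdd_g, of x] by auto
      then show ?thesis using r by (simp add: pos_divide_le_eq mult.commute)
    qed
    have bdd_f: "bdd_above (range (\<lambda>x. \<bar>f n x\<bar>))"
      by (rule bdd_aboveI2) (rule fle)
    have "(SUP x. \<bar>f n x\<bar>) \<le> r n * ((SUP x. \<bar>g x\<bar>) + \<rho> n / r n)"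
      by (rule cSUP_least) (auto intro: fle)
    then have u: "(SUP x. \<bar>f n x\<bar>) / r n \<le> (SUP x. \<bar>g x\<bar>) + \<rho> n / r n"
      using r by (simp add: pos_divide_le_eq mult.commute)
    have l: "(SUP x. \<bar>g x\<bar>) \<le> (SUP x. \<bar>f n x\<bar>) / r n + \<rho> n / r n"
    proof (rule cSUP_least)
      show "\<bar>g x\<bar> \<le> (SUP x. \<bar>f n x\<bar>) / r n + \<rho> n / r n" for x
        using d1[of x] divide_right_mono[OF cSUP_upper[OF _ bdd_f, of x], of "r n"] r by auto
    qed auto
    have int_d: "integrable lborel (\<lambda>x. \<bar>f n x\<bar> / r n - \<bar>g x\<bar>)"
      by (rule Bochner_Integration.integrable_bound[OF integrable_mult_right[OF w, of "\<rho> n / r n"]])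
         (use f g order_trans[OF d abs_ge_self] in auto)
    have int_f: "integrable lborel (\<lambda>x. \<bar>f n x\<bar> / r n)"
      using Bochner_Integration.integrable_add[OF int_d int_g] by simp
    have "(LBINT x. \<bar>f n x\<bar>) / r n - (LBINT x. \<bar>g x\<bar>) = (LBINT x. \<bar>f n x\<bar> / r n - \<bar>g x\<bar>)"
      by (subst Bochner_Integration.integral_diff[OF int_f int_g]) simp
    also have "\<bar>\<dots>\<bar> \<le> (LBINT x. \<bar>\<bar>f n x\<bar> / r n - \<bar>g x\<bar>\<bar>)"
      by (rule integral_abs_bound)
    also have "\<dots> \<le> (LBINT x. \<rho> n / r n * ?w x)"
      by (rule integral_mono) (use int_d w d in auto)
    finally show ?thesis using u l by simp
  qed
  have ev: "\<forall>\<^sub>F n in sequentially. r n > 0 \<and> f n \<in> borel_measurable borel \<and>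
      (\<forall>x. \<bar>f n x - r n * g x\<bar> \<le> \<rho> n * ?w x)"
    using close pos f by eventually_elim auto
  have "(\<lambda>n. (SUP x. \<bar>f n x\<bar>) / r n - (SUP x. \<bar>g x\<bar>)) \<longlonglongrightarrow> 0"
    by (rule Lim_null_comparison[OF _ small], rule eventually_mono[OF ev])
       (use main in auto)
  then show "(\<lambda>n. (SUP x. \<bar>f n x\<bar>) / r n) \<longlonglongrightarrow> (SUP x. \<bar>g x\<bar>)"
    by (simp add: LIM_zero_iff)
  have "(\<lambda>n. (LBINT x. \<bar>f n x\<bar>) / r n - (LBINT x. \<bar>g x\<bar>)) \<longlonglongrightarrow> 0"
    by (rule Lim_null_comparison[OF _ tendsto_mult_left_zero[OF small, of "LBINT x. ?w x"]],
        rule eventually_mono[OF ev]) (use main in auto)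
  then show "(\<lambda>n. (LBINT x. \<bar>f n x\<bar>) / r n) \<longlonglongrightarrow> (LBINT x. \<bar>g x\<bar>)"
    by (simp add: LIM_zero_iff)
qed

text \<open>
  Reduces a two-sided exponential bound to limits at the two ends of the line: a continuous function
  that tends to zero at both ends is bounded.
\<close>
lemma exponential_decay_bound:
  fixes f :: "real \<Rightarrow> real"
  assumes cont: "continuous_on UNIV f"
    and "((\<lambda>x. f x * exp (k * x)) \<longlongrightarrow> 0) at_top" "((\<lambda>x. f x * exp (k * x)) \<longlongrightarrow> 0) at_bot"
    and "((\<lambda>x. f x * exp (- k * x)) \<longlongrightarrow> 0) at_top" "((\<lambda>x. f x * exp (- k * x)) \<longlongrightarrow> 0) at_bot"
  obtains C where "C > 0" "\<And>x. \<bar>f x\<bar> \<le> C * exp (- k * \<bar>x\<bar>)"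
proof -
  have c: "continuous_on UNIV (\<lambda>x. f x * exp (k * x))" "continuous_on UNIV (\<lambda>x. f x * exp (- k * x))"
    by (intro continuous_intros cont)+
  obtain C1 where C1: "C1 > 0" "\<And>x. \<bar>f x * exp (k * x)\<bar> \<le> C1"
    using bounded_of_limits[OF c(1) assms(2,3)] by blast
  obtain C2 where C2: "C2 > 0" "\<And>x. \<bar>f x * exp (- k * x)\<bar> \<le> C2"
    using bounded_of_limits[OF c(2) assms(4,5)] by blast
  show thesis
  proof (rule that[of "C1 + C2"])
    fix x :: real
    have "\<bar>f x\<bar> * exp (k * \<bar>x\<bar>) \<le> C1 + C2"
      using C1(2)[of x] C2(2)[of x] C1(1) C2(1) by (cases "x \<ge> 0") (auto simp: abs_mult)
    then have "\<bar>f x\<bar> * exp (k * \<bar>x\<bar>) * exp (- k * \<bar>x\<bar>) \<le> (C1 + C2) * exp (- k * \<bar>x\<bar>)"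
      by (intro mult_right_mono) auto
    then show "\<bar>f x\<bar> \<le> (C1 + C2) * exp (- k * \<bar>x\<bar>)"
      by (simp add: mult.assoc exp_add[symmetric])
  qed (use C1 C2 in auto)
qed

text \<open>
  The remainder keeps the exponential of the smaller of the two points. For \<open>t = exp (- x)\<close> with \<open>x\<close> very
  negative this double exponential decay is what absorbs the growth of \<open>h\<close>.
\<close>
lemma exp_minus_taylor2: "\<bar>exp (- (t + h)) - exp (- t) + h * exp (- t)\<bar> \<le> h\<^sup>2 * exp (- min (t + h) (t::real))"
proof (cases "h \<ge> 0")
  case True
  have 1: "1 - h \<le> exp (- h)" using exp_ge_add_one_self[of "- h"] by simp
  have "h * exp (- h) \<le> 1 - exp (- h)"
    using mult_right_mono[OF exp_ge_add_one_self[of h], of "exp (- h)"]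
    by (simp add: algebra_simps exp_minus)
  then have "exp (- h) - 1 + h \<le> h * (1 - exp (- h))" by (simp add: algebra_simps)
  also have "\<dots> \<le> h * h" using 1 True by (intro mult_left_mono) auto
  finally have "\<bar>exp (- h) - 1 + h\<bar> \<le> h\<^sup>2" using 1 by (simp add: power2_eq_square)
  then have "exp (- t) * \<bar>exp (- h) - 1 + h\<bar> \<le> exp (- t) * h\<^sup>2" by (intro mult_left_mono) auto
  moreover have "exp (- (t + h)) - exp (- t) + h * exp (- t) = exp (- t) * (exp (- h) - 1 + h)"
    by (simp add: exp_add[symmetric] algebra_simps exp_diff exp_minus field_simps)
  ultimately show ?thesis using True by (simp add: abs_mult mult.commute min_def)
next
  case False
  define k where "k = - h"
  have k: "k > 0" "h = - k" using False by (auto simp: k_def)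
  have 1: "1 + k \<le> exp k" by simp
  have "(1 - k) * exp k \<le> exp (- k) * exp k"
    using exp_ge_add_one_self[of "- k"] by (intro mult_right_mono) auto
  then have 2: "exp k - 1 \<le> k * exp k" by (simp add: algebra_simps exp_minus)
  then have "exp k - 1 - k \<le> k * (exp k - 1)" by (simp add: algebra_simps)
  also have "\<dots> \<le> k * (k * exp k)" using k 2 by (intro mult_left_mono) auto
  also have "exp k - 1 - k = \<bar>exp k - 1 - k\<bar>" using 1 by linarith
  finally have "\<bar>exp k - 1 - k\<bar> \<le> k\<^sup>2 * exp k" by (simp only: power2_eq_square mult.assoc)
  then have "exp (- t) * \<bar>exp k - 1 - k\<bar> \<le> exp (- t) * (k\<^sup>2 * exp k)" by (intro mult_left_mono) auto
  moreover have "exp (- (t + h)) - exp (- t) + h * exp (- t) = exp (- t) * (exp k - 1 - k)"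
    unfolding k by (simp add: algebra_simps exp_diff exp_minus field_simps)
  moreover have "exp (- t) * (k\<^sup>2 * exp k) = h\<^sup>2 * exp (- (t + h))"
    unfolding k by (simp add: exp_diff exp_minus field_simps)
  ultimately show ?thesis using k by (simp add: abs_mult min_def)
qed

lemma exp_taylor2_abs: "\<bar>exp y - 1 - y\<bar> \<le> y\<^sup>2 * exp \<bar>y\<bar>" for y :: real
proof -
  have "\<bar>exp y - 1 - y\<bar> \<le> y\<^sup>2 * exp (- min (- y) 0)"
    using exp_minus_taylor2[of 0 "- y"] by simp
  also have "\<dots> \<le> y\<^sup>2 * exp \<bar>y\<bar>" by (intro mult_left_mono) auto
  finally show ?thesis .
qed

lemma square_le_exp_quarter: "x\<^sup>2 \<le> 32 * exp (\<bar>x\<bar> / 4)" for x :: real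
proof -
  have "1 + \<bar>x\<bar> / 4 + (\<bar>x\<bar> / 4)\<^sup>2 / 2 \<le> exp (\<bar>x\<bar> / 4)"
    by (rule exp_lower_Taylor_quadratic) simp
  moreover have "(\<bar>x\<bar> / 4)\<^sup>2 / 2 = x\<^sup>2 / 32" by (simp add: power_divide)
  ultimately show ?thesis by simp
qed

section \<open>The tail of the standard normal distribution\<close>

abbreviation std_normal_cdf :: "real \<Rightarrow> real" where
  "std_normal_cdf \<equiv> cdf std_normal_distribution"

lemma real_distribution_std_normal: "real_distribution std_normal_distribution"
  unfolding real_distribution_def real_distribution_axioms_def
  by (auto intro: prob_space_normal_density)

lemma std_normal_cdf_mono: "mono std_normal_cdf"
proof -
  interpret real_distribution std_normal_distribution by (rule real_distribution_std_normal)
  show ?thesis by (auto simp: mono_def intro: cdf_nondecreasing)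
qed

lemma std_normal_cdf_bounds: "0 \<le> std_normal_cdf u" "std_normal_cdf u \<le> 1"
proof -
  interpret real_distribution std_normal_distribution by (rule real_distribution_std_normal)
  show "0 \<le> std_normal_cdf u" "std_normal_cdf u \<le> 1"
    by (auto intro: cdf_nonneg cdf_bounded_prob)
qed

lemma std_normal_tail_eq_nn_integral:
  "ennreal (1 - std_normal_cdf u) =
    (\<integral>\<^sup>+x. ennreal (std_normal_density x) * indicator {u..} x \<partial>lborel)"
proof -
  interpret real_distribution std_normal_distribution by (rule real_distribution_std_normal)
  have "1 - std_normal_cdf u = prob {u<..}"
    using prob_compl[of "{..u}"] by (simp add: cdf_def Compl_eq_Diff_UNIV[symmetric] Compl_atMost)
  then have "ennreal (1 - std_normal_cdf u) = emeasure std_normal_distribution {u<..}"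
    by (simp add: emeasure_eq_measure)
  also have "\<dots> = (\<integral>\<^sup>+x. ennreal (std_normal_density x) * indicator {u<..} x \<partial>lborel)"
    by (subst emeasure_density) auto
  also have "\<dots> = (\<integral>\<^sup>+x. ennreal (std_normal_density x) * indicator {u..} x \<partial>lborel)"
    by (rule nn_integral_cong_AE, use AE_lborel_singleton[of u] in eventually_elim)
       (auto split: split_indicator)
  finally show ?thesis .
qed

text \<open>
  Comparison with a function \<open>f\<close> that has an explicit primitive vanishing at infinity.
\<close>
lemma std_normal_tail_upper:
  assumes "f \<in> borel_measurable borel" "\<And>x. u \<le> x \<Longrightarrow> DERIV F x :> f x"
    and "\<And>x. u \<le> x \<Longrightarrow> std_normal_density x \<le> f x" "(F \<longlongrightarrow> 0) at_top"
  shows "1 - std_normal_cdf u \<le> - F u"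
proof -
  have nn: "0 \<le> f x" if "u \<le> x" for x
    using assms(3)[OF that] normal_density_nonneg[of 0 1 x] by linarith
  have "F u \<le> 0"
  proof (rule tendsto_lowerbound[OF assms(4)])
    show "\<forall>\<^sub>F x in at_top. F u \<le> F x"
      using eventually_ge_at_top[of u]
      by eventually_elim (meson DERIV_nonneg_imp_nondecreasing assms(2) nn)
  qed auto
  have "ennreal (1 - std_normal_cdf u) \<le> (\<integral>\<^sup>+x. ennreal (f x) * indicator {u..} x \<partial>lborel)"
    unfolding std_normal_tail_eq_nn_integral
    by (intro nn_integral_mono) (auto split: split_indicator intro: ennreal_leI assms(3))
  also have "\<dots> = ennreal (0 - F u)"
    by (rule nn_integral_FTC_atLeast) (use assms nn in auto)
  finally show ?thesis using \<open>F u \<le> 0\<close> by (simp add: ennreal_le_iff)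
qed

lemma std_normal_tail_lower:
  assumes "f \<in> borel_measurable borel" "\<And>x. u \<le> x \<Longrightarrow> DERIV F x :> f x"
    and "\<And>x. u \<le> x \<Longrightarrow> 0 \<le> f x" "\<And>x. u \<le> x \<Longrightarrow> f x \<le> std_normal_density x"
    and "(F \<longlongrightarrow> 0) at_top"
  shows "- F u \<le> 1 - std_normal_cdf u"
proof -
  have "ennreal (0 - F u) = (\<integral>\<^sup>+x. ennreal (f x) * indicator {u..} x \<partial>lborel)"
    by (rule nn_integral_FTC_atLeast[symmetric]) (use assms in auto)
  also have "\<dots> \<le> ennreal (1 - std_normal_cdf u)"
    unfolding std_normal_tail_eq_nn_integral
    by (intro nn_integral_mono) (auto split: split_indicator intro: ennreal_leI assms(4))
  finally show ?thesis using std_normal_cdf_bounds[of u] by (simp add: ennreal_le_iff)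
qed

lemma std_normal_density_has_derivative:
  "DERIV std_normal_density x :> - x * std_normal_density x"
  unfolding std_normal_density_def by (auto intro!: derivative_eq_intros simp: field_simps)

text \<open>
  Truncations of the asymptotic series of Mills' ratio, whose partial sums alternately under- and
  overestimate: their derivatives are \<open>\<phi> (1 - 3 / u ^ 4)\<close> and \<open>\<phi> (1 + 15 / u ^ 6)\<close> up to sign, and these can
  be compared with \<open>\<phi>\<close>. The bound \<open>u \<ge> 2\<close> makes the first of them nonnegative.
\<close>
lemma mills_ratio_bounds:
  assumes "u \<ge> 2"
  shows "std_normal_density u / u * (1 - 1 / u\<^sup>2) \<le> 1 - std_normal_cdf u"
    and "1 - std_normal_cdf u \<le> std_normal_density u / u * (1 - 1 / u\<^sup>2 + 3 / u ^ 4)"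
proof -
  let ?p = std_normal_density
  let ?F = "\<lambda>x. - (?p x * (1 / x - 1 / x ^ 3))"
  have "- ?F u \<le> 1 - std_normal_cdf u"
  proof (rule std_normal_tail_lower[where f = "\<lambda>x. ?p x * (1 - 3 / x ^ 4)"])
    fix x assume x: "u \<le> x"
    with assms have x0: "x > 0" "x \<ge> 2" by auto
    show "DERIV ?F x :> ?p x * (1 - 3 / x ^ 4)"
      using x0 by (auto intro!: derivative_eq_intros std_normal_density_has_derivative
          simp: field_simps eval_nat_numeral)
    have "2 ^ 4 \<le> x ^ 4" using x0 by (intro power_mono) auto
    then have "1 - 3 / x ^ 4 \<ge> 0" using x0 by (simp add: field_simps)
    then show "0 \<le> ?p x * (1 - 3 / x ^ 4)" by simp
    show "?p x * (1 - 3 / x ^ 4) \<le> ?p x" by (intro mult_left_le) auto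
  next
    show "(?F \<longlongrightarrow> 0) at_top" unfolding std_normal_density_def by real_asymp
  qed simp
  also have "- ?F u = ?p u / u * (1 - 1 / u\<^sup>2)"
    using assms by (simp add: field_simps eval_nat_numeral)
  finally show "?p u / u * (1 - 1 / u\<^sup>2) \<le> 1 - std_normal_cdf u" .
  let ?G = "\<lambda>x. - (?p x * (1 / x - 1 / x ^ 3 + 3 / x ^ 5))"
  have "1 - std_normal_cdf u \<le> - ?G u"
  proof (rule std_normal_tail_upper[where f = "\<lambda>x. ?p x * (1 + 15 / x ^ 6)"])
    fix x assume x: "u \<le> x"
    with assms have x0: "x > 0" by auto
    show "DERIV ?G x :> ?p x * (1 + 15 / x ^ 6)"
      using x0 by (auto intro!: derivative_eq_intros std_normal_density_has_derivative
          simp: field_simps eval_nat_numeral)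
    have "?p x * 1 \<le> ?p x * (1 + 15 / x ^ 6)" by (intro mult_left_mono) auto
    then show "?p x \<le> ?p x * (1 + 15 / x ^ 6)" by simp
  next
    show "(?G \<longlongrightarrow> 0) at_top" unfolding std_normal_density_def by real_asymp
  qed simp
  also have "- ?G u = ?p u / u * (1 - 1 / u\<^sup>2 + 3 / u ^ 4)"
    using assms by (simp add: field_simps eval_nat_numeral)
  finally show "1 - std_normal_cdf u \<le> ?p u / u * (1 - 1 / u\<^sup>2 + 3 / u ^ 4)" .
qed

text \<open>
  Exponential tilting: \<open>\<phi>(x) exp (- s x)\<close> is \<open>exp (s\<^sup>2 / 2)\<close> times the normal density centred at \<open>- s\<close>.
\<close>
lemma std_normal_cdf_chernoff:
  assumes "s \<ge> 0" shows "std_normal_cdf u \<le> exp (s * u + s\<^sup>2 / 2)"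
proof -
  interpret real_distribution std_normal_distribution by (rule real_distribution_std_normal)
  interpret N: prob_space "density lborel (normal_density (- s) 1)"
    by (rule prob_space_normal_density) simp
  let ?K = "exp (s * u + s\<^sup>2 / 2)"
  have "ennreal (std_normal_cdf u) = (\<integral>\<^sup>+x. ennreal (std_normal_density x) * indicator {..u} x \<partial>lborel)"
    unfolding cdf_def by (subst emeasure_eq_measure[symmetric], subst emeasure_density) auto
  also have "\<dots> \<le> (\<integral>\<^sup>+x. ennreal ?K * ennreal (normal_density (- s) 1 x) \<partial>lborel)"
  proof (intro nn_integral_mono)
    fix x
    have "std_normal_density x \<le> ?K * normal_density (- s) 1 x" if "x \<le> u"
    proof -
      have "?K * normal_density (- s) 1 x = std_normal_density x * exp (s * (u - x))"
        by (simp add: normal_density_def exp_add[symmetric] power2_eq_square field_simps)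
      moreover have "1 \<le> exp (s * (u - x))" using that assms by simp
      ultimately show ?thesis by (metis mult.right_neutral mult_left_mono normal_density_nonneg)
    qed
    then show "ennreal (std_normal_density x) * indicator {..u} x
        \<le> ennreal ?K * ennreal (normal_density (- s) 1 x)"
      by (auto split: split_indicator simp: ennreal_mult'[symmetric] intro!: ennreal_leI)
  qed
  also have "\<dots> = ennreal ?K * emeasure (density lborel (normal_density (- s) 1)) UNIV"
    by (subst emeasure_density) (auto intro: nn_integral_cmult)
  also have "\<dots> = ennreal ?K" using N.emeasure_space_1 by simp
  finally show ?thesis by (simp add: ennreal_le_iff)
qed

section \<open>The Gumbel distribution function, its density and the first correction\<close>

definition gumbel_cdf :: "real \<Rightarrow> real" where
  "gumbel_cdf x = exp (- exp (- x))"

definition gumbel_density :: "real \<Rightarrow> real" where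
  "gumbel_density x = exp (- exp (- x)) * exp (- x)"

text \<open>
  The coefficient of \<open>1 / b\<^sup>2\<close> in the expansion of \<open>\<Phi> (b + x / b) ^ n\<close> around the Gumbel distribution
  function. It is half of the function whose supremum is \<open>d1\<close>.
\<close>
definition gumbel_correction :: "real \<Rightarrow> real" where
  "gumbel_correction x = (x\<^sup>2 / 2 + x + 1) * gumbel_density x"

lemma gumbel_density_nonneg: "gumbel_density x \<ge> 0"
  by (simp add: gumbel_density_def)

lemma gumbel_correction_nonneg: "gumbel_correction x \<ge> 0"
proof -
  have "x\<^sup>2 / 2 + x + 1 = ((x + 1)\<^sup>2 + 1) / 2" by (simp add: power2_eq_square field_simps)
  then show ?thesis unfolding gumbel_correction_def by (simp only:) (simp add: gumbel_density_nonneg)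
qed

text \<open>
  Not sharp: \<open>gumbel_cdf\<close> decays doubly exponentially on the left, but only the rate \<open>3 / 4\<close>, which it
  shares with the other terms, matters. Any rate above \<open>1 / 2\<close> would do.
\<close>
lemma gumbel_cdf_left_bound: "x \<le> 0 \<Longrightarrow> gumbel_cdf x \<le> exp (- (3 / 4) * \<bar>x\<bar>)"
proof -
  assume x: "x \<le> 0"
  have "1 + - x \<le> exp (- x)" by (rule exp_ge_add_one_self)
  then have "- exp (- x) \<le> (3 / 4) * x" using x by linarith
  then show ?thesis unfolding gumbel_cdf_def using x by simp
qed

text \<open>
  The left-hand side is the error term of \<open>power_cdf_expansion_central\<close>. On the right it decays like
  \<open>exp (- x)\<close> times a polynomial, and on the left the double exponentials win.
\<close>
lemma gumbel_weight_bound: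
  obtains C where "C > 0"
    "\<And>x. (120 * (1 + x\<^sup>2)\<^sup>2 * gumbel_density x +
       30000 * (exp (- x))\<^sup>2 * (1 + x\<^sup>2) ^ 4 * exp (- (exp (- x / 2) / 4))) \<le> C * exp (- \<bar>x\<bar> / 2)"
proof -
  let ?W = "\<lambda>x::real. 120 * (1 + x\<^sup>2)\<^sup>2 * gumbel_density x +
       30000 * (exp (- x))\<^sup>2 * (1 + x\<^sup>2) ^ 4 * exp (- (exp (- x / 2) / 4))"
  have cont: "continuous_on UNIV ?W" unfolding gumbel_density_def by (intro continuous_intros) auto
  have "((\<lambda>x. ?W x * exp (1 / 2 * x)) \<longlongrightarrow> 0) at_top"
    "((\<lambda>x. ?W x * exp (1 / 2 * x)) \<longlongrightarrow> 0) at_bot"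
    "((\<lambda>x. ?W x * exp (- (1 / 2) * x)) \<longlongrightarrow> 0) at_top"
    "((\<lambda>x. ?W x * exp (- (1 / 2) * x)) \<longlongrightarrow> 0) at_bot"
    unfolding gumbel_density_def by real_asymp+
  from exponential_decay_bound[OF cont this]
  obtain C where C: "C > 0" "\<And>x. \<bar>?W x\<bar> \<le> C * exp (- (1/2) * \<bar>x\<bar>)" by blast
  show thesis
  proof (rule that[OF C(1)])
    show "?W x \<le> C * exp (- \<bar>x\<bar> / 2)" for x
      using order_trans[OF abs_ge_self C(2), of x] by simp
  qed
qed

lemma gumbel_correction_bound:
  obtains C where "C > 0" "\<And>x. \<bar>gumbel_correction x\<bar> \<le> C * exp (- (3 / 4) * \<bar>x\<bar>)"
proof -
  have cont: "continuous_on UNIV gumbel_correction"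
    unfolding gumbel_correction_def gumbel_density_def by (intro continuous_intros) auto
  have "((\<lambda>x. gumbel_correction x * exp (3 / 4 * x)) \<longlongrightarrow> 0) at_top"
    "((\<lambda>x. gumbel_correction x * exp (3 / 4 * x)) \<longlongrightarrow> 0) at_bot"
    "((\<lambda>x. gumbel_correction x * exp (- (3 / 4) * x)) \<longlongrightarrow> 0) at_top"
    "((\<lambda>x. gumbel_correction x * exp (- (3 / 4) * x)) \<longlongrightarrow> 0) at_bot"
    unfolding gumbel_correction_def gumbel_density_def by real_asymp+
  from exponential_decay_bound[OF cont this] that show thesis by blast
qed

section \<open>Powers of the normal distribution function at the exact scale\<close>

text \<open>
  The purely algebraic part of the expansion, with \<open>\<epsilon> = 1 / b\<^sup>2\<close>. The first three factors contribute the
  three summands \<open>x\<^sup>2 / 2\<close>, \<open>x\<close> and \<open>1\<close> of the first-order term; \<open>m\<close> stands for Mills' ratio at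
  \<open>b + x / b\<close> times \<open>b + x / b\<close>, and \<open>1 + \<zeta>\<close> for \<open>- ln (1 - q) / q\<close>, which is
  \<open>1 + O(\<epsilon>\<^sup>2)\<close> because the tail probability \<open>q\<close> is tiny. The condition \<open>\<bar>x \<epsilon>\<bar> \<le> 1 / 2\<close> keeps the location \<open>b (1 + x \<epsilon>)\<close> at least \<open>b / 2\<close>.
\<close>
lemma tail_factor_expansion:
  fixes \<epsilon> x m \<zeta> :: real
  assumes \<epsilon>: "0 < \<epsilon>" "\<epsilon> \<le> 1/16" and v: "\<bar>x * \<epsilon>\<bar> \<le> 1/2"
    and m: "1 - \<epsilon> / (1 + x * \<epsilon>)\<^sup>2 \<le> m" "m \<le> 1 - \<epsilon> / (1 + x * \<epsilon>)\<^sup>2 + 3 * \<epsilon>\<^sup>2 / (1 + x * \<epsilon>) ^ 4"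
    and \<zeta>: "0 \<le> \<zeta>" "\<zeta> \<le> \<epsilon>\<^sup>2"
  shows "\<bar>exp (- (x\<^sup>2 * \<epsilon> / 2)) / (1 + x * \<epsilon>) * m * (1 + \<zeta>) - (1 - \<epsilon> * (x\<^sup>2 / 2 + x + 1))\<bar>
      \<le> 120 * \<epsilon>\<^sup>2 * (1 + x\<^sup>2)\<^sup>2"
    and "1 / 2 \<le> m" and "m \<le> 1"
proof -
  define v where "v = x * \<epsilon>"
  define U where "U = 1 / (1 + v)"
  have vb: "\<bar>v\<bar> \<le> 1/2" using v by (simp add: v_def)
  have U: "0 < U" "U \<le> 2" "U * (1 + v) = 1" using vb by (auto simp: U_def field_simps)
  have U1: "U - 1 = - v * U" using U(3) by (simp add: algebra_simps)
  have U2: "U\<^sup>2 \<le> 4" using power_mono[of U 2 2] U by simp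
  have m': "1 - \<epsilon> * U\<^sup>2 \<le> m" "m \<le> 1 - \<epsilon> * U\<^sup>2 + 3 * \<epsilon>\<^sup>2 * U ^ 4"
    using m by (auto simp: U_def v_def power_divide)
  have eU: "0 \<le> \<epsilon> * U\<^sup>2" "\<epsilon> * U\<^sup>2 \<le> 1/4"
    using mult_mono[OF \<epsilon>(2) U2] \<epsilon> by auto
  have U4: "\<epsilon>\<^sup>2 * U ^ 4 = (\<epsilon> * U\<^sup>2) * (\<epsilon> * U\<^sup>2)" by (simp add: eval_nat_numeral)
  have "3 * (\<epsilon>\<^sup>2 * U ^ 4) \<le> 3 * (\<epsilon> * U\<^sup>2 * (1/4))"
    unfolding U4 using eU by (intro mult_left_mono) auto
  then show m1: "m \<le> 1" using m' eU by simp
  show m2: "1 / 2 \<le> m" using m' eU by simp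
  define A where "A = exp (- (x\<^sup>2 * \<epsilon> / 2))"
  define h where "h = x\<^sup>2 * \<epsilon> / 2"
  define D where "D = U * m * (1 + \<zeta>)"
  have \<zeta>1: "\<zeta> \<le> 1" using \<zeta> power_mono[of \<epsilon> 1 2] \<epsilon> by simp
  have h0: "h \<ge> 0" using \<epsilon> by (simp add: h_def)
  have "x\<^sup>2 * \<epsilon> \<le> x\<^sup>2 * 1" using \<epsilon> by (intro mult_left_mono) auto
  then have x2h: "h \<le> x\<^sup>2" unfolding h_def using zero_le_power2[of x] by linarith
  have A: "\<bar>A - (1 - h)\<bar> \<le> h\<^sup>2"
    using exp_minus_taylor2[of 0 h] h0 unfolding A_def h_def[symmetric]
    by (simp add: min_absorb2 algebra_simps)
  have "U * m \<le> 2 * 1" using U m1 m2 by (intro mult_mono) auto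
  then have Um: "0 \<le> U * m" "U * m \<le> 2" using U m2 by auto
  have D: "0 \<le> D" "D \<le> 4"
    using mult_mono[of "U * m" 2 "1 + \<zeta>" 2] Um \<zeta> \<zeta>1 by (auto simp: D_def)
  have D1: "\<bar>D - (1 - v - \<epsilon>)\<bar> \<le> \<epsilon>\<^sup>2 * (110 * (1 + x\<^sup>2))"
  proof -
    have "U - (1 - v) = v * (1 - U)" using U1 by (simp add: algebra_simps)
    also have "1 - U = v * U" using U1 by simp
    finally have "U - (1 - v) = v\<^sup>2 * U" by (simp add: power2_eq_square)
    then have a: "\<bar>U - (1 - v)\<bar> \<le> v\<^sup>2 * 2" using U by (simp add: abs_mult mult_left_mono)
    have "U ^ 3 - 1 = (U - 1) * (U\<^sup>2 + U + 1)" by (simp add: eval_nat_numeral algebra_simps)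
    also have "\<bar>\<dots>\<bar> = \<bar>v\<bar> * (U * (U\<^sup>2 + U + 1))"
      unfolding U1 using U by (simp add: abs_mult)
    also have "\<dots> \<le> \<bar>v\<bar> * (2 * (4 + 2 + 1))"
      using U U2 by (intro mult_left_mono mult_mono add_mono) auto
    finally have b0: "\<bar>U ^ 3 - 1\<bar> \<le> \<bar>v\<bar> * 14" by simp
    have "\<epsilon> * U ^ 3 - \<epsilon> = \<epsilon> * (U ^ 3 - 1)" by (simp add: algebra_simps)
    then have b: "\<bar>\<epsilon> * U ^ 3 - \<epsilon>\<bar> \<le> \<epsilon> * (\<bar>v\<bar> * 14)"
      using b0 \<epsilon> by (simp add: abs_mult)
    have "U ^ 4 * U \<le> 16 * 2"
      using power_mono[of U 2 4] U by (intro mult_mono) auto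
    then have U5: "3 * \<epsilon>\<^sup>2 * (U ^ 4 * U) \<le> 3 * \<epsilon>\<^sup>2 * 32" by (intro mult_left_mono) auto
    have "U * (m - (1 - \<epsilon> * U\<^sup>2)) \<le> U * (3 * \<epsilon>\<^sup>2 * U ^ 4)"
      using m' U by (intro mult_left_mono) auto
    also have "\<dots> = 3 * \<epsilon>\<^sup>2 * (U ^ 4 * U)" by simp
    finally have "U * (m - (1 - \<epsilon> * U\<^sup>2)) \<le> 96 * \<epsilon>\<^sup>2" using U5 by linarith
    moreover have "0 \<le> U * (m - (1 - \<epsilon> * U\<^sup>2))" using m' U by simp
    moreover have "U * (m - (1 - \<epsilon> * U\<^sup>2)) = U * m - U + \<epsilon> * U ^ 3"
      by (simp add: eval_nat_numeral algebra_simps)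
    ultimately have c: "\<bar>U * m - U + \<epsilon> * U ^ 3\<bar> \<le> 96 * \<epsilon>\<^sup>2" by simp
    have "U * m * \<zeta> \<le> 2 * \<epsilon>\<^sup>2" using Um \<zeta> by (intro mult_mono) auto
    moreover have "0 \<le> U * m * \<zeta>" using Um \<zeta> by simp
    ultimately have d: "\<bar>D - U * m\<bar> \<le> 2 * \<epsilon>\<^sup>2" by (simp add: D_def algebra_simps)
    have "\<bar>D - (1 - v - \<epsilon>)\<bar> \<le> v\<^sup>2 * 2 + \<epsilon> * (\<bar>v\<bar> * 14) + 98 * \<epsilon>\<^sup>2"
      using a b c d by linarith
    also have "\<dots> = \<epsilon>\<^sup>2 * (2 * x\<^sup>2 + 14 * \<bar>x\<bar> + 98)"
      using \<epsilon> by (simp add: v_def abs_mult power2_eq_square algebra_simps)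
    also have "\<dots> \<le> \<epsilon>\<^sup>2 * (110 * (1 + x\<^sup>2))"
    proof (intro mult_left_mono)
      have "2 * \<bar>x\<bar> \<le> 1 + \<bar>x\<bar>\<^sup>2" using zero_le_power2[of "\<bar>x\<bar> - 1"] by (simp add: power2_diff del: zero_le_power2)
      then have x: "2 * \<bar>x\<bar> \<le> 1 + x\<^sup>2" by simp
      have key: "2 * y + 14 * a + 98 \<le> 110 * (1 + y)" if "2 * a \<le> 1 + y" "0 \<le> y" for a y :: real
        using that by simp
      show "2 * x\<^sup>2 + 14 * \<bar>x\<bar> + 98 \<le> 110 * (1 + x\<^sup>2)" by (rule key[OF x]) simp
    qed auto
    finally show ?thesis .
  qed
  let ?X = "\<epsilon>\<^sup>2 * (1 + x\<^sup>2)\<^sup>2"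
  have split: "A * D - (1 - \<epsilon> * (x\<^sup>2 / 2 + x + 1)) =
      (A - (1 - h)) * D + (1 - h) * (D - (1 - v - \<epsilon>)) + h * (v + \<epsilon>)"
  proof -
    have "1 - \<epsilon> * (x\<^sup>2 / 2 + x + 1) = 1 - h - v - \<epsilon>" by (simp add: h_def v_def field_simps)
    then show ?thesis by (simp add: algebra_simps)
  qed
  have e1: "\<bar>(A - (1 - h)) * D\<bar> \<le> ?X"
  proof -
    have "\<bar>(A - (1 - h)) * D\<bar> \<le> h\<^sup>2 * 4"
      unfolding abs_mult using A D by (intro mult_mono) auto
    also have "\<dots> = \<epsilon>\<^sup>2 * (x\<^sup>2)\<^sup>2" by (simp add: h_def power2_eq_square)
    also have "\<dots> \<le> ?X" by (intro mult_left_mono power_mono) auto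
    finally show ?thesis .
  qed
  have e2: "\<bar>(1 - h) * (D - (1 - v - \<epsilon>))\<bar> \<le> 110 * ?X"
  proof -
    have "\<bar>(1 - h) * (D - (1 - v - \<epsilon>))\<bar> \<le> (1 + x\<^sup>2) * (\<epsilon>\<^sup>2 * (110 * (1 + x\<^sup>2)))"
      unfolding abs_mult using D1 h0 x2h by (intro mult_mono) auto
    then show ?thesis by (simp add: power2_eq_square mult_ac)
  qed
  have e3: "\<bar>h * (v + \<epsilon>)\<bar> \<le> ?X"
  proof -
    have "h * (v + \<epsilon>) = \<epsilon>\<^sup>2 * ((x\<^sup>2 / 2) * (x + 1))"
      by (simp add: h_def v_def power2_eq_square algebra_simps)
    also have "\<bar>\<dots>\<bar> = \<epsilon>\<^sup>2 * ((x\<^sup>2 / 2) * \<bar>x + 1\<bar>)" by (simp add: abs_mult)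
    also have "\<dots> \<le> \<epsilon>\<^sup>2 * ((1 + x\<^sup>2) * (1 + x\<^sup>2))"
    proof (intro mult_left_mono)
      have "\<bar>x + 1\<bar> / 2 \<le> 1 + x\<^sup>2"
      proof -
        have key: "\<bar>x + 1\<bar> / 2 \<le> 1 + y" if "0 \<le> y + 1 - 2 * x" "0 \<le> y + 1 + 2 * x" "0 \<le> y" for y
        proof -
          have "x + 1 \<le> 2 + 2 * y" "- (x + 1) \<le> 2 + 2 * y" using that by linarith+
          then have "\<bar>x + 1\<bar> \<le> 2 + 2 * y" by (rule abs_leI)
          then show ?thesis by simp
        qed
        show ?thesis
          using zero_le_power2[of "x - 1"] zero_le_power2[of "x + 1"]
          by (intro key) (simp_all add: power2_diff power2_sum algebra_simps del: zero_le_power2)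
      qed
      then show "x\<^sup>2 / 2 * \<bar>x + 1\<bar> \<le> (1 + x\<^sup>2) * (1 + x\<^sup>2)"
        using mult_mono[of "x\<^sup>2" "1 + x\<^sup>2" "\<bar>x + 1\<bar> / 2" "1 + x\<^sup>2"] by simp
    qed auto
    finally show ?thesis by (simp add: power2_eq_square)
  qed
  have "\<bar>A * D - (1 - \<epsilon> * (x\<^sup>2 / 2 + x + 1))\<bar> \<le> 112 * ?X"
    unfolding split using e1 e2 e3 by linarith
  also have "\<dots> \<le> 120 * ?X" by simp
  finally show "\<bar>exp (- (x\<^sup>2 * \<epsilon> / 2)) / (1 + x * \<epsilon>) * m * (1 + \<zeta>) - (1 - \<epsilon> * (x\<^sup>2 / 2 + x + 1))\<bar>
      \<le> 120 * \<epsilon>\<^sup>2 * (1 + x\<^sup>2)\<^sup>2"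
    by (simp add: A_def D_def U_def v_def mult_ac)
qed

text \<open>
  A single sample size \<open>n\<close> with its exact scale \<open>b\<close>. The value \<open>4\<close> guarantees that \<open>b / 2 \<ge> 2\<close>, so that
  the bounds on Mills' ratio hold on the whole central region \<open>\<bar>x\<bar> \<le> b\<^sup>2 / 2\<close>.
\<close>
locale normal_scaling =
  fixes b :: real and n :: nat
  assumes b4: "b \<ge> 4" and scaling: "2 * pi * b\<^sup>2 * exp (b\<^sup>2) = (real n)\<^sup>2"
begin

text \<open>
  This identity is the reason for the choice of \<open>b\<close>: it makes the expected number of exceedances of
  \<open>b + x / b\<close> equal to \<open>exp (- x)\<close> to leading order.
\<close>
lemma n_density: "real n * std_normal_density b = b"
proof -
  have "real n = sqrt (2 * pi * b\<^sup>2 * exp (b\<^sup>2))" unfolding scaling by simp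
  also have "\<dots> = sqrt (2 * pi) * b * sqrt (exp (b\<^sup>2))" using b4 by (simp add: real_sqrt_mult)
  also have "sqrt (exp (b\<^sup>2)) = exp (b\<^sup>2 / 2)" by (rule real_sqrt_unique) (auto simp: exp_double[symmetric])
  finally show ?thesis by (simp add: std_normal_density_def exp_minus)
qed

lemma n_ge_2: "n \<ge> 2"
proof -
  have "b \<noteq> 0" using b4 by auto
  then have "n \<noteq> 0" using scaling by (intro notI) simp
  have "4 ^ 2 \<le> b ^ 2" using b4 by (intro power_mono) auto
  have "4 \<le> 2 * pi" using pi_ge_two by simp
  then have "4 * 1 * 1 \<le> 2 * pi * b\<^sup>2 * exp (b\<^sup>2)"
    using \<open>4 ^ 2 \<le> b ^ 2\<close> by (intro mult_mono) auto
  then have "2\<^sup>2 \<le> (real n)\<^sup>2" using scaling by simp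
  then have "2 \<le> real n" by (rule power2_le_imp_le) simp
  then show ?thesis by simp
qed

lemma n_density_shift:
  assumes "b + x / b > 0"
  shows "real n * (std_normal_density (b + x / b) / (b + x / b)) =
    exp (- x) * (exp (- (x\<^sup>2 * (1 / b\<^sup>2) / 2)) / (1 + x * (1 / b\<^sup>2)))"
proof -
  have b: "b > 0" using b4 by simp
  have u: "b + x / b = b * (1 + x * (1 / b\<^sup>2))" using b by (simp add: field_simps power2_eq_square)
  have sq: "(b + x / b)\<^sup>2 = b\<^sup>2 + 2 * x + x\<^sup>2 * (1 / b\<^sup>2)"
    using b by (simp add: power2_sum power_divide)
  have e: "- (b + x / b)\<^sup>2 / 2 = - b\<^sup>2 / 2 + (- x + - (x\<^sup>2 * (1 / b\<^sup>2) / 2))"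
    unfolding sq by (simp add: field_simps)
  have "std_normal_density (b + x / b) =
      std_normal_density b * (exp (- x) * exp (- (x\<^sup>2 * (1 / b\<^sup>2) / 2)))"
    unfolding std_normal_density_def e exp_add by simp
  then have "real n * (std_normal_density (b + x / b) / (b + x / b)) =
      (real n * std_normal_density b) * (exp (- x) * exp (- (x\<^sup>2 * (1 / b\<^sup>2) / 2))) / (b + x / b)"
    by simp
  also have "\<dots> = exp (- x) * (exp (- (x\<^sup>2 * (1 / b\<^sup>2) / 2)) / (1 + x * (1 / b\<^sup>2)))"
    unfolding n_density unfolding u using b by simp
  finally show ?thesis .
qed

lemma location_bounds:
  assumes "\<bar>x\<bar> \<le> b\<^sup>2 / 2"
  shows "b + x / b \<ge> b / 2" "b + x / b \<ge> 2" "\<bar>x * (1 / b\<^sup>2)\<bar> \<le> 1 / 2"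
    "0 < 1 / b\<^sup>2" "1 / b\<^sup>2 \<le> 1 / 16"
proof -
  have b: "b > 0" using b4 by simp
  show "b + x / b \<ge> b / 2" using assms b by (simp add: field_simps power2_eq_square abs_le_iff)
  then show "b + x / b \<ge> 2" using b4 by linarith
  show "\<bar>x * (1 / b\<^sup>2)\<bar> \<le> 1 / 2" using assms b by (simp add: abs_mult field_simps)
  show "0 < 1 / b\<^sup>2" using b by simp
  have "4 ^ 2 \<le> b ^ 2" using b4 by (intro power_mono) auto
  then show "1 / b\<^sup>2 \<le> 1 / 16" using b by (simp add: field_simps)
qed

lemma n_tail_bounds:
  assumes "\<bar>x\<bar> \<le> b\<^sup>2 / 2"
  obtains m where
    "real n * (1 - std_normal_cdf (b + x / b)) =
      exp (- x) * (exp (- (x\<^sup>2 * (1 / b\<^sup>2) / 2)) / (1 + x * (1 / b\<^sup>2)) * m)"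
    "1 - (1 / b\<^sup>2) / (1 + x * (1 / b\<^sup>2))\<^sup>2 \<le> m"
    "m \<le> 1 - (1 / b\<^sup>2) / (1 + x * (1 / b\<^sup>2))\<^sup>2 + 3 * (1 / b\<^sup>2)\<^sup>2 / (1 + x * (1 / b\<^sup>2)) ^ 4"
proof -
  have b: "b > 0" using b4 by simp
  let ?u = "b + x / b"
  note loc = location_bounds[OF assms]
  have u: "?u = b * (1 + x * (1 / b\<^sup>2))" using b by (simp add: field_simps power2_eq_square)
  define r where "r = std_normal_density ?u / ?u"
  have r: "r > 0" using loc by (simp add: r_def normal_density_pos)
  \<comment> \<open>Mills' ratio at \<open>?u\<close>, normalized so that it tends to \<open>1\<close>\<close>
  define m where "m = (1 - std_normal_cdf ?u) / r"
  have tail: "1 - std_normal_cdf ?u = r * m" using r by (simp add: m_def)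
  show thesis
  proof (rule that[of m])
    show "real n * (1 - std_normal_cdf ?u) =
      exp (- x) * (exp (- (x\<^sup>2 * (1 / b\<^sup>2) / 2)) / (1 + x * (1 / b\<^sup>2)) * m)"
    proof -
      have "?u > 0" using loc by linarith
      from n_density_shift[OF this] show ?thesis
        unfolding tail r_def[symmetric] by (simp only: mult.assoc[symmetric])
    qed
    have mm: "1 - 1 / ?u\<^sup>2 \<le> m" "m \<le> 1 - 1 / ?u\<^sup>2 + 3 / ?u ^ 4"
      using mills_ratio_bounds[OF loc(2)] r unfolding tail r_def[symmetric] by auto
    have u2: "1 / ?u\<^sup>2 = (1 / b\<^sup>2) / (1 + x * (1 / b\<^sup>2))\<^sup>2"
      unfolding u by (simp add: power_mult_distrib)
    have u4: "3 / ?u ^ 4 = 3 * (1 / b\<^sup>2)\<^sup>2 / (1 + x * (1 / b\<^sup>2)) ^ 4"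
      unfolding u by (simp add: power_mult_distrib power_divide flip: power_mult)
    show "1 - (1 / b\<^sup>2) / (1 + x * (1 / b\<^sup>2))\<^sup>2 \<le> m"
      "m \<le> 1 - (1 / b\<^sup>2) / (1 + x * (1 / b\<^sup>2))\<^sup>2 + 3 * (1 / b\<^sup>2)\<^sup>2 / (1 + x * (1 / b\<^sup>2)) ^ 4"
      using mm unfolding u2 u4 by auto
  qed
qed

lemma n_tail_le_of_nonneg:
  assumes "x \<ge> 0"
  shows "real n * (1 - std_normal_cdf (b + x / b)) \<le> exp (- x)"
proof -
  have b: "b > 0" using b4 by simp
  let ?u = "b + x / b"
  have u: "?u \<ge> 2" using b4 assms b by (simp add: add_increasing2)
  have u2: "?u\<^sup>2 \<ge> 4" using power_mono[of 2 ?u 2] u by simp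
  have "?u ^ 4 = ?u\<^sup>2 * ?u\<^sup>2" by (simp add: eval_nat_numeral)
  moreover have "3 / (w * w) \<le> 1 / w" if "w \<ge> 4" for w :: real using that by (simp add: field_simps)
  ultimately have le1: "1 - 1 / ?u\<^sup>2 + 3 / ?u ^ 4 \<le> 1" using u2 by fastforce
  have "1 - std_normal_cdf ?u \<le> std_normal_density ?u / ?u * (1 - 1 / ?u\<^sup>2 + 3 / ?u ^ 4)"
    using mills_ratio_bounds[OF u] by simp
  also have "\<dots> \<le> std_normal_density ?u / ?u" using u le1 by (intro mult_left_le) auto
  finally have "real n * (1 - std_normal_cdf ?u) \<le> real n * (std_normal_density ?u / ?u)"
    by (intro mult_left_mono) auto
  also have "\<dots> = exp (- x) * (exp (- (x\<^sup>2 * (1 / b\<^sup>2) / 2)) / (1 + x * (1 / b\<^sup>2)))"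
    using u by (intro n_density_shift) auto
  also have "\<dots> \<le> exp (- x) * 1"
  proof (intro mult_left_mono)
    have "0 \<le> x * (1 / b\<^sup>2)" using assms by simp
    moreover have "exp (- (x\<^sup>2 * (1 / b\<^sup>2) / 2)) \<le> 1" by simp
    ultimately show "exp (- (x\<^sup>2 * (1 / b\<^sup>2) / 2)) / (1 + x * (1 / b\<^sup>2)) \<le> 1"
      by (simp add: divide_le_eq add_pos_nonneg del: exp_le_one_iff)
  qed auto
  finally show ?thesis by simp
qed

text \<open>
  In the left half of the central region the Gaussian factor is at least \<open>exp (x / 4)\<close>, as
  \<open>x\<^sup>2 / (2 b\<^sup>2) \<le> \<bar>x\<bar> / 4\<close> there. What is left is still exponentially large, so that
  \<open>\<Phi> (b + x / b) ^ n\<close> is doubly exponentially small.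
\<close>
lemma n_tail_ge_of_nonpos:
  assumes "x \<le> 0" "\<bar>x\<bar> \<le> b\<^sup>2 / 2"
  shows "exp (- (3 / 4) * x) / 2 \<le> real n * (1 - std_normal_cdf (b + x / b))"
proof -
  note loc = location_bounds[OF assms(2)]
  obtain m where m: "real n * (1 - std_normal_cdf (b + x / b)) =
      exp (- x) * (exp (- (x\<^sup>2 * (1 / b\<^sup>2) / 2)) / (1 + x * (1 / b\<^sup>2)) * m)"
    "1 - (1 / b\<^sup>2) / (1 + x * (1 / b\<^sup>2))\<^sup>2 \<le> m"
    "m \<le> 1 - (1 / b\<^sup>2) / (1 + x * (1 / b\<^sup>2))\<^sup>2 + 3 * (1 / b\<^sup>2)\<^sup>2 / (1 + x * (1 / b\<^sup>2)) ^ 4"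
    by (rule n_tail_bounds[OF assms(2)])
  have mh: "1 / 2 \<le> m"
    by (rule tail_factor_expansion(2)[OF loc(4,5,3) m(2,3), of 0]) auto
  let ?v = "x * (1 / b\<^sup>2)"
  have "x\<^sup>2 * (1 / b\<^sup>2) = \<bar>x\<bar> * \<bar>?v\<bar>" by (simp add: power2_eq_square abs_mult)
  also have "\<dots> \<le> \<bar>x\<bar> * (1 / 2)" using loc(3) by (intro mult_left_mono) auto
  finally have A: "exp (x / 4) \<le> exp (- (x\<^sup>2 * (1 / b\<^sup>2) / 2))" using assms(1) by simp
  have "?v \<le> 0" using assms(1) by (simp add: divide_nonpos_nonneg)
  then have v: "0 < 1 + ?v" "1 + ?v \<le> 1" using loc(3) by linarith+
  have "exp (x / 4) \<le> exp (- (x\<^sup>2 * (1 / b\<^sup>2) / 2)) / (1 + ?v)"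
    using order_trans[OF A, of "exp (- (x\<^sup>2 * (1 / b\<^sup>2) / 2)) / (1 + ?v)"] v
      divide_left_mono[of "1 + ?v" 1 "exp (- (x\<^sup>2 * (1 / b\<^sup>2) / 2))"] by simp
  then have "exp (x / 4) * (1 / 2) \<le> exp (- (x\<^sup>2 * (1 / b\<^sup>2) / 2)) / (1 + ?v) * m"
    using mh v by (intro mult_mono) auto
  then have "exp (- x) * (exp (x / 4) * (1 / 2)) \<le> real n * (1 - std_normal_cdf (b + x / b))"
    unfolding m(1) by (intro mult_left_mono) auto
  also have "exp (- x) * (exp (x / 4) * (1 / 2)) = exp (- x + x / 4) / 2" by (simp only: exp_add)
  also have "- x + x / 4 = - (3 / 4) * x" by simp
  finally show ?thesis .
qed

text \<open>
  With \<open>q = 1 - \<Phi> (b + x / b)\<close> one has \<open>\<Phi> (b + x / b) ^ n = exp (n ln (1 - q)) = exp (- T \<theta>)\<close>, where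
  \<open>T = exp (- x)\<close> and \<open>\<theta>\<close> is the product treated in \<open>tail_factor_expansion\<close>. A second order Taylor
  expansion of \<open>exp\<close> around \<open>- T\<close> leaves the two error terms on the right: the error of \<open>\<theta>\<close>, and the
  square of \<open>T (\<theta> - 1)\<close>.
\<close>
lemma power_cdf_expansion_central:
  assumes x: "\<bar>x\<bar> \<le> b\<^sup>2 / 2" and Q: "2 * exp (- b\<^sup>2 / 8) \<le> 1 / b ^ 4"
  shows "\<bar>std_normal_cdf (b + x / b) ^ n - gumbel_cdf x - gumbel_correction x / b\<^sup>2\<bar>
    \<le> 1 / b ^ 4 * (120 * (1 + x\<^sup>2)\<^sup>2 * gumbel_density x +
       30000 * (exp (- x))\<^sup>2 * (1 + x\<^sup>2) ^ 4 * exp (- (exp (- x / 2) / 4)))"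
proof -
  have b: "b > 0" using b4 by simp
  note loc = location_bounds[OF x]
  define e where "e = 1 / b\<^sup>2"
  have e2: "e\<^sup>2 = 1 / b ^ 4" by (simp add: e_def power_divide flip: power_mult)
  define q where "q = 1 - std_normal_cdf (b + x / b)"
  define T where "T = exp (- x)"
  obtain m where m: "real n * q = T * (exp (- (x\<^sup>2 * e / 2)) / (1 + x * e) * m)"
    "1 - e / (1 + x * e)\<^sup>2 \<le> m" "m \<le> 1 - e / (1 + x * e)\<^sup>2 + 3 * e\<^sup>2 / (1 + x * e) ^ 4"
    unfolding q_def T_def e_def by (rule n_tail_bounds[OF x])
  have loc': "\<bar>x * e\<bar> \<le> 1 / 2" "0 < e" "e \<le> 1 / 16" using loc by (auto simp: e_def)
  have mh: "1 / 2 \<le> m" "m \<le> 1"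
    using tail_factor_expansion(2,3)[OF loc'(2,3,1) m(2,3), of 0] by auto
  have n: "real n > 0" using n_ge_2 by simp
  have "real n * q > 0" unfolding m(1) T_def using loc' mh by (intro mult_pos_pos divide_pos_pos) auto
  then have q0: "q > 0" using n by (simp add: zero_less_mult_iff)
  \<comment> \<open>The tail at \<open>b / 2\<close> is already far smaller than the square of \<open>1 / b\<^sup>2\<close>.\<close>
  have q1: "2 * q \<le> e\<^sup>2"
  proof -
    have "std_normal_cdf (b / 2) \<le> std_normal_cdf (b + x / b)"
      using std_normal_cdf_mono loc(1) by (auto simp: mono_def)
    then have "q \<le> 1 - std_normal_cdf (b / 2)" by (simp add: q_def)
    also have "\<dots> \<le> - (- exp (- (b/2) * (b/2) / 2))"
    proof (rule std_normal_tail_upper[where F = "\<lambda>x. - exp (- x * x / 2)" and f = "\<lambda>x. x * exp (- x * x / 2)"])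
      show "((\<lambda>x::real. - exp (- x * x / 2)) \<longlongrightarrow> 0) at_top" by real_asymp
      fix y assume y: "b / 2 \<le> y"
      show "((\<lambda>x. - exp (- x * x / 2)) has_real_derivative y * exp (- y * y / 2)) (at y)"
        by (auto intro!: derivative_eq_intros)
      have "1 \<le> sqrt (2 * pi)" using pi_ge_two by simp
      then have "1 / sqrt (2 * pi) \<le> 1" by simp
      also have "1 \<le> y" using y b4 by simp
      finally have "1 / sqrt (2 * pi) * exp (- y * y / 2) \<le> y * exp (- y * y / 2)"
        by (intro mult_right_mono) auto
      then show "std_normal_density y \<le> y * exp (- y * y / 2)"
        unfolding std_normal_density_def by (simp add: power2_eq_square)
    qed simp
    also have "\<dots> = exp (- b\<^sup>2 / 8)" by (simp add: power2_eq_square)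
    finally show ?thesis using Q unfolding e2 by linarith
  qed
  have "e\<^sup>2 \<le> 1 / 2" using power_mono[OF loc'(3), of 2] loc' by (simp add: power2_eq_square)
  with q1 have qh: "q \<le> 1 / 2" using q0 by linarith
  define z where "z = - ln (1 - q) / q - 1"
  have lq: "- ln (1 - q) = q * (1 + z)" using q0 by (simp add: z_def)
  have z0: "z \<ge> 0"
    using ln_le_minus_one[of "1 - q"] q0 qh by (simp add: z_def field_simps)
  have "- ln (1 - q) \<le> q + 2 * q\<^sup>2"
    using ln_one_minus_pos_lower_bound[of q] q0 qh by linarith
  then have "q * (1 + z) \<le> q * (1 + 2 * q)" unfolding lq by (simp add: power2_eq_square distrib_left)
  then have "1 + z \<le> 1 + 2 * q" using q0 by (rule mult_left_le_imp_le)
  then have z1: "z \<le> e\<^sup>2" using q1 by linarith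
  define \<theta> where "\<theta> = exp (- (x\<^sup>2 * e / 2)) / (1 + x * e) * m * (1 + z)"
  define p where "p = x\<^sup>2 / 2 + x + 1"
  have th: "\<bar>\<theta> - (1 - e * p)\<bar> \<le> 120 * e\<^sup>2 * (1 + x\<^sup>2)\<^sup>2"
    unfolding \<theta>_def p_def by (rule tail_factor_expansion(1)[OF loc'(2,3,1) m(2,3) z0 z1])
  have F: "std_normal_cdf (b + x / b) ^ n = exp (- (T * \<theta>))"
  proof -
    have "std_normal_cdf (b + x / b) ^ n = (1 - q) ^ n" by (simp add: q_def)
    also have "\<dots> = exp (real n * ln (1 - q))" using qh by (simp add: exp_of_nat_mult)
    also have "ln (1 - q) = - (q * (1 + z))" using lq by linarith
    also have "real n * (- (q * (1 + z))) = - ((real n * q) * (1 + z))" by simp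
    also have "\<dots> = - (T * \<theta>)" unfolding m(1) \<theta>_def by (simp add: mult.assoc)
    finally show ?thesis .
  qed
  have p0: "\<bar>p\<bar> \<le> 2 * (1 + x\<^sup>2)"
  proof -
    have "0 \<le> ((x + 1)\<^sup>2 + 1) / 2" by simp
    also have "\<dots> = p" by (simp add: p_def power2_eq_square field_simps)
    finally have "0 \<le> p" .
    have "0 \<le> (2 * x\<^sup>2 + (x - 1)\<^sup>2 + 1) / 2" by simp
    also have "\<dots> = 2 * (1 + x\<^sup>2) - p" by (simp add: p_def power2_eq_square field_simps)
    finally have "p \<le> 2 * (1 + x\<^sup>2)" by simp
    with \<open>0 \<le> p\<close> show ?thesis by simp
  qed
  let ?y = "1 + x\<^sup>2"
  have y1: "?y \<ge> 1" by simp
  have th1: "\<bar>\<theta> - 1\<bar> \<le> e * (122 * ?y\<^sup>2)"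
  proof -
    have "\<bar>e * p\<bar> \<le> e * (2 * ?y)" unfolding abs_mult using loc' p0 by (intro mult_mono) auto
    also have "\<dots> \<le> e * (2 * ?y\<^sup>2)"
      using loc' self_le_power[OF y1, of 2] by (intro mult_left_mono) auto
    finally have 1: "\<bar>e * p\<bar> \<le> e * (2 * ?y\<^sup>2)" .
    have "120 * e\<^sup>2 * ?y\<^sup>2 = e * (e * (120 * ?y\<^sup>2))" by (simp add: power2_eq_square)
    also have "\<dots> \<le> e * (1 * (120 * ?y\<^sup>2))"
      using loc' by (intro mult_left_mono mult_right_mono) auto
    finally have 2: "120 * e\<^sup>2 * ?y\<^sup>2 \<le> e * (120 * ?y\<^sup>2)" by simp
    have "e * (122 * ?y\<^sup>2) = e * (2 * ?y\<^sup>2) + e * (120 * ?y\<^sup>2)" by (simp add: algebra_simps)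
    then show ?thesis using 1 2 th by linarith
  qed
  \<comment> \<open>On the right half line the double exponential is bounded below, so the factor \<open>2\<close> makes the bound trivial.\<close>
  have mi: "exp (- min (T * \<theta>) T) \<le> 2 * exp (- (exp (- x / 2) / 4))"
  proof (cases "x \<ge> 0")
    case True
    have "0 \<le> min (T * \<theta>) T" using loc' mh z0 by (auto simp: T_def \<theta>_def)
    then have "exp (- min (T * \<theta>) T) \<le> 1" by simp
    also have "1 \<le> 2 * exp (- (1 / 4 :: real))"
      using exp_ge_add_one_self[of "- (1/4)"] by simp
    also have "\<dots> \<le> 2 * exp (- (exp (- x / 2) / 4))" using True by simp
    finally show ?thesis .
  next
    case False
    have "exp (- x / 2) / 4 \<le> exp (- x)"
    proof -
      have "exp (- x / 2) \<le> exp (- x)" using False by simp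
      then show ?thesis using exp_gt_zero[of "- x"] by linarith
    qed
    moreover have "exp (- x / 2) / 4 \<le> T * \<theta>"
    proof -
      have "exp (- x / 2) / 4 \<le> exp (- (3 / 4) * x) / 2"
      proof -
        have "exp (- x / 2) \<le> exp (- (3 / 4) * x)" using False by simp
        then show ?thesis using exp_gt_zero[of "- x / 2"] by linarith
      qed
      also have "\<dots> \<le> real n * q" unfolding q_def
        using n_tail_ge_of_nonpos[OF _ x] False by simp
      also have "\<dots> \<le> real n * q * (1 + z)"
        using mult_left_mono[of 1 "1 + z" "real n * q"] z0 q0 n by simp
      also have "\<dots> = T * \<theta>" unfolding m(1) \<theta>_def by (simp add: mult.assoc)
      finally show ?thesis .
    qed
    ultimately have "exp (- min (T * \<theta>) T) \<le> exp (- (exp (- x / 2) / 4))"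
      by (simp add: T_def)
    then show ?thesis by (smt (verit) exp_gt_zero)
  qed
  define h where "h = T * (\<theta> - 1)"
  have hT: "T + h = T * \<theta>" by (simp add: h_def algebra_simps)
  have g: "gumbel_correction x * e = e * p * T * exp (- T)"
    by (simp add: gumbel_correction_def gumbel_density_def p_def T_def)
  have "std_normal_cdf (b + x / b) ^ n - gumbel_cdf x - gumbel_correction x * e =
     (exp (- (T + h)) - exp (- T) + h * exp (- T)) - (\<theta> - (1 - e * p)) * (T * exp (- T))"
    unfolding F g hT by (simp add: gumbel_cdf_def T_def[symmetric] h_def algebra_simps)
  also have "\<bar>\<dots>\<bar> \<le> \<bar>exp (- (T + h)) - exp (- T) + h * exp (- T)\<bar> + \<bar>(\<theta> - (1 - e * p)) * (T * exp (- T))\<bar>"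
    by (rule abs_triangle_ineq4)
  also have "\<bar>(\<theta> - (1 - e * p)) * (T * exp (- T))\<bar> \<le> 120 * e\<^sup>2 * ?y\<^sup>2 * (T * exp (- T))"
    unfolding abs_mult using th by (intro mult_mono) (auto simp: T_def)
  also have "\<bar>exp (- (T + h)) - exp (- T) + h * exp (- T)\<bar> \<le> h\<^sup>2 * exp (- min (T + h) T)"
    by (rule exp_minus_taylor2)
  also have "\<dots> \<le> (T\<^sup>2 * (e * (122 * ?y\<^sup>2))\<^sup>2) * (2 * exp (- (exp (- x / 2) / 4)))"
  proof (intro mult_mono)
    have "(\<theta> - 1)\<^sup>2 \<le> (e * (122 * ?y\<^sup>2))\<^sup>2" using th1 by (metis abs_ge_zero power2_abs power_mono)
    then show "h\<^sup>2 \<le> T\<^sup>2 * (e * (122 * ?y\<^sup>2))\<^sup>2"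
      unfolding h_def power_mult_distrib by (intro mult_left_mono) auto
    show "exp (- min (T + h) T) \<le> 2 * exp (- (exp (- x / 2) / 4))" unfolding hT by (rule mi)
  qed auto
  also have "\<dots> = e\<^sup>2 * (29768 * T\<^sup>2 * ?y ^ 4 * exp (- (exp (- x / 2) / 4)))"
    by (simp add: power_mult_distrib flip: power_mult)
  also have "\<dots> \<le> e\<^sup>2 * (30000 * T\<^sup>2 * ?y ^ 4 * exp (- (exp (- x / 2) / 4)))"
    by (intro mult_left_mono mult_right_mono) auto
  finally show ?thesis
    unfolding e2 by (simp add: e_def T_def gumbel_density_def algebra_simps)
qed

text \<open>
  Far to the left, \<open>n - 1\<close> factors are bounded by their value at \<open>b / 2\<close>, which makes the power tiny
  uniformly in \<open>x\<close>. The remaining factor supplies, through the Chernoff bound with \<open>s = b\<close>, the decay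
  \<open>exp x\<close> that is needed for integrability.
\<close>
lemma power_cdf_left_bound:
  assumes "x < - b\<^sup>2 / 2"
  shows "std_normal_cdf (b + x / b) ^ n \<le> exp (3 * b\<^sup>2 / 2 - exp (3 / 8 * b\<^sup>2) / 4) * exp x"
proof -
  have b: "b > 0" using b4 by simp
  let ?P = std_normal_cdf
  have n1: "n = Suc (n - 1)" using n_ge_2 by simp
  have "b + x / b \<le> b / 2" using assms b by (simp add: field_simps power2_eq_square)
  then have le: "?P (b + x / b) \<le> ?P (b / 2)" using std_normal_cdf_mono by (auto simp: mono_def)
  have "?P (b + x / b) \<le> exp (b * (b + x / b) + b\<^sup>2 / 2)"
    using b by (intro std_normal_cdf_chernoff) auto
  also have "b * (b + x / b) + b\<^sup>2 / 2 = 3 * b\<^sup>2 / 2 + x"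
    using b by (simp add: field_simps power2_eq_square)
  finally have c: "?P (b + x / b) \<le> exp (3 * b\<^sup>2 / 2 + x)" .
  define q where "q = 1 - ?P (b / 2)"
  have "exp (3 / 8 * b\<^sup>2) / 2 \<le> real n * q"
    using n_tail_ge_of_nonpos[of "- (b\<^sup>2 / 2)"] b unfolding q_def
    by (simp add: power2_eq_square)
  moreover have "real n * q / 2 \<le> real (n - 1) * q"
  proof -
    have "real n / 2 \<le> real (n - 1)" using n_ge_2 by (simp add: of_nat_diff)
    then have "real n / 2 * q \<le> real (n - 1) * q"
      using std_normal_cdf_bounds[of "b / 2"] by (intro mult_right_mono) (auto simp: q_def)
    then show ?thesis by simp
  qed
  ultimately have q: "exp (3 / 8 * b\<^sup>2) / 4 \<le> real (n - 1) * q" by linarith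
  have "?P (b / 2) \<le> exp (- q)" using exp_ge_add_one_self[of "- q"] by (simp add: q_def)
  then have "?P (b / 2) ^ (n - 1) \<le> exp (- q) ^ (n - 1)"
    using std_normal_cdf_bounds by (intro power_mono) auto
  also have "\<dots> = exp (- (real (n - 1) * q))" by (simp add: exp_of_nat_mult[symmetric])
  also have "\<dots> \<le> exp (- (exp (3 / 8 * b\<^sup>2) / 4))" using q by simp
  finally have d: "?P (b / 2) ^ (n - 1) \<le> exp (- (exp (3 / 8 * b\<^sup>2) / 4))" .
  have "?P (b + x / b) ^ n = ?P (b + x / b) * ?P (b + x / b) ^ (n - 1)"
    by (subst n1) simp
  also have "\<dots> \<le> exp (3 * b\<^sup>2 / 2 + x) * exp (- (exp (3 / 8 * b\<^sup>2) / 4))"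
    using c order_trans[OF power_mono[OF le] d] std_normal_cdf_bounds by (intro mult_mono) auto
  also have "\<dots> = exp (3 * b\<^sup>2 / 2 - exp (3 / 8 * b\<^sup>2) / 4) * exp x"
    by (simp add: exp_add[symmetric])
  finally show ?thesis .
qed

lemma power_cdf_right_bound:
  assumes "x \<ge> 0"
  shows "1 - std_normal_cdf (b + x / b) ^ n \<le> exp (- x)"
proof -
  let ?q = "1 - std_normal_cdf (b + x / b)"
  have "1 + real n * (- ?q) \<le> (1 + (- ?q)) ^ n"
    using std_normal_cdf_bounds by (intro Bernoulli_inequality) (simp add: add_increasing)
  then have "1 - real n * ?q \<le> std_normal_cdf (b + x / b) ^ n" by (simp add: algebra_simps)
  then show ?thesis using n_tail_le_of_nonneg[OF assms] by linarith
qed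

end

text \<open>
  The expansion on the whole line. Outside the central region every term is at most a multiple of
  \<open>exp (- 3 \<bar>x\<bar> / 4) \<le> exp (- b\<^sup>2 / 8) exp (- \<bar>x\<bar> / 2)\<close>, or smaller still, so that the terms can be
  estimated separately.
\<close>
lemma power_cdf_expansion:
  obtains C B where "C > 0" "\<And>b n x. \<lbrakk>b \<ge> B; 2 * pi * b\<^sup>2 * exp (b\<^sup>2) = (real n)\<^sup>2\<rbrakk> \<Longrightarrow>
    \<bar>std_normal_cdf (b + x / b) ^ n - gumbel_cdf x - 1 / b\<^sup>2 * gumbel_correction x\<bar>
      \<le> C / b ^ 4 * exp (- \<bar>x\<bar> / 2)"
proof -
  obtain C where C: "C > 0" "\<And>x. (120 * (1 + x\<^sup>2)\<^sup>2 * gumbel_density x +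
       30000 * (exp (- x))\<^sup>2 * (1 + x\<^sup>2) ^ 4 * exp (- (exp (- x / 2) / 4))) \<le> C * exp (- \<bar>x\<bar> / 2)"
    by (rule gumbel_weight_bound) metis
  obtain K where K: "K > 0" "\<And>x. \<bar>gumbel_correction x\<bar> \<le> K * exp (- (3 / 4) * \<bar>x\<bar>)"
    by (rule gumbel_correction_bound) metis
  have "\<forall>\<^sub>F b::real in at_top. 2 * exp (- b\<^sup>2 / 8) \<le> 1 / b ^ 4"
    "\<forall>\<^sub>F b::real in at_top. exp (3 * b\<^sup>2 / 2 - exp (3 / 8 * b\<^sup>2) / 4) \<le> 1 / b ^ 4"
    "\<forall>\<^sub>F b::real in at_top. b \<ge> 4"
    by real_asymp+
  then have "\<forall>\<^sub>F b::real in at_top. 2 * exp (- b\<^sup>2 / 8) \<le> 1 / b ^ 4 \<and>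
      exp (3 * b\<^sup>2 / 2 - exp (3 / 8 * b\<^sup>2) / 4) \<le> 1 / b ^ 4 \<and> b \<ge> 4"
    by eventually_elim simp
  then obtain B where B: "\<And>b::real. b \<ge> B \<Longrightarrow> 2 * exp (- b\<^sup>2 / 8) \<le> 1 / b ^ 4 \<and>
      exp (3 * b\<^sup>2 / 2 - exp (3 / 8 * b\<^sup>2) / 4) \<le> 1 / b ^ 4 \<and> b \<ge> 4"
    unfolding eventually_at_top_linorder by blast
  show thesis
  proof (rule that[of "C + K + 2" B])
    fix b x :: real and n :: nat
    assume b: "b \<ge> B" and s: "2 * pi * b\<^sup>2 * exp (b\<^sup>2) = (real n)\<^sup>2"
    interpret normal_scaling b n by unfold_locales (use B[OF b] s in auto)
    let ?P = "std_normal_cdf (b + x / b) ^ n"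
    let ?w = "exp (- \<bar>x\<bar> / 2)"
    have b0: "b > 0" using b4 by simp
    have b2: "1 / b\<^sup>2 \<le> 1" using location_bounds(5)[of 0] b0 by simp
    have split: "(C + K + 2) / b ^ 4 * ?w = C / b ^ 4 * ?w + K / b ^ 4 * ?w + 2 * (1 / b ^ 4 * ?w)"
      by (simp add: add_divide_distrib algebra_simps)
    have nn: "C / b ^ 4 * ?w \<ge> 0" "K / b ^ 4 * ?w \<ge> 0" "1 / b ^ 4 * ?w \<ge> 0" using C K by auto
    show "\<bar>?P - gumbel_cdf x - 1 / b\<^sup>2 * gumbel_correction x\<bar> \<le> (C + K + 2) / b ^ 4 * ?w"
    proof (cases "\<bar>x\<bar> \<le> b\<^sup>2 / 2")
      case True
      have "\<bar>?P - gumbel_cdf x - gumbel_correction x / b\<^sup>2\<bar> \<le> 1 / b ^ 4 * (C * ?w)"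
        using B[OF b] by (intro order_trans[OF power_cdf_expansion_central[OF True] mult_left_mono[OF C(2)]]) auto
      moreover have "gumbel_correction x / b\<^sup>2 = 1 / b\<^sup>2 * gumbel_correction x"
        "1 / b ^ 4 * (C * ?w) = C / b ^ 4 * ?w" by simp_all
      ultimately show ?thesis unfolding split using nn by linarith
    next
      case False
      have small: "exp (- (3 / 4) * \<bar>x\<bar>) \<le> 1 / b ^ 4 * ?w"
      proof -
        have "exp (- (3 / 4) * \<bar>x\<bar>) = exp (- \<bar>x\<bar> / 4) * ?w" by (simp add: exp_add[symmetric])
        also have "exp (- \<bar>x\<bar> / 4) \<le> exp (- b\<^sup>2 / 8)" using False by simp
        also have "exp (- b\<^sup>2 / 8) \<le> 1 / b ^ 4"
          using B[OF b] exp_gt_zero[of "- b\<^sup>2 / 8"] by linarith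
        finally show ?thesis by simp
      qed
      have "\<bar>1 / b\<^sup>2 * gumbel_correction x\<bar> \<le> 1 * (K * exp (- (3 / 4) * \<bar>x\<bar>))"
        unfolding abs_mult using b2 K by (intro mult_mono) auto
      also have "\<dots> \<le> K * (1 / b ^ 4 * ?w)" using mult_left_mono[OF small] K by simp
      finally have g: "\<bar>1 / b\<^sup>2 * gumbel_correction x\<bar> \<le> K / b ^ 4 * ?w" by simp
      have "\<bar>?P - gumbel_cdf x\<bar> \<le> 2 * (1 / b ^ 4 * ?w)"
      proof (cases "x \<ge> 0")
        case True
        have e: "exp (- x) \<le> exp (- (3 / 4) * \<bar>x\<bar>)" using True by simp
        have "1 - gumbel_cdf x \<le> exp (- x)"
          unfolding gumbel_cdf_def using exp_ge_add_one_self[of "- exp (- x)"] by linarith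
        moreover have "gumbel_cdf x \<le> 1" by (simp add: gumbel_cdf_def)
        moreover have "?P \<le> 1" using std_normal_cdf_bounds by (intro power_le_one) auto
        moreover note power_cdf_right_bound[OF True]
        ultimately show ?thesis using e small by linarith
      next
        case neg: False
        have "?P \<le> exp (3 * b\<^sup>2 / 2 - exp (3 / 8 * b\<^sup>2) / 4) * exp x"
          using neg False by (intro power_cdf_left_bound) auto
        also have "\<dots> \<le> 1 / b ^ 4 * ?w" using B[OF b] neg by (intro mult_mono) auto
        finally have "?P \<le> 1 / b ^ 4 * ?w" .
        moreover have "?P \<ge> 0" using std_normal_cdf_bounds by simp
        moreover have "gumbel_cdf x \<ge> 0" by (simp add: gumbel_cdf_def)
        moreover have "gumbel_cdf x \<le> 1 / b ^ 4 * ?w"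
          using order_trans[OF gumbel_cdf_left_bound small] neg by simp
        ultimately show ?thesis by linarith
      qed
      then show ?thesis unfolding split using g nn by linarith
    qed
  qed (use C K in auto)
qed

section \<open>Changing the location and the scale\<close>

lemma gumbel_cdf_deriv: "(gumbel_cdf has_real_derivative gumbel_density x) (at x)"
  unfolding gumbel_cdf_def gumbel_density_def by (auto intro!: derivative_eq_intros)

lemma gumbel_density_deriv:
  "(gumbel_density has_real_derivative (exp (- x) - 1) * gumbel_density x) (at x)"
  unfolding gumbel_density_def by (auto intro!: derivative_eq_intros simp: algebra_simps)

lemma gumbel_density_decay:
  obtains C where "C > 0" "\<And>x. gumbel_density x \<le> C * exp (- (3 / 4) * \<bar>x\<bar>)"
    "\<And>x. \<bar>(exp (- x) - 1) * gumbel_density x\<bar> \<le> C * exp (- (3 / 4) * \<bar>x\<bar>)"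
proof -
  have c1: "continuous_on UNIV gumbel_density"
    unfolding gumbel_density_def by (intro continuous_intros)
  have "((\<lambda>x. gumbel_density x * exp (3 / 4 * x)) \<longlongrightarrow> 0) at_top"
    "((\<lambda>x. gumbel_density x * exp (3 / 4 * x)) \<longlongrightarrow> 0) at_bot"
    "((\<lambda>x. gumbel_density x * exp (- (3 / 4) * x)) \<longlongrightarrow> 0) at_top"
    "((\<lambda>x. gumbel_density x * exp (- (3 / 4) * x)) \<longlongrightarrow> 0) at_bot"
    unfolding gumbel_density_def by real_asymp+
  from exponential_decay_bound[OF c1 this] obtain C1 where
    C1: "C1 > 0" "\<And>x. \<bar>gumbel_density x\<bar> \<le> C1 * exp (- (3 / 4) * \<bar>x\<bar>)" by blast
  let ?h = "\<lambda>x. (exp (- x) - 1) * gumbel_density x"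
  have c2: "continuous_on UNIV ?h" by (intro continuous_intros c1)
  have "((\<lambda>x. ?h x * exp (3 / 4 * x)) \<longlongrightarrow> 0) at_top"
    "((\<lambda>x. ?h x * exp (3 / 4 * x)) \<longlongrightarrow> 0) at_bot"
    "((\<lambda>x. ?h x * exp (- (3 / 4) * x)) \<longlongrightarrow> 0) at_top"
    "((\<lambda>x. ?h x * exp (- (3 / 4) * x)) \<longlongrightarrow> 0) at_bot"
    unfolding gumbel_density_def by real_asymp+
  from exponential_decay_bound[OF c2 this] obtain C2 where
    C2: "C2 > 0" "\<And>x. \<bar>?h x\<bar> \<le> C2 * exp (- (3 / 4) * \<bar>x\<bar>)" by blast
  show thesis
  proof (rule that[of "C1 + C2"])
    fix x :: real
    have "C1 * exp (- (3 / 4) * \<bar>x\<bar>) \<le> (C1 + C2) * exp (- (3 / 4) * \<bar>x\<bar>)"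
      "C2 * exp (- (3 / 4) * \<bar>x\<bar>) \<le> (C1 + C2) * exp (- (3 / 4) * \<bar>x\<bar>)"
      using C1(1) C2(1) by (auto intro!: mult_right_mono)
    then show "gumbel_density x \<le> (C1 + C2) * exp (- (3 / 4) * \<bar>x\<bar>)"
      "\<bar>?h x\<bar> \<le> (C1 + C2) * exp (- (3 / 4) * \<bar>x\<bar>)"
      using C1(2)[of x] C2(2)[of x] by linarith+
  qed (use C1 C2 in auto)
qed

text \<open>
  Taylor's theorem to second order. The displacement \<open>p + s x\<close> is at most \<open>1 + \<bar>x\<bar> / 8\<close>, so the
  intermediate point is far from the origin whenever \<open>x\<close> is, and the second derivative of the Gumbel
  distribution function decays exponentially there.
\<close>
lemma gumbel_cdf_affine_expansion:
  obtains C where "C > 0" "\<And>p s x. \<lbrakk>\<bar>p\<bar> \<le> 1; \<bar>s\<bar> \<le> 1/8\<rbrakk> \<Longrightarrow>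
    \<bar>gumbel_cdf (p + (1 + s) * x) - gumbel_cdf x - s * (x * gumbel_density x)\<bar>
      \<le> C * (\<bar>p\<bar> + s\<^sup>2) * exp (- \<bar>x\<bar> / 4)"
proof -
  obtain K where K: "K > 0" "\<And>x. gumbel_density x \<le> K * exp (- (3 / 4) * \<bar>x\<bar>)"
    "\<And>x. \<bar>(exp (- x) - 1) * gumbel_density x\<bar> \<le> K * exp (- (3 / 4) * \<bar>x\<bar>)"
    by (rule gumbel_density_decay) blast
  have gd0: "gumbel_density x \<ge> 0" for x by (simp add: gumbel_density_def)
  define L where "L = K * exp 1"
  have L: "L > 0" "K \<le> L" using K(1) by (auto simp: L_def)
  show thesis
  proof (rule that[of "33 * L"])
    fix p s x :: real assume p: "\<bar>p\<bar> \<le> 1" and s: "\<bar>s\<bar> \<le> 1/8"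
    define d where "d = p + s * x"
    have dx: "\<bar>d\<bar> \<le> 1 + \<bar>x\<bar> / 8"
    proof -
      have "\<bar>s * x\<bar> \<le> 1/8 * \<bar>x\<bar>" unfolding abs_mult using s by (intro mult_right_mono) auto
      then show ?thesis using p abs_triangle_ineq[of p "s * x"] unfolding d_def by linarith
    qed
    have ex: "\<exists>t. \<bar>t - x\<bar> \<le> \<bar>d\<bar> \<and> gumbel_cdf (x + d) = gumbel_cdf x + d * gumbel_density x +
        d\<^sup>2 / 2 * ((exp (- t) - 1) * gumbel_density t)"
    proof (cases "d = 0")
      case False
      let ?D = "\<lambda>m::nat. if m = 0 then gumbel_cdf else if m = 1 then gumbel_density
          else (\<lambda>t. (exp (- t) - 1) * gumbel_density t)"
      have "\<exists>t. (if x + d < x then x + d < t \<and> t < x else x < t \<and> t < x + d) \<and>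
          gumbel_cdf (x + d) = (\<Sum>m<2. ?D m x / fact m * (x + d - x) ^ m) + ?D 2 t / fact 2 * (x + d - x) ^ 2"
      proof (rule Taylor[where diff = ?D and f = gumbel_cdf and n = 2 and c = x and a = "min x (x + d)" and b = "max x (x + d)"])
        show "\<forall>m t. m < 2 \<and> min x (x + d) \<le> t \<and> t \<le> max x (x + d) \<longrightarrow>
            (?D m has_real_derivative ?D (Suc m) t) (at t)"
          using gumbel_cdf_deriv gumbel_density_deriv by (auto simp: less_2_cases_iff)
      qed (use False in auto)
      then obtain t where t: "if x + d < x then x + d < t \<and> t < x else x < t \<and> t < x + d"
        "gumbel_cdf (x + d) = (\<Sum>m<2. ?D m x / fact m * (x + d - x) ^ m) + ?D 2 t / fact 2 * (x + d - x) ^ 2"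
        by blast
      have "\<bar>t - x\<bar> \<le> \<bar>d\<bar>" using t(1) by (auto split: if_splits)
      moreover have "gumbel_cdf (x + d) = gumbel_cdf x + d * gumbel_density x +
        d\<^sup>2 / 2 * ((exp (- t) - 1) * gumbel_density t)"
      proof -
        have "{..<2} = {0, 1::nat}" by auto
        then show ?thesis using t(2) by simp
      qed
      ultimately show ?thesis by blast
    qed (auto intro: exI[of _ x])
    then obtain t where t: "\<bar>t - x\<bar> \<le> \<bar>d\<bar>" "gumbel_cdf (x + d) = gumbel_cdf x + d * gumbel_density x +
        d\<^sup>2 / 2 * ((exp (- t) - 1) * gumbel_density t)" by blast
    have tx: "7/8 * \<bar>x\<bar> - 1 \<le> \<bar>t\<bar>" using t(1) dx by linarith
    let ?w = "exp (- \<bar>x\<bar> / 4)"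
    have e1: "exp (- (3 / 4) * \<bar>t\<bar>) \<le> exp 1 * (?w * ?w)"
    proof -
      have "- (3 / 4) * \<bar>t\<bar> \<le> 1 + (- \<bar>x\<bar> / 4 + - \<bar>x\<bar> / 4)" using tx by linarith
      then show ?thesis by (simp only: exp_add[symmetric]) simp
    qed
    have r: "\<bar>(exp (- t) - 1) * gumbel_density t\<bar> \<le> L * (?w * ?w)"
      using order_trans[OF K(3)[of t] mult_left_mono[OF e1, of K]] K(1) by (simp add: L_def mult.assoc)
    have d2: "d\<^sup>2 / 2 * ?w \<le> 32 * (\<bar>p\<bar> + s\<^sup>2)"
    proof -
      have "0 \<le> (p - s * x)\<^sup>2" by simp
      then have "d\<^sup>2 / 2 \<le> p\<^sup>2 + s\<^sup>2 * x\<^sup>2"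
        unfolding d_def by (simp add: power2_eq_square field_simps)
      also have "p\<^sup>2 \<le> \<bar>p\<bar>" using mult_left_le[of "\<bar>p\<bar>" "\<bar>p\<bar>"] p by (simp add: power2_eq_square)
      finally have "d\<^sup>2 / 2 * ?w \<le> (\<bar>p\<bar> + s\<^sup>2 * x\<^sup>2) * ?w" by (intro mult_right_mono) auto
      also have "\<dots> = \<bar>p\<bar> * ?w + s\<^sup>2 * (x\<^sup>2 * ?w)" by (simp add: algebra_simps)
      finally have le: "d\<^sup>2 / 2 * ?w \<le> \<bar>p\<bar> * ?w + s\<^sup>2 * (x\<^sup>2 * ?w)" .
      have "x\<^sup>2 * ?w \<le> 32 * exp (\<bar>x\<bar> / 4) * ?w"
        by (intro mult_right_mono square_le_exp_quarter) auto
      also have "\<dots> = 32" by (simp add: mult.assoc exp_add[symmetric])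
      finally have "s\<^sup>2 * (x\<^sup>2 * ?w) \<le> s\<^sup>2 * 32" by (intro mult_left_mono) auto
      moreover have "\<bar>p\<bar> * ?w \<le> \<bar>p\<bar> * 32" by (intro mult_left_mono) (auto intro: order_trans[of _ 1])
      ultimately show ?thesis using le by (simp add: distrib_left)
    qed
    have "gumbel_cdf (p + (1 + s) * x) - gumbel_cdf x - s * (x * gumbel_density x) =
        p * gumbel_density x + d\<^sup>2 / 2 * ((exp (- t) - 1) * gumbel_density t)"
    proof -
      have "p + (1 + s) * x = x + d" by (simp add: d_def algebra_simps)
      then show ?thesis using t(2) by (simp add: d_def algebra_simps)
    qed
    also have "\<bar>\<dots>\<bar> \<le> \<bar>p * gumbel_density x\<bar> + \<bar>d\<^sup>2 / 2 * ((exp (- t) - 1) * gumbel_density t)\<bar>"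
      by (rule abs_triangle_ineq)
    also have "\<bar>p * gumbel_density x\<bar> \<le> \<bar>p\<bar> * (L * ?w)"
    proof -
      have "exp (- (3 / 4) * \<bar>x\<bar>) \<le> ?w" by simp
      then have "K * exp (- (3 / 4) * \<bar>x\<bar>) \<le> L * ?w" using L K(1) by (intro mult_mono) auto
      then show ?thesis unfolding abs_mult using K(2)[of x] gd0[of x] by (intro mult_left_mono) auto
    qed
    also have "\<bar>d\<^sup>2 / 2 * ((exp (- t) - 1) * gumbel_density t)\<bar> \<le> d\<^sup>2 / 2 * (L * (?w * ?w))"
      unfolding abs_mult[of "d\<^sup>2 / 2"] using r by (intro mult_mono) auto
    also have "\<dots> = (d\<^sup>2 / 2 * ?w) * (L * ?w)" by simp
    also have "\<dots> \<le> 32 * (\<bar>p\<bar> + s\<^sup>2) * (L * ?w)" using d2 L by (intro mult_right_mono) auto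
    finally have "\<bar>gumbel_cdf (p + (1 + s) * x) - gumbel_cdf x - s * (x * gumbel_density x)\<bar>
        \<le> \<bar>p\<bar> * (L * ?w) + 32 * (\<bar>p\<bar> + s\<^sup>2) * (L * ?w)" by simp
    also have "\<dots> \<le> (\<bar>p\<bar> + s\<^sup>2) * (L * ?w) + 32 * (\<bar>p\<bar> + s\<^sup>2) * (L * ?w)"
      using L by (intro add_mono mult_right_mono) auto
    finally show "\<bar>gumbel_cdf (p + (1 + s) * x) - gumbel_cdf x - s * (x * gumbel_density x)\<bar>
        \<le> 33 * L * (\<bar>p\<bar> + s\<^sup>2) * ?w" by (simp add: algebra_simps)
  qed (use L in auto)
qed

text \<open>
  The exact scales of the first part of the theorem, for all sample sizes at once.
\<close>
definition normal_scale :: "(nat \<Rightarrow> real) \<Rightarrow> bool" where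
  "normal_scale b \<longleftrightarrow> (\<forall>n\<ge>2. b n > 0 \<and> 2 * pi * (b n)\<^sup>2 * exp ((b n)\<^sup>2) = (real n)\<^sup>2)"

lemma normal_scale_exists: "\<exists>b. normal_scale b"
proof -
  have "\<exists>b. n \<ge> 2 \<longrightarrow> b > 0 \<and> 2 * pi * b\<^sup>2 * exp (b\<^sup>2) = (real n)\<^sup>2" for n
  proof (cases "n \<ge> 2")
    case True
    let ?f = "\<lambda>b::real. 2 * pi * b\<^sup>2 * exp (b\<^sup>2)"
    have "(real n)\<^sup>2 * 1 \<le> (real n)\<^sup>2 * (2 * pi * exp ((real n)\<^sup>2))"
    proof (intro mult_left_mono)
      have "1 * 1 \<le> 2 * pi * exp ((real n)\<^sup>2)" using pi_ge_two by (intro mult_mono) auto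
      then show "1 \<le> 2 * pi * exp ((real n)\<^sup>2)" by simp
    qed auto
    then have "(real n)\<^sup>2 \<le> ?f (real n)" by (simp add: mult_ac)
    then have "\<exists>b\<ge>0. b \<le> real n \<and> ?f b = (real n)\<^sup>2"
      by (intro IVT') (auto intro!: continuous_intros)
    then obtain b where b: "b \<ge> 0" "?f b = (real n)\<^sup>2" by blast
    have "b \<noteq> 0" using b(2) True by (intro notI) simp
    then show ?thesis using b by (intro exI[of _ b]) auto
  qed auto
  then obtain b where "\<And>n. n \<ge> 2 \<longrightarrow> b n > 0 \<and> 2 * pi * (b n)\<^sup>2 * exp ((b n)\<^sup>2) = (real n)\<^sup>2"
    by metis
  then show ?thesis unfolding normal_scale_def by blast
qed

lemma normal_scale_at_top:
  assumes "normal_scale b" shows "filterlim b at_top sequentially"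
  unfolding filterlim_at_top
proof
  fix Z :: real
  define K where "K = max Z 0"
  have K: "K \<ge> 0" "Z \<le> K" by (auto simp: K_def)
  have "filterlim (\<lambda>n. (real n)\<^sup>2) at_top sequentially" by real_asymp
  then have "\<forall>\<^sub>F n in sequentially. (real n)\<^sup>2 > 2 * pi * K\<^sup>2 * exp (K\<^sup>2)"
    by (simp add: filterlim_at_top_dense)
  then show "\<forall>\<^sub>F n in sequentially. Z \<le> b n"
    using eventually_ge_at_top[of 2]
  proof eventually_elim
    case (elim n)
    have b: "b n > 0" "2 * pi * (b n)\<^sup>2 * exp ((b n)\<^sup>2) = (real n)\<^sup>2"
      using assms elim by (auto simp: normal_scale_def)
    show ?case
    proof (rule ccontr)
      assume "\<not> Z \<le> b n"
      then have "(b n)\<^sup>2 \<le> K\<^sup>2" using b K by (intro power_mono) auto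
      then have "2 * pi * (b n)\<^sup>2 * exp ((b n)\<^sup>2) \<le> 2 * pi * K\<^sup>2 * exp (K\<^sup>2)"
        by (intro mult_mono mult_left_mono) auto
      then show False using b elim by simp
    qed
  qed
qed

lemma normal_scale_log:
  assumes "normal_scale b" "n \<ge> 2"
  shows "2 * ln (real n) = ln (2 * pi * (b n)\<^sup>2) + (b n)\<^sup>2"
proof -
  have b: "b n > 0" "2 * pi * (b n)\<^sup>2 * exp ((b n)\<^sup>2) = (real n)\<^sup>2"
    using assms by (auto simp: normal_scale_def)
  have "2 * ln (real n) = ln ((real n)\<^sup>2)" using assms(2) by (simp add: ln_realpow)
  also have "\<dots> = ln (2 * pi * (b n)\<^sup>2 * exp ((b n)\<^sup>2))" using b by simp
  also have "\<dots> = ln (2 * pi * (b n)\<^sup>2) + (b n)\<^sup>2" using b by (subst ln_mult) auto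
  finally show ?thesis .
qed

lemma normal_scale_square:
  assumes "normal_scale b"
  shows "(\<lambda>n. (b n)\<^sup>2 / (2 * ln (real n))) \<longlonglongrightarrow> 1"
proof -
  note top = normal_scale_at_top[OF assms]
  have "((\<lambda>b::real. b\<^sup>2 / (ln (2 * pi * b\<^sup>2) + b\<^sup>2)) \<longlongrightarrow> 1) at_top" by real_asymp
  from filterlim_compose[OF this top]
  have "(\<lambda>n. (b n)\<^sup>2 / (ln (2 * pi * (b n)\<^sup>2) + (b n)\<^sup>2)) \<longlonglongrightarrow> 1" .
  then show ?thesis
    by (rule Lim_transform_eventually)
       (use eventually_ge_at_top[of 2] in \<open>eventually_elim, simp add: normal_scale_log[OF assms]\<close>)
qed

text \<open>
  The slope and the intercept of the affine map between the coordinate of \<open>bhat n + x / a_seq n\<close> and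
  that of \<open>b n + y / b n\<close> are \<open>1 + rel_shift b n\<close> and \<open>loc_shift b n\<close>.
\<close>
definition rel_shift :: "(nat \<Rightarrow> real) \<Rightarrow> nat \<Rightarrow> real" where
  "rel_shift b n = b n / a_seq n - 1"

definition loc_shift :: "(nat \<Rightarrow> real) \<Rightarrow> nat \<Rightarrow> real" where
  "loc_shift b n = b n * (bhat n - b n)"

lemma bhat_reparametrization:
  assumes "b n \<noteq> 0" "a_seq n \<noteq> 0"
  shows "bhat n + x / a_seq n = b n + (loc_shift b n + (1 + rel_shift b n) * x) / b n"
  using assms by (simp add: loc_shift_def rel_shift_def field_simps)

text \<open>
  Write \<open>L = 2 ln n\<close>, \<open>c = c_seq n\<close> and \<open>s = rel_shift b n\<close>. Taking logarithms in the equation of \<open>b\<close> gives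
  \<open>L s (2 + s) = - 2 (c + ln (1 + s))\<close>, hence \<open>s \<sim> - c / L\<close>; since \<open>c \<sim> ln (ln n) / 2\<close>, this is
  \<open>- ln (ln n) / (4 ln n)\<close>. The third term of \<open>bhat\<close> cancels the second order terms of the same
  equation, which leaves \<open>loc_shift b n / s = O(c\<^sup>2 / L) + O(s)\<close>.
\<close>
lemma shifts_asymptotics:
  assumes "normal_scale b"
  shows "(\<lambda>n. - rel_shift b n / (ln (ln (real n)) / (4 * ln (real n)))) \<longlonglongrightarrow> 1"
    and "rel_shift b \<longlonglongrightarrow> 0"
    and "(\<lambda>n. loc_shift b n / rel_shift b n) \<longlonglongrightarrow> 0"
    and "(\<lambda>n. 1 / (b n)\<^sup>2 / rel_shift b n) \<longlonglongrightarrow> 0"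
    and "\<forall>\<^sub>F n in sequentially. rel_shift b n < 0"
proof -
  define s where "s = rel_shift b"
  define L where "L n = 2 * ln (real n)" for n :: nat
  define c where "c = c_seq"
  have c_eq: "c n = ln (sqrt (2 * pi) * sqrt (2 * ln (real n)))" for n
    by (simp add: c_def c_seq_def a_seq_def)
  have c_top: "filterlim c at_top sequentially" unfolding c_eq[abs_def] by real_asymp
  have cL: "(\<lambda>n. c n / L n / (ln (ln (real n)) / (4 * ln (real n)))) \<longlonglongrightarrow> 1"
    unfolding c_eq L_def by real_asymp
  have c2L: "(\<lambda>n. (c n)\<^sup>2 / L n) \<longlonglongrightarrow> 0" unfolding c_eq L_def by real_asymp
  have ci: "(\<lambda>n. 1 / c n) \<longlonglongrightarrow> 0" unfolding c_eq by real_asymp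
  have ev: "\<forall>\<^sub>F n in sequentially. n \<ge> 2 \<and> c n > 0"
    using eventually_ge_at_top[of 2] filterlim_at_top_dense[THEN iffD1, OF c_top, rule_format, of 0]
    by eventually_elim simp
  have basic: "L n > 0" "a_seq n > 0" "(a_seq n)\<^sup>2 = L n" "b n > 0" "1 + s n > 0"
      "b n = a_seq n * (1 + s n)" if "n \<ge> 2" for n
    using that assms by (auto simp: L_def a_seq_def s_def rel_shift_def normal_scale_def)
  have sq: "(1 + s n)\<^sup>2 = (b n)\<^sup>2 / (2 * ln (real n))" if "n \<ge> 2" for n
  proof -
    note B = basic[OF that]
    have "(b n)\<^sup>2 = L n * (1 + s n)\<^sup>2" unfolding B(6) B(3)[symmetric] by (simp only: power_mult_distrib)
    then show ?thesis using B(1) by (simp add: L_def)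
  qed
  have "(\<lambda>n. (1 + s n)\<^sup>2) \<longlonglongrightarrow> 1"
    by (rule Lim_transform_eventually[OF normal_scale_square[OF assms]])
       (use eventually_ge_at_top[of 2] in \<open>eventually_elim, simp add: sq\<close>)
  then have "(\<lambda>n. sqrt ((1 + s n)\<^sup>2)) \<longlonglongrightarrow> sqrt 1" by (rule tendsto_real_sqrt)
  then have "(\<lambda>n. \<bar>1 + s n\<bar>) \<longlonglongrightarrow> 1" by simp
  then have "(\<lambda>n. 1 + s n) \<longlonglongrightarrow> 1"
    by (rule Lim_transform_eventually)
       (use eventually_ge_at_top[of 2] in \<open>eventually_elim, use basic(5) in force\<close>)
  then have s0: "s \<longlonglongrightarrow> 0" using tendsto_diff[of "\<lambda>n. 1 + s n" 1 _ "\<lambda>_. 1" 1] by simp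
  then show "rel_shift b \<longlonglongrightarrow> 0" by (simp add: s_def)
  have ln_s: "(\<lambda>n. ln (1 + s n)) \<longlonglongrightarrow> 0"
    using tendsto_ln[OF tendsto_add[OF tendsto_const[of 1] s0]] by simp
  have defining: "L n * (s n * (2 + s n)) = - 2 * (c n + ln (1 + s n))" if n: "n \<ge> 2" for n
  proof -
    note B = basic[OF n]
    have "2 * pi * (b n)\<^sup>2 = (sqrt (2 * pi) * a_seq n * (1 + s n))\<^sup>2"
      using B by (simp add: power_mult_distrib)
    then have "ln (2 * pi * (b n)\<^sup>2) = 2 * ln (sqrt (2 * pi) * a_seq n * (1 + s n))"
      using B by (simp add: ln_realpow)
    also have "ln (sqrt (2 * pi) * a_seq n * (1 + s n)) = c n + ln (1 + s n)"
      using B by (subst ln_mult) (auto simp: c_def c_seq_def)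
    finally have "L n = 2 * (c n + ln (1 + s n)) + (b n)\<^sup>2"
      using normal_scale_log[OF assms n] by (simp add: L_def)
    moreover have "(b n)\<^sup>2 = L n * (1 + s n)\<^sup>2" unfolding B(6) using B by (simp add: power_mult_distrib)
    ultimately show ?thesis by (simp add: power2_eq_square algebra_simps)
  qed
  \<comment> \<open>The quotient of \<open>s\<close> and its leading term \<open>- c / L\<close>\<close>
  define u where "u n = - s n * L n / c n" for n
  have u1: "u \<longlonglongrightarrow> 1"
  proof -
    have "(\<lambda>n. 2 * (1 + ln (1 + s n) * (1 / c n)) / (2 + s n)) \<longlonglongrightarrow> 2 * (1 + 0 * 0) / (2 + 0)"
      by (intro tendsto_intros ln_s ci s0) auto
    then have "(\<lambda>n. 2 * (1 + ln (1 + s n) * (1 / c n)) / (2 + s n)) \<longlonglongrightarrow> 1" by simp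
    then show ?thesis
    proof (rule Lim_transform_eventually)
      show "\<forall>\<^sub>F n in sequentially. 2 * (1 + ln (1 + s n) * (1 / c n)) / (2 + s n) = u n"
        using ev
      proof eventually_elim
        case (elim n)
        have "2 + s n > 0" using basic(5)[of n] elim by simp
        moreover have "2 * (1 + ln (1 + s n) * (1 / c n)) = - (L n * (s n * (2 + s n))) / c n"
          using elim defining[of n] by (simp add: field_simps)
        ultimately show ?case by (simp add: u_def)
      qed
    qed
  qed
  have neg: "\<forall>\<^sub>F n in sequentially. s n < 0"
  proof -
    have "\<forall>\<^sub>F n in sequentially. u n > 0" using order_tendstoD(1)[OF u1, of 0] by simp
    with ev show ?thesis
    proof eventually_elim
      case (elim n)
      then have "0 < u n * c n" by simp
      also have "u n * c n = - s n * L n" using elim by (simp add: u_def)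
      finally have "0 < - s n * L n" .
      then show ?case using basic(1)[of n] elim by (simp add: mult_less_0_iff)
    qed
  qed
  then show "\<forall>\<^sub>F n in sequentially. rel_shift b n < 0" by (simp add: s_def)
  have "(\<lambda>n. u n * (c n / L n / (ln (ln (real n)) / (4 * ln (real n))))) \<longlonglongrightarrow> 1 * 1"
    by (intro tendsto_mult u1 cL)
  then have "(\<lambda>n. - s n / (ln (ln (real n)) / (4 * ln (real n)))) \<longlonglongrightarrow> 1"
    unfolding mult_1_left
  proof (rule Lim_transform_eventually)
    show "\<forall>\<^sub>F n in sequentially. u n * (c n / L n / (ln (ln (real n)) / (4 * ln (real n)))) =
        - s n / (ln (ln (real n)) / (4 * ln (real n)))"
      using ev
    proof eventually_elim
      case (elim n)
      have "u n * (c n / L n) = - s n" using elim basic(1)[of n] by (simp add: u_def)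
      then show ?case by (metis times_divide_eq_right)
    qed
  qed
  then show "(\<lambda>n. - rel_shift b n / (ln (ln (real n)) / (4 * ln (real n)))) \<longlonglongrightarrow> 1" by (simp add: s_def)
  have "(\<lambda>n. - (1 / u n) * (1 / c n) / (1 + s n)\<^sup>2) \<longlonglongrightarrow> - (1 / 1) * 0 / (1 + 0)\<^sup>2"
    by (intro tendsto_intros u1 ci s0) auto
  then have "(\<lambda>n. - (1 / u n) * (1 / c n) / (1 + s n)\<^sup>2) \<longlonglongrightarrow> 0" by simp
  then have "(\<lambda>n. 1 / (b n)\<^sup>2 / s n) \<longlonglongrightarrow> 0"
  proof (rule Lim_transform_eventually)
    show "\<forall>\<^sub>F n in sequentially. - (1 / u n) * (1 / c n) / (1 + s n)\<^sup>2 = 1 / (b n)\<^sup>2 / s n"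
      using ev neg
    proof eventually_elim
      case (elim n)
      have "(b n)\<^sup>2 = L n * (1 + s n)\<^sup>2" using basic[of n] elim by (simp add: power_mult_distrib)
      then show ?case using elim basic[of n] by (simp add: u_def field_simps)
    qed
  qed
  then show "(\<lambda>n. 1 / (b n)\<^sup>2 / rel_shift b n) \<longlonglongrightarrow> 0" by (simp add: s_def)
  have s_at: "filterlim s (at 0) sequentially"
    unfolding filterlim_at using s0 neg by (auto elim: eventually_mono)
  have l1: "(\<lambda>n. (s n - ln (1 + s n)) / s n) \<longlonglongrightarrow> 0"
  proof -
    have "((\<lambda>s::real. (s - ln (1 + s)) / s) \<longlongrightarrow> 0) (at 0)" by real_asymp
    from filterlim_compose[OF this s_at] show ?thesis .
  qed
  have l2: "(\<lambda>n. ln (1 + s n) / s n) \<longlonglongrightarrow> 1"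
  proof -
    have "((\<lambda>s::real. ln (1 + s) / s) \<longlongrightarrow> 1) (at 0)" by real_asymp
    from filterlim_compose[OF this s_at] show ?thesis .
  qed
  have "(\<lambda>n. - (1 + s n) * ((s n - ln (1 + s n)) / s n +
      (- (ln (1 + s n) / s n) * (1 / c n) + u n / 2) * ((1 + u n) / 2 - 1 / c n) * ((c n)\<^sup>2 / L n)))
    \<longlonglongrightarrow> - (1 + 0) * (0 + (- 1 * 0 + 1 / 2) * ((1 + 1) / 2 - 0) * 0)"
    by (intro tendsto_intros s0 l1 l2 ci u1 c2L) auto
  then have "(\<lambda>n. - (1 + s n) * ((s n - ln (1 + s n)) / s n +
      (- (ln (1 + s n) / s n) * (1 / c n) + u n / 2) * ((1 + u n) / 2 - 1 / c n) * ((c n)\<^sup>2 / L n)))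
    \<longlonglongrightarrow> 0" by simp
  then have "(\<lambda>n. loc_shift b n / s n) \<longlonglongrightarrow> 0"
  proof (rule Lim_transform_eventually)
    show "\<forall>\<^sub>F n in sequentially. - (1 + s n) * ((s n - ln (1 + s n)) / s n +
      (- (ln (1 + s n) / s n) * (1 / c n) + u n / 2) * ((1 + u n) / 2 - 1 / c n) * ((c n)\<^sup>2 / L n)) =
      loc_shift b n / s n"
      using ev neg
    proof eventually_elim
      case (elim n)
      then have n: "n \<ge> 2" by simp
      note B = basic[OF n]
      have nz: "c n \<noteq> 0" "L n \<noteq> 0" "s n \<noteq> 0" "a_seq n \<noteq> 0" using elim B by auto
      define l where "l = ln (1 + s n)"
      \<comment> \<open>\<open>\<delta>\<close> is \<open>a_seq n * (b n - bhat n)\<close>, written in terms of \<open>L\<close>, \<open>s\<close> and \<open>c\<close>\<close>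
      define \<delta> where "\<delta> = L n * s n + c n + ((c n)\<^sup>2 - 2 * c n) / (2 * L n)"
      have p: "loc_shift b n = - (1 + s n) * \<delta>"
      proof -
        have e1: "a_seq n * (bhat n - b n) = - \<delta>"
        proof -
          have "a_seq n * (((c n)\<^sup>2 - 2 * c n) / (2 * a_seq n ^ 3)) = ((c n)\<^sup>2 - 2 * c n) / (2 * L n)"
            using nz unfolding B(3)[symmetric] by (simp add: eval_nat_numeral)
          moreover have "a_seq n * (a_seq n - c n / a_seq n - b n) = - c n - L n * s n"
            using nz unfolding B(6) B(3)[symmetric] by (simp add: field_simps power2_eq_square)
          ultimately show ?thesis
            unfolding bhat_def c_def[symmetric] \<delta>_def by (simp add: algebra_simps)
        qed
        have e2: "loc_shift b n = (1 + s n) * (a_seq n * (bhat n - b n))"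
          unfolding loc_shift_def by (subst (1) B(6)) simp
        show ?thesis unfolding e2 e1 by (simp add: algebra_simps)
      qed
      have Ls: "L n * s n + c n = - l - L n * (s n)\<^sup>2 / 2"
        using defining[OF n] by (simp add: l_def power2_eq_square field_simps)
      have \<delta>: "\<delta> = (s n - l) + (- l - L n * (s n)\<^sup>2 / 2) * ((c n - L n * s n) / 2 - 1) / L n"
      proof -
        have "(- l - L n * (s n)\<^sup>2 / 2) * ((c n - L n * s n) / 2 - 1) / L n =
            (L n * s n + c n) * ((c n - L n * s n) / 2 - 1) / L n" unfolding Ls ..
        also have "\<dots> = ((c n)\<^sup>2 - (L n * s n)\<^sup>2) / (2 * L n) - s n - c n / L n"
          using nz by (simp add: field_simps power2_eq_square)
        also have "\<dots> = (c n)\<^sup>2 / (2 * L n) - L n * (s n)\<^sup>2 / 2 - s n - c n / L n"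
          using nz by (simp add: field_simps power2_eq_square)
        finally have "(s n - l) + (- l - L n * (s n)\<^sup>2 / 2) * ((c n - L n * s n) / 2 - 1) / L n =
            (- l - L n * (s n)\<^sup>2 / 2) + (c n)\<^sup>2 / (2 * L n) - c n / L n" by simp
        also have "\<dots> = \<delta>" unfolding Ls[symmetric] \<delta>_def using nz by (simp add: field_simps)
        finally show ?thesis ..
      qed
      have su: "L n * s n = - u n * c n" using nz by (simp add: u_def)
      have f1: "(- l - L n * (s n)\<^sup>2 / 2) / s n = (- (l / s n) * (1 / c n) + u n / 2) * c n"
      proof -
        have "(- l - L n * (s n)\<^sup>2 / 2) / s n = - (l / s n) - (L n * s n) / 2"
          using nz by (simp add: field_simps power2_eq_square)
        also have "\<dots> = (- (l / s n) * (1 / c n) + u n / 2) * c n"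
          unfolding su using nz by (simp add: field_simps)
        finally show ?thesis .
      qed
      have f2: "(c n - L n * s n) / 2 - 1 = ((1 + u n) / 2 - 1 / c n) * c n"
        unfolding su using nz by (simp add: field_simps)
      have "\<delta> / s n = (s n - l) / s n + ((- l - L n * (s n)\<^sup>2 / 2) / s n) * ((c n - L n * s n) / 2 - 1) / L n"
        unfolding \<delta> by (simp add: add_divide_distrib)
      also have "\<dots> = (s n - l) / s n + (- (l / s n) * (1 / c n) + u n / 2) * ((1 + u n) / 2 - 1 / c n) * ((c n)\<^sup>2 / L n)"
        unfolding f1 f2 by (simp add: power2_eq_square)
      finally have "- (1 + s n) * ((s n - l) / s n + (- (l / s n) * (1 / c n) + u n / 2) * ((1 + u n) / 2 - 1 / c n) * ((c n)\<^sup>2 / L n))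
          = - (1 + s n) * (\<delta> / s n)" by simp
      then show ?case unfolding p l_def by simp
    qed
  qed
  then show "(\<lambda>n. loc_shift b n / rel_shift b n) \<longlonglongrightarrow> 0" by (simp add: s_def)
qed

section \<open>Moments of the Gumbel distribution\<close>

text \<open>
  The substitution \<open>t = exp (- x)\<close>: if \<open>x\<close> has the Gumbel distribution, \<open>t\<close> is a standard exponential
  variable.
\<close>
lemma gumbel_substitution:
  fixes f :: "real \<Rightarrow> real"
  assumes f: "f \<in> borel_measurable borel"
  shows "set_integrable lborel {0<..} f \<longleftrightarrow> integrable lborel (\<lambda>x. exp (- x) * f (exp (- x)))"
    and "set_integrable lborel {0<..} f \<Longrightarrow>
      (LBINT t:{0<..}. f t) = (LBINT x. exp (- x) * f (exp (- x)))"
proof -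
  have img: "(\<lambda>x::real. exp (- x)) ` UNIV = {0<..}"
  proof (intro equalityI subsetI)
    fix y :: real assume "y \<in> {0<..}"
    then have "y = exp (- (- ln y))" by simp
    then show "y \<in> range (\<lambda>x. exp (- x))" by blast
  qed auto
  let ?g = "\<lambda>x. exp (- x) * f (exp (- x))"
  have der: "((\<lambda>x. exp (- x)) has_real_derivative - exp (- x)) (at x)" for x :: real
    by (auto intro!: derivative_eq_intros)
  have inj: "inj (\<lambda>x::real. exp (- x))" by (auto simp: inj_on_def)
  have cov: "(?g absolutely_integrable_on UNIV \<and> integral UNIV ?g = b) \<longleftrightarrow>
      (f absolutely_integrable_on {0<..} \<and> integral {0<..} f = b)" for b
    using has_absolute_integral_change_of_variables_1'[OF _ der inj, of f b]
    unfolding img by simp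
  have mg: "?g \<in> borel_measurable lborel" and mf: "(\<lambda>t. indicator {0<..} t *\<^sub>R f t) \<in> borel_measurable lborel"
    using f by measurable
  have i1: "?g absolutely_integrable_on UNIV \<longleftrightarrow> integrable lborel ?g"
    using mg by (simp add: set_integrable_def integrable_completion)
  have i2: "f absolutely_integrable_on {0<..} \<longleftrightarrow> set_integrable lborel {0<..} f"
    unfolding set_integrable_def using mf by (rule integrable_completion)
  show iff: "set_integrable lborel {0<..} f \<longleftrightarrow> integrable lborel ?g"
    using cov i1 i2 by blast
  show "(LBINT t:{0<..}. f t) = (LBINT x. ?g x)" if s: "set_integrable lborel {0<..} f"
  proof -
    have "(LBINT t:{0<..}. f t) = integral {0<..} f"
      by (rule set_borel_integral_eq_integral(2)[OF s])
    also have "\<dots> = integral UNIV ?g" using cov i2 s by blast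
    also have "\<dots> = (LBINT x. ?g x)" using s iff by (intro integral_lborel) auto
    finally show ?thesis .
  qed
qed

lemma Gamma_eq_gumbel_transform:
  assumes "s > -1"
  shows "integrable lborel (\<lambda>x. gumbel_density x * exp (- s * x))"
    and "(LBINT x. gumbel_density x * exp (- s * x)) = Gamma (1 + s)"
proof -
  define f where "f = (\<lambda>t::real. t powr s / exp t)"
  have "(f has_integral Gamma (1 + s)) {0..}"
    unfolding f_def using Gamma_integral_real[of "1 + s"] assms by simp
  moreover have "(f has_integral Gamma (1 + s)) {0..} \<longleftrightarrow> (f has_integral Gamma (1 + s)) {0<..}"
    by (rule has_integral_spike_set_eq) (auto intro: negligible_subset[of "{0}"])
  ultimately have h: "(f has_integral Gamma (1 + s)) {0<..}" by simp
  have m: "f \<in> borel_measurable borel" unfolding f_def by measurable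
  have "f absolutely_integrable_on {0<..}"
    by (rule nonnegative_absolutely_integrable_1) (use h in \<open>auto simp: f_def has_integral_iff\<close>)
  then have a: "set_integrable lborel {0<..} f"
    unfolding set_integrable_def by (subst (asm) integrable_completion) (use m in measurable)
  have e: "exp (- x) * f (exp (- x)) = gumbel_density x * exp (- s * x)" for x
    by (simp add: f_def gumbel_density_def powr_def exp_minus[of "exp (- x)"] divide_inverse mult_ac)
  show "integrable lborel (\<lambda>x. gumbel_density x * exp (- s * x))"
    using gumbel_substitution(1)[OF m] a unfolding e by simp
  have "(LBINT x. gumbel_density x * exp (- s * x)) = (LBINT t:{0<..}. f t)"
    using gumbel_substitution(2)[OF m a] unfolding e by simp
  then show "(LBINT x. gumbel_density x * exp (- s * x)) = Gamma (1 + s)"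
    using set_borel_integral_eq_integral(2)[OF a] h by (simp add: has_integral_iff)
qed

text \<open>
  Powers are absorbed by \<open>exp (c \<bar>x\<bar>)\<close> with a small \<open>c\<close>, and \<open>exp (3 \<bar>x\<bar> / 4)\<close> is integrable
  against the Gumbel density because \<open>Gamma (1 + s)\<close> is finite for \<open>s = \<plusminus> 3 / 4\<close>.
\<close>
lemma integrable_gumbel_moment:
  assumes "\<bar>s\<bar> < 1/2"
  shows "integrable lborel (\<lambda>x. gumbel_density x * x ^ k * exp (- s * x))"
    and "integrable lborel (\<lambda>x. gumbel_density x * \<bar>x\<bar> ^ k * exp (\<bar>s\<bar> * \<bar>x\<bar>))"
proof -
  define c where "c = 3/4 - \<bar>s\<bar>"
  have c: "c > 0" using assms by (simp add: c_def)
  have ex: "\<exists>C. \<forall>x. \<bar>x\<bar> ^ k * exp (\<bar>s\<bar> * \<bar>x\<bar>) \<le> C * (exp (- (3/4) * x) + exp (- (-3/4) * x))"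
  proof (intro exI allI)
    fix x :: real
    have "(c * \<bar>x\<bar>) ^ k / fact k \<le> exp (c * \<bar>x\<bar>)"
    proof -
      have "(c * \<bar>x\<bar>) ^ k / fact k \<le> (\<Sum>i. (c * \<bar>x\<bar>) ^ i /\<^sub>R fact i)"
        using sum_le_suminf[OF summable_exp_generic[of "c * \<bar>x\<bar>"], of "{k}"] c
        by (simp add: field_simps)
      then show ?thesis by (simp add: exp_def)
    qed
    then have "\<bar>x\<bar> ^ k \<le> fact k / c ^ k * exp (c * \<bar>x\<bar>)"
      using c by (simp add: power_mult_distrib field_simps)
    then have "\<bar>x\<bar> ^ k * exp (\<bar>s\<bar> * \<bar>x\<bar>) \<le> fact k / c ^ k * exp (c * \<bar>x\<bar>) * exp (\<bar>s\<bar> * \<bar>x\<bar>)"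
      by (rule mult_right_mono) simp
    also have "\<dots> = fact k / c ^ k * exp ((3/4) * \<bar>x\<bar>)"
      by (simp add: c_def exp_add[symmetric] algebra_simps)
    also have "\<dots> \<le> fact k / c ^ k * (exp (- (3/4) * x) + exp (- (-3/4) * x))"
      using c by (intro mult_left_mono) (auto simp: abs_if)
    finally show "\<bar>x\<bar> ^ k * exp (\<bar>s\<bar> * \<bar>x\<bar>) \<le> fact k / c ^ k * (exp (- (3/4) * x) + exp (- (-3/4) * x))" .
  qed
  then obtain C where C: "\<And>x. \<bar>x\<bar> ^ k * exp (\<bar>s\<bar> * \<bar>x\<bar>) \<le> C * (exp (- (3/4) * x) + exp (- (-3/4) * x))"
    by blast
  have dom: "integrable lborel (\<lambda>x. C * (gumbel_density x * exp (- (3/4) * x) + gumbel_density x * exp (- (-3/4) * x)))"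
    by (intro integrable_mult_right Bochner_Integration.integrable_add Gamma_eq_gumbel_transform(1)) auto
  have m: "gumbel_density \<in> borel_measurable borel"
    unfolding gumbel_density_def by measurable
  have bound: "gumbel_density x * (\<bar>x\<bar> ^ k * exp (\<bar>s\<bar> * \<bar>x\<bar>)) \<le>
      C * (gumbel_density x * exp (- (3/4) * x) + gumbel_density x * exp (- (-3/4) * x))" for x
    using mult_left_mono[OF C[of x] gumbel_density_nonneg[of x]] by (simp add: algebra_simps)
  show "integrable lborel (\<lambda>x. gumbel_density x * \<bar>x\<bar> ^ k * exp (\<bar>s\<bar> * \<bar>x\<bar>))"
  proof (rule Bochner_Integration.integrable_bound[OF dom])
    show "AE x in lborel. norm (gumbel_density x * \<bar>x\<bar> ^ k * exp (\<bar>s\<bar> * \<bar>x\<bar>)) \<le>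
       norm (C * (gumbel_density x * exp (- (3/4) * x) + gumbel_density x * exp (- (-3/4) * x)))"
    proof (rule AE_I2)
      fix x :: real
      have "norm (gumbel_density x * \<bar>x\<bar> ^ k * exp (\<bar>s\<bar> * \<bar>x\<bar>)) =
          gumbel_density x * (\<bar>x\<bar> ^ k * exp (\<bar>s\<bar> * \<bar>x\<bar>))"
        by (simp add: abs_mult gumbel_density_nonneg mult.assoc)
      then show "norm (gumbel_density x * \<bar>x\<bar> ^ k * exp (\<bar>s\<bar> * \<bar>x\<bar>)) \<le>
       norm (C * (gumbel_density x * exp (- (3/4) * x) + gumbel_density x * exp (- (-3/4) * x)))"
        using bound[of x] unfolding real_norm_def by linarith
    qed
  qed (use m in measurable)
  show "integrable lborel (\<lambda>x. gumbel_density x * x ^ k * exp (- s * x))"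
  proof (rule Bochner_Integration.integrable_bound[OF dom])
    show "AE x in lborel. norm (gumbel_density x * x ^ k * exp (- s * x)) \<le>
       norm (C * (gumbel_density x * exp (- (3/4) * x) + gumbel_density x * exp (- (-3/4) * x)))"
    proof (rule AE_I2)
      fix x :: real
      have "- s * x \<le> \<bar>s\<bar> * \<bar>x\<bar>" by (metis abs_ge_self abs_minus_cancel abs_mult)
      then have "norm (gumbel_density x * x ^ k * exp (- s * x)) \<le> gumbel_density x * (\<bar>x\<bar> ^ k * exp (\<bar>s\<bar> * \<bar>x\<bar>))"
        by (auto simp: abs_mult power_abs gumbel_density_nonneg mult.assoc intro!: mult_left_mono)
      then show "norm (gumbel_density x * x ^ k * exp (- s * x)) \<le>
       norm (C * (gumbel_density x * exp (- (3/4) * x) + gumbel_density x * exp (- (-3/4) * x)))"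
        using bound[of x] unfolding real_norm_def by linarith
    qed
  qed (use m in measurable)
qed

text \<open>
  Up to sign, the \<open>k\<close>-th derivative of the Laplace transform of the Gumbel distribution at \<open>s\<close>.
\<close>
definition gumbel_transform :: "nat \<Rightarrow> real \<Rightarrow> real" where
  "gumbel_transform k s = (LBINT x. gumbel_density x * x ^ k * exp (- s * x))"

text \<open>
  Differentiation under the integral sign. The difference quotient deviates from the derivative by at
  most \<open>\<bar>h\<bar>\<close> times a fixed integral, by the second order estimate for the exponential function.
\<close>
lemma gumbel_transform_deriv:
  assumes s: "\<bar>s\<bar> < 1/4"
  shows "(gumbel_transform k has_real_derivative - gumbel_transform (Suc k) s) (at s)"
proof -
  define t where "t = \<bar>s\<bar> + 1/4"
  have t: "\<bar>t\<bar> < 1/2" "t \<ge> 0" using s by (auto simp: t_def)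
  define D where "D = (LBINT x. gumbel_density x * \<bar>x\<bar> ^ (k + 2) * exp (\<bar>t\<bar> * \<bar>x\<bar>))"
  have bound: "\<bar>(gumbel_transform k (s + h) - gumbel_transform k s) / h - (- gumbel_transform (Suc k) s)\<bar> \<le> \<bar>h\<bar> * D"
    if h: "h \<noteq> 0" "\<bar>h\<bar> < 1/4" for h
  proof -
    have sh: "\<bar>s + h\<bar> < 1/2" "\<bar>s\<bar> < 1/2" using s h abs_triangle_ineq[of s h] by linarith+
    note i1 = integrable_gumbel_moment(1)[OF sh(1), of k]
    note i2 = integrable_gumbel_moment(1)[OF sh(2), of k]
    note i3 = integrable_gumbel_moment(1)[OF sh(2), of "Suc k"]
    note i4 = integrable_gumbel_moment(2)[OF t(1), of "k + 2"]
    let ?F = "\<lambda>x. (gumbel_density x * x ^ k * exp (- (s + h) * x) - gumbel_density x * x ^ k * exp (- s * x)) / h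
        + gumbel_density x * x ^ Suc k * exp (- s * x)"
    have eq: "(gumbel_transform k (s + h) - gumbel_transform k s) / h - (- gumbel_transform (Suc k) s) = (LBINT x. ?F x)"
      unfolding gumbel_transform_def using i1 i2 i3 by simp
    have "\<bar>LBINT x. ?F x\<bar> \<le> (LBINT x. \<bar>?F x\<bar>)" by (rule integral_abs_bound)
    also have "\<dots> \<le> (LBINT x. \<bar>h\<bar> * (gumbel_density x * \<bar>x\<bar> ^ (k + 2) * exp (\<bar>t\<bar> * \<bar>x\<bar>)))"
    proof (rule integral_mono)
      show "integrable lborel (\<lambda>x. \<bar>?F x\<bar>)" using i1 i2 i3 by (intro integrable_abs) simp
      show "integrable lborel (\<lambda>x. \<bar>h\<bar> * (gumbel_density x * \<bar>x\<bar> ^ (k + 2) * exp (\<bar>t\<bar> * \<bar>x\<bar>)))"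
        using i4 by simp
      fix x :: real
      have "?F x = gumbel_density x * x ^ k * exp (- s * x) * ((exp (- h * x) - 1 - (- h * x)) / h)"
      proof -
        have "exp (- (s + h) * x) = exp (- s * x) * exp (- h * x)"
          by (simp add: exp_add[symmetric] algebra_simps)
        moreover have "(G * P * (E * H) - G * P * E) / h + G * (x * P) * E = G * P * E * ((H - 1 - (- h * x)) / h)"
          for G P E H :: real using h by (simp add: field_simps)
        ultimately show ?thesis by (simp only: power_Suc)
      qed
      also have "\<bar>\<dots>\<bar> = gumbel_density x * \<bar>x\<bar> ^ k * exp (- s * x) * (\<bar>exp (- h * x) - 1 - (- h * x)\<bar> / \<bar>h\<bar>)"
        by (simp add: abs_mult power_abs gumbel_density_nonneg)
      also have "\<dots> \<le> gumbel_density x * \<bar>x\<bar> ^ k * exp (\<bar>s\<bar> * \<bar>x\<bar>) * (((- h * x)\<^sup>2 * exp ((1/4) * \<bar>x\<bar>)) / \<bar>h\<bar>)"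
      proof (intro mult_mono mult_left_mono divide_right_mono)
        have "- s * x \<le> \<bar>s\<bar> * \<bar>x\<bar>" by (metis abs_ge_self abs_minus_cancel abs_mult)
        then show "exp (- s * x) \<le> exp (\<bar>s\<bar> * \<bar>x\<bar>)" by simp
        have "\<bar>- h * x\<bar> \<le> 1/4 * \<bar>x\<bar>"
          unfolding abs_mult using h by (intro mult_right_mono) auto
        then show "\<bar>exp (- h * x) - 1 - (- h * x)\<bar> \<le> (- h * x)\<^sup>2 * exp ((1/4) * \<bar>x\<bar>)"
          by (intro order_trans[OF exp_taylor2_abs] mult_left_mono) auto
      qed (auto simp: gumbel_density_nonneg)
      also have "\<dots> = \<bar>h\<bar> * (gumbel_density x * \<bar>x\<bar> ^ (k + 2) * exp (\<bar>t\<bar> * \<bar>x\<bar>))"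
      proof -
        have A: "((- h * x)\<^sup>2 * E) / \<bar>h\<bar> = \<bar>h\<bar> * (\<bar>x\<bar>\<^sup>2 * E)" for E
          using h by (simp add: power_mult_distrib field_simps) (simp add: power2_eq_square)
        have B: "exp (\<bar>t\<bar> * \<bar>x\<bar>) = exp (\<bar>s\<bar> * \<bar>x\<bar>) * exp ((1/4) * \<bar>x\<bar>)"
          by (simp add: t_def exp_add[symmetric] algebra_simps)
        show ?thesis unfolding A B power_add by (simp only: mult_ac)
      qed
      finally show "\<bar>?F x\<bar> \<le> \<bar>h\<bar> * (gumbel_density x * \<bar>x\<bar> ^ (k + 2) * exp (\<bar>t\<bar> * \<bar>x\<bar>))" .
    qed
    also have "\<dots> = \<bar>h\<bar> * D" unfolding D_def by simp
    finally show ?thesis unfolding eq .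
  qed
  have "((\<lambda>h. (gumbel_transform k (s + h) - gumbel_transform k s) / h - (- gumbel_transform (Suc k) s)) \<longlongrightarrow> 0) (at 0)"
  proof (rule Lim_null_comparison)
    have "\<forall>\<^sub>F h in at (0::real). h \<noteq> 0 \<and> \<bar>h\<bar> < 1/4"
      unfolding eventually_at by (auto intro!: exI[of _ "1/4"])
    then show "\<forall>\<^sub>F h in at 0. norm ((gumbel_transform k (s + h) - gumbel_transform k s) / h - (- gumbel_transform (Suc k) s)) \<le> \<bar>h\<bar> * D"
      by eventually_elim (use bound in auto)
    show "((\<lambda>h. \<bar>h\<bar> * D) \<longlongrightarrow> 0) (at 0)" by (auto intro!: tendsto_eq_intros)
  qed
  then show ?thesis unfolding DERIV_def by (rule LIM_zero_cancel)
qed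

text \<open>
  The logarithmic derivative of \<open>Gamma\<close> is \<open>Digamma\<close>, with the value \<open>- euler_mascheroni\<close> at \<open>1\<close>; the
  derivative of \<open>Digamma\<close> at \<open>1\<close> is the sum of the inverse squares.
\<close>
lemma gumbel_moments:
  "(LBINT x. gumbel_density x) = 1"
  "(LBINT x. gumbel_density x * x) = euler_mascheroni"
  "(LBINT x. gumbel_density x * x\<^sup>2) = euler_mascheroni\<^sup>2 + pi\<^sup>2 / 6"
proof -
  have g0: "gumbel_transform 0 s = Gamma (1 + s)" if "\<bar>s\<bar> < 1/4" for s
    using Gamma_eq_gumbel_transform(2)[of s] that by (simp add: gumbel_transform_def)
  have np: "1 + s \<notin> \<int>\<^sub>\<le>\<^sub>0" if "\<bar>s\<bar> < 1/4" for s :: real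
    using that by (auto elim!: nonpos_Ints_cases)
  have dG: "((\<lambda>s. Gamma (1 + s)) has_real_derivative Gamma (1 + s) * Digamma (1 + s)) (at s)" if "\<bar>s\<bar> < 1/4" for s
    using np[OF that] by (auto intro!: derivative_eq_intros)
  have op: "open {s::real. \<bar>s\<bar> < 1/4}" by (intro open_Collect_less continuous_intros)
  have g1: "gumbel_transform 1 s = - (Gamma (1 + s) * Digamma (1 + s))" if s: "\<bar>s\<bar> < 1/4" for s
  proof -
    have "((\<lambda>s. Gamma (1 + s)) has_real_derivative - gumbel_transform (Suc 0) s) (at s)"
      by (rule has_field_derivative_transform_within_open[OF gumbel_transform_deriv[OF s] op])
         (use s g0 in auto)
    from DERIV_unique[OF this dG[OF s]] show ?thesis by simp
  qed
  have "((\<lambda>s. - (Gamma (1 + s) * Digamma (1 + s))) has_real_derivative - gumbel_transform (Suc 1) 0) (at 0)"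
    by (rule has_field_derivative_transform_within_open[OF gumbel_transform_deriv op])
       (use g1 in auto)
  moreover have "((\<lambda>s. - (Gamma (1 + s) * Digamma (1 + s))) has_real_derivative
      - (Gamma 1 * Digamma 1 * Digamma 1 + Polygamma 1 1 * Gamma (1::real))) (at 0)"
    using np[of 0] by (auto intro!: derivative_eq_intros)
  ultimately have "gumbel_transform 2 0 = Digamma 1 * Digamma 1 + Polygamma 1 (1::real)"
    by (auto dest: DERIV_unique simp: numeral_2_eq_2)
  moreover have "Polygamma 1 (1::real) = pi\<^sup>2 / 6"
  proof -
    have eq: "inverse ((1 + of_nat k) ^ Suc 1) = 1 / (real k + 1)\<^sup>2" for k
      by (simp add: power2_eq_square divide_inverse add.commute[of 1])
    show ?thesis
      using sums_unique[OF inverse_squares_sums] unfolding Polygamma_def eq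
      by (simp add: add.commute[of 1])
  qed
  ultimately have g2: "gumbel_transform 2 0 = euler_mascheroni\<^sup>2 + pi\<^sup>2 / 6"
    by (simp add: power2_eq_square)
  show "(LBINT x. gumbel_density x) = 1"
    using g0[of 0] by (simp add: gumbel_transform_def)
  show "(LBINT x. gumbel_density x * x) = euler_mascheroni"
    using g1[of 0] by (simp add: gumbel_transform_def)
  show "(LBINT x. gumbel_density x * x\<^sup>2) = euler_mascheroni\<^sup>2 + pi\<^sup>2 / 6"
    using g2 by (simp add: gumbel_transform_def)
qed

lemma integral_gumbel_correction:
  "(LBINT x. \<bar>gumbel_correction x\<bar>) = (6 * (euler_mascheroni\<^sup>2 + 2 * euler_mascheroni + 2) + pi\<^sup>2) / 12"
proof -
  have i: "integrable lborel (\<lambda>x. gumbel_density x * x ^ k)" for k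
    using integrable_gumbel_moment(1)[of 0 k] by simp
  have "(LBINT x. \<bar>gumbel_correction x\<bar>) =
      (LBINT x. gumbel_density x * x\<^sup>2 / 2 + (gumbel_density x * x + gumbel_density x))"
    by (intro Bochner_Integration.integral_cong refl)
       (simp add: abs_of_nonneg[OF gumbel_correction_nonneg], simp add: gumbel_correction_def algebra_simps)
  also have "\<dots> = (LBINT x. gumbel_density x * x\<^sup>2) / 2 + ((LBINT x. gumbel_density x * x) + (LBINT x. gumbel_density x))"
    using i[of 2] i[of 1] i[of 0] by simp
  also have "\<dots> = (6 * (euler_mascheroni\<^sup>2 + 2 * euler_mascheroni + 2) + pi\<^sup>2) / 12"
    unfolding gumbel_moments by (simp add: field_simps)
  finally show ?thesis .
qed

section \<open>Numerical values of the constants\<close>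

lemma exp_bounds_e: "27 / 10 < exp (1::real)" "exp (1::real) < 272 / 100"
proof -
  have "5837465777 / 2147483648 - exp 1 \<le> inverse (2 ^ 32 :: real)"
    using e_approx_32 unfolding abs_le_iff by auto
  then show "27 / 10 < exp (1::real)" by simp
  show "exp (1::real) < 272 / 100" by (rule e_less_272)
qed

lemma exp_ge_e_times: "exp 1 * z \<le> exp (z::real)"
proof -
  have "z \<le> exp (z - 1)" using exp_ge_add_one_self[of "z - 1"] by simp
  then have "exp 1 * z \<le> exp 1 * exp (z - 1)" by (intro mult_left_mono) auto
  then show ?thesis by (simp add: exp_add[symmetric])
qed

lemma exp_ge_cubic: "1 + z + z\<^sup>2 / 2 + z ^ 3 / 6 \<le> exp (z::real)"
proof -
  obtain t where "exp z = (\<Sum>m<4. z ^ m / fact m) + exp t / fact 4 * z ^ 4"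
    using Maclaurin_exp_le[of z 4] by blast
  moreover have "0 \<le> exp t / fact 4 * z ^ 4" by simp
  ultimately show ?thesis by (simp add: numeral_eq_Suc)
qed

lemma square_exp_le: "t \<ge> 0 \<Longrightarrow> t\<^sup>2 * exp (- t) \<le> 4 / (exp 1)\<^sup>2" for t :: real
proof -
  assume t: "t \<ge> 0"
  have "(exp 1 * (t / 2))\<^sup>2 \<le> (exp (t / 2))\<^sup>2"
    using t by (intro power_mono exp_ge_e_times) auto
  also have "(exp (t / 2))\<^sup>2 = exp t" by (simp add: exp_double[symmetric])
  finally show ?thesis by (simp add: exp_minus field_simps power2_eq_square)
qed

text \<open>
  The exponent \<open>x + exp (- x)\<close> of the Gumbel density is convex; this is its tangent at \<open>x = ln 4\<close>, close
  to the maximizers for both constants, with \<open>ln 4\<close> replaced by its lower bound \<open>4 / 3\<close>.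
\<close>
lemma gumbel_density_tangent_bound:
  "exp (- exp (- x)) * exp (- x) \<le> exp (- ((3 / 4) * x + 7 / 12))" for x :: real
proof -
  have "4 * exp (- x) = exp (ln 4 - x)" by (simp add: exp_diff exp_minus divide_inverse)
  also have "\<dots> \<ge> 1 + (ln 4 - x)" by (rule exp_ge_add_one_self)
  finally have a: "1 + (ln 4 - x) \<le> 4 * exp (- x)" .
  have "ln (4::real) = 2 * ln 2" using ln_realpow[of 2 2] by simp
  then have "ln (4::real) \<ge> 4 / 3" using ln2_ge_two_thirds by linarith
  with a have "(3 / 4) * x + 7 / 12 \<le> exp (- x) + x" by linarith
  then show ?thesis by (simp add: exp_add[symmetric])
qed

text \<open>
  Both suprema are bounded from below by their value at \<open>x = 1\<close>, which leaves little but enough room.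
\<close>
lemma gumbel_density_at_1: "507 / 2000 < exp (- exp (- 1)) * exp (- 1 :: real)"
proof -
  define y :: real where "y = exp (- 1)"
  have ye: "y * exp 1 = 1" by (simp add: y_def exp_add[symmetric])
  have y: "0 < y" by (simp add: y_def)
  have y1: "y \<le> 1 / (27 / 10)" and y2: "1 / (272 / 100) \<le> y"
    using exp_bounds_e unfolding y_def exp_minus by (auto simp: field_simps)
  define c :: real where "c = 10 / 27"
  have "1 + (- c) + (- c)\<^sup>2 / 2 + (- c) ^ 3 / 6 \<le> exp (- c)" by (rule exp_ge_cubic)
  also have "\<dots> \<le> exp (- y)" using y1 by (simp add: c_def)
  finally have "(1 + (- c) + (- c)\<^sup>2 / 2 + (- c) ^ 3 / 6) * (1 / (272 / 100)) \<le> exp (- y) * y"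
    using y2 by (intro mult_mono) auto
  then show ?thesis by (simp add: y_def c_def eval_nat_numeral)
qed

text \<open>
  With \<open>z = (3 x - 3) / 4\<close> the tangent bound becomes \<open>exp (- (4 / 3 + z))\<close>, and for \<open>x \<ge> 0\<close> the claim is a
  polynomial inequality in \<open>z\<close>. The polynomial factor \<open>1 + (x + 1)\<^sup>2\<close> is at most \<open>2\<close> on \<open>[- 2, 0]\<close>, and
  further left it is at most \<open>exp (- x)\<close>.
\<close>
lemma d1_bounds: "\<bar>d1 - 1.3\<bar> < 0.05"
proof -
  let ?f = "\<lambda>x::real. (x\<^sup>2 + 2 * x + 2) * exp (- exp (- x)) * exp (- x)"
  have upper: "?f x \<le> 134 / 100" for x
  proof -
    have sq: "x\<^sup>2 + 2 * x + 2 = 1 + (x + 1)\<^sup>2" by (simp add: power2_eq_square algebra_simps)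
    consider "x \<ge> 0" | "x < 0" "x \<ge> -2" | "x < -2" by linarith
    then show ?thesis
    proof cases
      case 1
      define z where "z = (3 * x - 3) / 4"
      have z: "z \<ge> - (3 / 4)" using 1 by (simp add: z_def)
      have "exp (4 / 3 :: real) = exp 1 * exp (1 / 3)" by (simp add: exp_add[symmetric])
      moreover have "1 + 1 / 3 + (1 / 3)\<^sup>2 / 2 + (1 / 3) ^ 3 / 6 \<le> exp (1 / 3 :: real)" by (rule exp_ge_cubic)
      then have "27 / 10 * (1 + 1 / 3 + (1 / 3)\<^sup>2 / 2 + (1 / 3) ^ 3 / 6) \<le> exp 1 * exp (1 / 3 :: real)"
        using exp_bounds_e by (intro mult_mono) auto
      ultimately have K: "376 / 100 \<le> exp (4 / 3 :: real)" by (simp add: eval_nat_numeral)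
      have poly: "0 \<le> 1 + z + z\<^sup>2 / 2 + z ^ 3 / 6 \<and>
          1 + (x + 1)\<^sup>2 \<le> 134 / 100 * (376 / 100) * (1 + z + z\<^sup>2 / 2 + z ^ 3 / 6)"
      proof (cases "z \<ge> 0")
        case True
        have x: "x = 1 + 4 * z / 3" unfolding z_def by (simp add: field_simps)
        have sq: "1 + (x + 1)\<^sup>2 = 5 + 16 / 3 * z + 16 / 9 * z\<^sup>2"
          unfolding x by (simp add: power2_eq_square field_simps)
        have "0 \<le> (z - 1/5)\<^sup>2" by simp
        then have "2 / 5 * z - 1 / 25 \<le> z\<^sup>2" by (simp add: power2_eq_square algebra_simps)
        moreover have "z ^ 3 \<ge> 0" "z\<^sup>2 \<ge> 0" using True by auto
        moreover have "0 \<le> 1 + z + q / 2 + r / 6 \<and>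
            5 + 16 / 3 * z + 16 / 9 * q \<le> 134 / 100 * (376 / 100) * (1 + z + q / 2 + r / 6)"
          if "2 / 5 * z - 1 / 25 \<le> q" "0 \<le> r" "0 \<le> q" for q r :: real
          using that True by (auto simp: field_simps)
        ultimately show ?thesis unfolding sq by blast
      next
        case False
        have x: "x = 1 + 4 * z / 3" unfolding z_def by (simp add: field_simps)
        have sq: "1 + (x + 1)\<^sup>2 = 5 + 16 / 3 * z + 16 / 9 * z\<^sup>2"
          unfolding x by (simp add: power2_eq_square field_simps)
        have "z\<^sup>2 * (- (3 / 4)) \<le> z\<^sup>2 * z" using z by (intro mult_left_mono) auto
        then have z3: "- (3 / 4) * z\<^sup>2 \<le> z ^ 3" by (simp add: eval_nat_numeral)
        have z2: "0 \<le> z\<^sup>2" by simp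
        have key: "0 \<le> 1 + z + q / 2 + r / 6 \<and>
            5 + 16 / 3 * z + 16 / 9 * q \<le> 134 / 100 * (376 / 100) * (1 + z + q / 2 + r / 6)"
          if "- (3 / 4) * q \<le> r" "0 \<le> q" for q r :: real
          using that z False by (auto simp: field_simps)
        show ?thesis unfolding sq by (rule key[OF z3 z2])
      qed
      have e: "exp (- ((3 / 4) * x + 7 / 12)) = 1 / (exp (4 / 3) * exp z)"
      proof -
        have "(3 / 4) * x + 7 / 12 = 4 / 3 + z" by (simp add: z_def field_simps)
        then show ?thesis by (simp only: exp_minus exp_add inverse_eq_divide)
      qed
      have "376 / 100 * (1 + z + z\<^sup>2 / 2 + z ^ 3 / 6) \<le> exp (4 / 3) * exp z"
        using K poly by (intro mult_mono exp_ge_cubic) auto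
      then have "1 + (x + 1)\<^sup>2 \<le> 134 / 100 * (exp (4 / 3) * exp z)" using poly by linarith
      then have "(1 + (x + 1)\<^sup>2) * exp (- ((3 / 4) * x + 7 / 12)) \<le> 134 / 100"
        unfolding e by (simp add: divide_le_eq)
      moreover have "?f x \<le> (1 + (x + 1)\<^sup>2) * exp (- ((3 / 4) * x + 7 / 12))"
        unfolding sq mult.assoc by (intro mult_left_mono gumbel_density_tangent_bound) (simp add: add_nonneg_nonneg)
      ultimately show ?thesis by linarith
    next
      case 2
      have "\<bar>x + 1\<bar> \<le> 1" using 2 by auto
      then have "(x + 1)\<^sup>2 \<le> 1" by (simp add: abs_square_le_1)
      moreover have "exp (- exp (- x)) * exp (- x) \<le> 10 / 27"
      proof -
        have "exp (- x) * exp 1 \<le> exp (exp (- x))" using exp_ge_e_times[of "exp (- x)"] by (simp add: mult.commute)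
        then have "exp (- exp (- x)) * exp (- x) \<le> 1 / exp 1" by (simp add: exp_minus field_simps)
        also have "\<dots> \<le> 10 / 27" using exp_bounds_e by (simp add: field_simps)
        finally show ?thesis .
      qed
      ultimately have "(1 + (x + 1)\<^sup>2) * (exp (- exp (- x)) * exp (- x)) \<le> 2 * (10 / 27)"
        by (intro mult_mono) auto
      then show ?thesis unfolding sq mult.assoc by simp
    next
      case 3
      define t where "t = exp (- x)"
      have "exp 1 * (- x / 2) \<le> exp (- x / 2)" by (rule exp_ge_e_times)
      moreover have "2 * (- x / 2) \<le> exp 1 * (- x / 2)"
        using exp_bounds_e 3 by (intro mult_right_mono) auto
      ultimately have "- x \<le> exp (- x / 2)" by linarith
      then have "(- x)\<^sup>2 \<le> (exp (- x / 2))\<^sup>2" using 3 by (intro power_mono) auto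
      then have "x\<^sup>2 \<le> t" by (simp add: t_def exp_double[symmetric])
      then have "x\<^sup>2 + 2 * x + 2 \<le> t" using 3 by linarith
      then have "(x\<^sup>2 + 2 * x + 2) * (exp (- t) * t) \<le> t * (exp (- t) * t)"
        by (intro mult_right_mono) (auto simp: t_def)
      also have "\<dots> = t\<^sup>2 * exp (- t)" by (simp add: power2_eq_square)
      also have "\<dots> \<le> 4 / (exp 1)\<^sup>2" by (rule square_exp_le) (simp add: t_def)
      also have "\<dots> \<le> 4 / (2 ^ 2)" using exp_bounds_e by (intro divide_left_mono power_mono) auto
      finally show ?thesis by (simp add: t_def mult.assoc)
    qed
  qed
  have bdd: "bdd_above (range ?f)" by (rule bdd_aboveI2) (rule upper)
  have "507 / 400 < ?f 1" using gumbel_density_at_1 by simp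
  also have "?f 1 \<le> d1"
    unfolding d1_def by (rule cSUP_upper[OF _ bdd]) simp
  finally have "507 / 400 < d1" .
  moreover have "d1 \<le> 134 / 100" unfolding d1_def by (rule cSUP_least) (simp, rule upper)
  ultimately show ?thesis unfolding abs_less_iff by auto
qed

lemma d2_bounds: "\<bar>d2 - 0.3\<bar> < 0.05"
proof -
  let ?f = "\<lambda>x::real. \<bar>x\<bar> * exp (- exp (- x)) * exp (- x)"
  have upper: "?f x \<le> 34 / 100" for x
  proof (cases "x \<ge> 0")
    case True
    have "exp 1 * (3 / 4 * x) \<le> exp (3 / 4 * x)" by (rule exp_ge_e_times)
    moreover have "27 / 10 * (3 / 4 * x) \<le> exp 1 * (3 / 4 * x)"
      using exp_bounds_e True by (intro mult_right_mono) auto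
    ultimately have a: "81 / 40 * x \<le> exp (3 / 4 * x)" by linarith
    have b: "1 + 7 / 12 \<le> exp (7 / 12 :: real)" by (rule exp_ge_add_one_self)
    have "81 / 40 * x * (1 + 7 / 12) \<le> exp (3 / 4 * x) * exp (7 / 12)"
      using a b True by (intro mult_mono) auto
    then have "3 * x \<le> exp ((3 / 4) * x + 7 / 12)" using True by (simp add: exp_add)
    then have "x * exp (- ((3 / 4) * x + 7 / 12)) \<le> 1 / 3"
      by (simp only: exp_minus) (simp add: field_simps)
    moreover have "?f x \<le> x * exp (- ((3 / 4) * x + 7 / 12))"
      using mult_left_mono[OF gumbel_density_tangent_bound True, of x] True
      by (simp only: abs_of_nonneg mult.assoc)
    ultimately show ?thesis by linarith
  next
    case False
    define t where "t = exp (- x)"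
    have "exp 1 * \<bar>x\<bar> \<le> t" using exp_ge_e_times[of "- x"] False by (simp add: t_def)
    moreover have "27 / 10 * \<bar>x\<bar> \<le> exp 1 * \<bar>x\<bar>" using exp_bounds_e by (intro mult_right_mono) auto
    ultimately have x: "\<bar>x\<bar> \<le> 10 / 27 * t" by linarith
    have "\<bar>x\<bar> * (exp (- t) * t) \<le> 10 / 27 * t * (exp (- t) * t)"
      using x by (intro mult_right_mono) (auto simp: t_def)
    also have "\<dots> = 10 / 27 * (t\<^sup>2 * exp (- t))" by (simp add: power2_eq_square)
    also have "\<dots> \<le> 10 / 27 * (4 / (exp 1)\<^sup>2)"
      by (intro mult_left_mono square_exp_le) (auto simp: t_def)
    also have "\<dots> \<le> 10 / 27 * (4 / (27 / 10) ^ 2)"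
      using exp_bounds_e by (intro mult_left_mono divide_left_mono power_mono) auto
    finally show ?thesis by (simp add: t_def mult.assoc power2_eq_square)
  qed
  have bdd: "bdd_above (range ?f)" by (rule bdd_aboveI2) (rule upper)
  have "507 / 2000 < ?f 1" using gumbel_density_at_1 by simp
  also have "?f 1 \<le> d2"
    unfolding d2_def by (rule cSUP_upper[OF _ bdd]) simp
  finally have "507 / 2000 < d2" .
  moreover have "d2 \<le> 34 / 100" unfolding d2_def by (rule cSUP_least) (simp, rule upper)
  ultimately show ?thesis unfolding abs_less_iff by auto
qed

text \<open>
  The bounds are \<open>exp (- t)\<close> times convergents of the continued fraction of the exponential integral. If
  \<open>R\<close> is such a rational function, \<open>- exp (- t) R\<close> has the derivative \<open>exp (- t) (R - R')\<close>, and \<open>R - R'\<close>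
  differs from \<open>1 / t\<close> only by a small term of known sign. At \<open>t = 1\<close> the two convergents are \<open>4 / 7\<close> and \<open>8 / 13\<close>.
\<close>
lemma E1_at_1_bounds:
  shows set_integrable_E1: "set_integrable lborel {1::real<..} (\<lambda>t. exp (- t) / t)"
    and E1_lower: "4 / 7 * exp (- 1) \<le> E1 1"
    and E1_upper: "E1 1 \<le> 8 / 13 * exp (- 1)"
proof -
  have ein: "einterval (ereal 1) \<infinity> = {1::real<..}" by (auto simp: einterval_def)
  define fu where "fu = (\<lambda>t::real. exp (- t) * (1 / t + 12 / (t * (t\<^sup>2 + 6 * t + 6))\<^sup>2))"
  define Fu where "Fu = (\<lambda>t::real. - (exp (- t) * ((t\<^sup>2 + 5 * t + 2) / (t * (t\<^sup>2 + 6 * t + 6)))))"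
  define fl where "fl = (\<lambda>t::real. exp (- t) * (1 / t - 4 / (t * (t\<^sup>2 + 4 * t + 2)\<^sup>2)))"
  define Fl where "Fl = (\<lambda>t::real. - (exp (- t) * ((t + 3) / (t\<^sup>2 + 4 * t + 2))))"
  have pos: "t\<^sup>2 + 6 * t + 6 > 0" "t\<^sup>2 + 4 * t + 2 > 0" if "t \<ge> 1" for t :: real
    using that by (auto intro: add_pos_pos add_nonneg_pos)
  have prod: "((\<lambda>t. - (exp (- t) * R t)) has_real_derivative exp (- t) * (R t - R')) (at t)"
    if "(R has_real_derivative R') (at t)" for R R' and t :: real
    using that by (auto intro!: derivative_eq_intros simp: algebra_simps)
  have dFu: "(Fu has_real_derivative fu t) (at t)" if "t \<ge> 1" for t
  proof -
    define N where "N = t\<^sup>2 + 5 * t + 2"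
    define Q where "Q = t\<^sup>2 + 6 * t + 6"
    have nz: "t \<noteq> 0" "Q \<noteq> 0" "t * Q \<noteq> 0" using pos[OF that] that by (auto simp: Q_def)
    have "((\<lambda>t. (t\<^sup>2 + 5 * t + 2) / (t * (t\<^sup>2 + 6 * t + 6))) has_real_derivative
        ((2 * t + 5) * (t * Q) - N * (Q + t * (2 * t + 6))) / (t * Q)\<^sup>2) (at t)"
      using nz unfolding N_def Q_def
      by (auto intro!: derivative_eq_intros simp: power2_eq_square algebra_simps)
    from prod[OF this] have "(Fu has_real_derivative exp (- t) * (N / (t * Q) -
        ((2 * t + 5) * (t * Q) - N * (Q + t * (2 * t + 6))) / (t * Q)\<^sup>2)) (at t)"
      unfolding Fu_def N_def Q_def .
    also have "N / (t * Q) - ((2 * t + 5) * (t * Q) - N * (Q + t * (2 * t + 6))) / (t * Q)\<^sup>2 =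
      (N * (t * Q) - ((2 * t + 5) * (t * Q) - N * (Q + t * (2 * t + 6)))) / (t * Q)\<^sup>2"
      using nz by (simp add: power2_eq_square diff_divide_distrib)
    \<comment> \<open>The convergent is chosen so that the numerator exceeds \<open>t Q\<^sup>2\<close> by a constant.\<close>
    also have "N * (t * Q) - ((2 * t + 5) * (t * Q) - N * (Q + t * (2 * t + 6))) = t * Q\<^sup>2 + 12"
      unfolding N_def Q_def by algebra
    also have "(t * Q\<^sup>2 + 12) / (t * Q)\<^sup>2 = 1 / t + 12 / (t * Q)\<^sup>2"
      using nz by (simp add: add_divide_distrib power_mult_distrib power2_eq_square)
    finally show ?thesis unfolding fu_def Q_def .
  qed
  have dFl: "(Fl has_real_derivative fl t) (at t)" if "t \<ge> 1" for t
  proof -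
    define Q where "Q = t\<^sup>2 + 4 * t + 2"
    have nz: "t \<noteq> 0" "Q \<noteq> 0" using pos[OF that] that by (auto simp: Q_def)
    have "((\<lambda>t. (t + 3) / (t\<^sup>2 + 4 * t + 2)) has_real_derivative
        (Q - (t + 3) * (2 * t + 4)) / Q\<^sup>2) (at t)"
      using nz unfolding Q_def
      by (auto intro!: derivative_eq_intros simp: power2_eq_square algebra_simps)
    from prod[OF this] have "(Fl has_real_derivative exp (- t) * ((t + 3) / Q -
        (Q - (t + 3) * (2 * t + 4)) / Q\<^sup>2)) (at t)"
      unfolding Fl_def Q_def .
    also have "(t + 3) / Q - (Q - (t + 3) * (2 * t + 4)) / Q\<^sup>2 =
      t * ((t + 3) * Q - (Q - (t + 3) * (2 * t + 4))) / (t * Q\<^sup>2)"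
      using nz by (simp add: power2_eq_square diff_divide_distrib)
    also have "t * ((t + 3) * Q - (Q - (t + 3) * (2 * t + 4))) = Q\<^sup>2 - 4"
      unfolding Q_def by algebra
    also have "(Q\<^sup>2 - 4) / (t * Q\<^sup>2) = 1 / t - 4 / (t * Q\<^sup>2)"
      using nz by (simp add: diff_divide_distrib)
    finally show ?thesis unfolding fl_def Q_def .
  qed
  have cu: "isCont fu t" if "t \<ge> 1" for t
    unfolding fu_def using pos[OF that] that by (intro continuous_intros) auto
  have cl: "isCont fl t" if "t \<ge> 1" for t
    unfolding fl_def using pos[OF that] that by (intro continuous_intros) auto
  have fu0: "fu t \<ge> exp (- t) / t" if "t \<ge> 1" for t
    unfolding fu_def by (simp add: distrib_left)
  have fl1: "fl t \<le> exp (- t) / t" if "t \<ge> 1" for t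
    unfolding fl_def using that by (simp add: right_diff_distrib)
  have fl0: "fl t \<ge> 0" if "t \<ge> 1" for t
  proof -
    have "t\<^sup>2 + 4 * t + 2 \<ge> 2" using that by (simp add: add_nonneg_nonneg)
    then have "(t\<^sup>2 + 4 * t + 2)\<^sup>2 \<ge> 2\<^sup>2" by (intro power_mono) auto
    then have "4 / (t\<^sup>2 + 4 * t + 2)\<^sup>2 \<le> 1" using pos[OF that] by (simp add: divide_le_eq)
    then have "4 / (t\<^sup>2 + 4 * t + 2)\<^sup>2 * (1 / t) \<le> 1 * (1 / t)" using that by (intro mult_right_mono) auto
    then show ?thesis unfolding fl_def by (simp add: mult.commute)
  qed
  have integral: "set_integrable lborel {1::real<..} f" "(LBINT t:{1::real<..}. f t) = - F 1"
    if F: "\<And>t. t \<ge> 1 \<Longrightarrow> (F has_real_derivative f t) (at t)" and f: "\<And>t. t \<ge> 1 \<Longrightarrow> isCont f t"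
      and nn: "\<And>t. t \<ge> 1 \<Longrightarrow> 0 \<le> f t" and lim: "(F \<longlongrightarrow> 0) at_top" for f F :: "real \<Rightarrow> real"
  proof -
    have "(F \<longlongrightarrow> F 1) (at_right 1)"
      using DERIV_isCont[OF F, of 1] by (auto simp: isCont_def intro: filterlim_mono at_within_le_at)
    then have A: "((F \<circ> real_of_ereal) \<longlongrightarrow> F 1) (at_right (ereal 1))"
      unfolding ereal_tendsto_simps1 .
    have B: "((F \<circ> real_of_ereal) \<longlongrightarrow> 0) (at_left \<infinity>)"
      using lim unfolding ereal_tendsto_simps1 .
    have lt: "ereal 1 < \<infinity>" by simp
    note FTC = interval_integral_FTC_nonneg[OF lt _ _ _ A B, of f]
    have "set_integrable lborel (einterval (ereal 1) \<infinity>) f" by (rule FTC(1)) (use F f nn in auto)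
    then show "set_integrable lborel {1::real<..} f" unfolding ein .
    have "(LBINT t=ereal 1..\<infinity>. f t) = 0 - F 1" by (rule FTC(2)) (use F f nn in auto)
    then show "(LBINT t:{1::real<..}. f t) = - F 1" by (simp add: interval_lebesgue_integral_def ein)
  qed
  have "(Fu \<longlongrightarrow> 0) at_top" unfolding Fu_def by real_asymp
  then have U': "set_integrable lborel {1::real<..} fu" and U: "(LBINT t:{1::real<..}. fu t) = - Fu 1"
    using integral[of Fu fu] dFu cu by (auto simp: fu_def)
  have "(Fl \<longlongrightarrow> 0) at_top" unfolding Fl_def by real_asymp
  then have L': "set_integrable lborel {1::real<..} fl" and L: "(LBINT t:{1::real<..}. fl t) = - Fl 1"
    using integral[of Fl fl] dFl cl fl0 by auto
  show i: "set_integrable lborel {1::real<..} (\<lambda>t. exp (- t) / t)"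
    unfolding set_integrable_def
  proof (rule Bochner_Integration.integrable_bound[OF U'[unfolded set_integrable_def]])
    show "AE t in lborel. norm (indicator {1::real<..} t *\<^sub>R (exp (- t) / t)) \<le> norm (indicator {1::real<..} t *\<^sub>R fu t)"
      by (rule AE_I2) (auto split: split_indicator intro!: order_trans[OF fu0 abs_ge_self])
  qed measurable
  have "E1 1 \<le> (LBINT t:{1::real<..}. fu t)"
    unfolding E1_def by (rule set_integral_mono[OF i U']) (use fu0 in auto)
  also have "\<dots> = - Fu 1"
    by (rule U)
  also have "\<dots> = 8 / 13 * exp (- 1)" by (simp add: Fu_def)
  finally show "E1 1 \<le> 8 / 13 * exp (- 1)" .
  have "4 / 7 * exp (- 1) = - Fl 1" by (simp add: Fl_def)
  also have "\<dots> = (LBINT t:{1::real<..}. fl t)"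
    by (rule L[symmetric])
  also have "\<dots> \<le> E1 1"
    unfolding E1_def by (rule set_integral_mono[OF L' i]) (use fl1 in auto)
  finally show "4 / 7 * exp (- 1) \<le> E1 1" .
qed

text \<open>
  On \<open>t > 0\<close>, \<open>\<bar>ln t\<bar>\<close> is \<open>- ln t\<close> plus \<open>2 ln t\<close> on \<open>t > 1\<close>. The first part gives the mean of the Gumbel
  distribution. For the second, \<open>- exp (- t) ln t\<close> vanishes at \<open>1\<close> and at infinity, so that \<open>exp (- t) ln t\<close>
  and \<open>exp (- t) / t\<close> have the same integral over \<open>t > 1\<close>.
\<close>
lemma gumbel_abs_moment:
  "(LBINT x. \<bar>x * gumbel_density x\<bar>) = euler_mascheroni + 2 * E1 1"
  "(LBINT t:{0::real<..}. exp (- t) * \<bar>ln t\<bar>) = euler_mascheroni + 2 * E1 1"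
proof -
  have im: "integrable lborel (\<lambda>x. gumbel_density x * x)"
    using integrable_gumbel_moment(1)[of 0 1] by simp
  have ia: "integrable lborel (\<lambda>x. gumbel_density x * \<bar>x\<bar>)"
    using integrable_gumbel_moment(2)[of 0 1] by simp
  have m1: "(\<lambda>t::real. exp (- t) * \<bar>ln t\<bar>) \<in> borel_measurable borel"
    and m2: "(\<lambda>t::real. exp (- t) * ln t) \<in> borel_measurable borel" by measurable
  have e1: "exp (- x) * (exp (- exp (- x)) * \<bar>ln (exp (- x))\<bar>) = gumbel_density x * \<bar>x\<bar>" for x :: real
    by (simp add: gumbel_density_def)
  have e2: "exp (- x) * (exp (- exp (- x)) * ln (exp (- x))) = - (gumbel_density x * x)" for x :: real
    by (simp add: gumbel_density_def)
  have s1: "set_integrable lborel {0::real<..} (\<lambda>t. exp (- t) * \<bar>ln t\<bar>)"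
    using gumbel_substitution(1)[OF m1] ia unfolding e1 by simp
  have v1: "(LBINT t:{0::real<..}. exp (- t) * \<bar>ln t\<bar>) = (LBINT x. gumbel_density x * \<bar>x\<bar>)"
    using gumbel_substitution(2)[OF m1 s1] unfolding e1 .
  have s2: "set_integrable lborel {0::real<..} (\<lambda>t. exp (- t) * ln t)"
    using gumbel_substitution(1)[OF m2] im unfolding e2 by simp
  have v2: "(LBINT t:{0::real<..}. exp (- t) * ln t) = - euler_mascheroni"
    using gumbel_substitution(2)[OF m2 s2] gumbel_moments(2) unfolding e2 by simp
  have s3: "set_integrable lborel {1::real<..} (\<lambda>t. exp (- t) * ln t)"
    by (rule set_integrable_subset[OF s2]) auto
  have ein: "einterval (ereal 1) \<infinity> = {1<..}" by (auto simp: einterval_def)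
  have "(LBINT t=ereal 1..\<infinity>. exp (- t) * ln t - exp (- t) / t) = 0 - 0"
  proof (rule interval_integral_FTC_integrable[where F = "\<lambda>t. - (exp (- t) * ln t)"])
    show "((\<lambda>t. - (exp (- t) * ln t)) has_vector_derivative exp (- t) * ln t - exp (- t) / t) (at t)"
      if "ereal 1 < ereal t" for t
      using that unfolding has_real_derivative_iff_has_vector_derivative[symmetric]
      by (auto intro!: derivative_eq_intros simp: field_simps)
    show "isCont (\<lambda>t. exp (- t) * ln t - exp (- t) / t) t" if "ereal 1 < ereal t" for t
      using that by (intro continuous_intros) auto
    show "set_integrable lborel (einterval (ereal 1) \<infinity>) (\<lambda>t. exp (- t) * ln t - exp (- t) / t)"
      unfolding ein by (rule set_integral_diff[OF s3 set_integrable_E1])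
    show "(((\<lambda>t. - (exp (- t) * ln t)) \<circ> real_of_ereal) \<longlongrightarrow> 0) (at_right (ereal 1))"
      unfolding ereal_tendsto_simps1 by real_asymp
    show "(((\<lambda>t. - (exp (- t) * ln t)) \<circ> real_of_ereal) \<longlongrightarrow> 0) (at_left \<infinity>)"
      unfolding ereal_tendsto_simps1 by real_asymp
  qed auto
  then have "(LBINT t:{1::real<..}. exp (- t) * ln t - exp (- t) / t) = 0"
    by (simp add: interval_lebesgue_integral_def ein)
  then have v3: "(LBINT t:{1::real<..}. exp (- t) * ln t) = E1 1"
    by (subst (asm) set_integral_diff(2)[OF s3 set_integrable_E1]) (simp add: E1_def)
  have "(LBINT t:{0::real<..}. exp (- t) * \<bar>ln t\<bar>) =
      (LBINT t::real. 2 * (indicator {1::real<..} t *\<^sub>R (exp (- t) * ln t)) - indicator {0::real<..} t *\<^sub>R (exp (- t) * ln t))"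
    unfolding set_lebesgue_integral_def
    by (intro Bochner_Integration.integral_cong refl) (auto split: split_indicator simp: abs_if not_less)
  also have "\<dots> = 2 * (LBINT t:{1::real<..}. exp (- t) * ln t) - (LBINT t:{0::real<..}. exp (- t) * ln t)"
    using s2 s3 unfolding set_lebesgue_integral_def set_integrable_def
    by (subst Bochner_Integration.integral_diff) auto
  finally show a: "(LBINT t:{0::real<..}. exp (- t) * \<bar>ln t\<bar>) = euler_mascheroni + 2 * E1 1"
    unfolding v2 v3 by simp
  show "(LBINT x. \<bar>x * gumbel_density x\<bar>) = euler_mascheroni + 2 * E1 1"
    using a unfolding v1 by (simp add: abs_mult gumbel_density_nonneg mult.commute)
qed

lemma gumbel_abs_moment_numeric: "\<bar>euler_mascheroni + 2 * E1 1 - 1\<bar> < 0.05"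
proof -
  have "exp (- 1) \<le> 1 / (27 / 10 :: real)" "1 / (272 / 100) \<le> exp (- 1 :: real)"
    using exp_bounds_e unfolding exp_minus by (auto simp: field_simps)
  then show ?thesis
    using E1_lower E1_upper euler_mascheroni_gt_19_over_33 euler_mascheroni_less_13_over_22
    unfolding abs_less_iff by auto
qed

section \<open>Rates of convergence of normal maxima\<close>

lemma prob_sample_max_le:
  assumes "prob_space M" "prob_space.indep_vars M (\<lambda>_. borel) X {1..}"
    and "\<And>i. i \<ge> 1 \<Longrightarrow> distr M borel (X i) = std_normal_distribution" and n: "n \<ge> 1"
  shows "measure M {\<omega> \<in> space M. sample_max X n \<omega> \<le> y} = std_normal_cdf y ^ n"
proof -
  interpret prob_space M by fact
  have X: "X i \<in> borel_measurable M" if "i \<ge> 1" for i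
    using assms(2)[unfolded indep_vars_def2] that by simp
  have "{\<omega> \<in> space M. sample_max X n \<omega> \<le> y} = (\<Inter>i\<in>{1..n}. X i -` {..y} \<inter> space M)"
    using n by (auto simp: sample_max_def)
  then have "prob {\<omega> \<in> space M. sample_max X n \<omega> \<le> y} = prob (\<Inter>i\<in>{1..n}. X i -` {..y} \<inter> space M)"
    by simp
  also have "\<dots> = (\<Prod>i\<in>{1..n}. prob (X i -` {..y} \<inter> space M))"
    by (rule indep_varsD[OF assms(2)]) (use n in auto)
  also have "\<dots> = (\<Prod>i\<in>{1..n}. std_normal_cdf y)"
  proof (rule prod.cong)
    fix i assume "i \<in> {1..n}"
    then have i: "i \<ge> 1" by simp
    show "prob (X i -` {..y} \<inter> space M) = std_normal_cdf y"
      unfolding cdf_def assms(3)[OF i, symmetric] using X[OF i] by (simp add: measure_distr)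
  qed simp
  finally show ?thesis by simp
qed

lemma cdf_normalized_sample_max:
  assumes "prob_space M" "prob_space.indep_vars M (\<lambda>_. borel) X {1..}"
    and "\<And>i. i \<ge> 1 \<Longrightarrow> distr M borel (X i) = std_normal_distribution"
    and n: "n \<ge> 1" and s: "s > 0"
  shows "cdf (distr M borel (\<lambda>\<omega>. s * (sample_max X n \<omega> - m))) x = std_normal_cdf (m + x / s) ^ n"
proof -
  interpret prob_space M by fact
  have X: "X i \<in> borel_measurable M" if "i \<ge> 1" for i
    using assms(2)[unfolded indep_vars_def2] that by simp
  have [measurable]: "sample_max X n \<in> borel_measurable M"
    unfolding sample_max_def by (rule borel_measurable_Max) (use X in auto)
  have "cdf (distr M borel (\<lambda>\<omega>. s * (sample_max X n \<omega> - m))) x =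
      prob ((\<lambda>\<omega>. s * (sample_max X n \<omega> - m)) -` {..x} \<inter> space M)"
    unfolding cdf_def by (subst measure_distr) auto
  also have "(\<lambda>\<omega>. s * (sample_max X n \<omega> - m)) -` {..x} \<inter> space M =
      {\<omega> \<in> space M. sample_max X n \<omega> \<le> m + x / s}"
    using s by (auto simp: field_simps)
  finally show ?thesis using prob_sample_max_le[OF assms(1-3) n] by simp
qed

lemma asymp_equiv_of_limits:
  fixes F r q :: "nat \<Rightarrow> real"
  assumes "(\<lambda>n. F n / r n) \<longlonglongrightarrow> K" "(\<lambda>n. r n / q n) \<longlonglongrightarrow> 1" "K \<noteq> 0"
    "\<forall>\<^sub>F n in sequentially. r n > 0"
  shows "F \<sim>[sequentially] (\<lambda>n. K * q n)"
proof (rule asymp_equivI')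
  have "(\<lambda>n. F n / r n / K * (r n / q n)) \<longlonglongrightarrow> K / K * 1"
    by (intro tendsto_intros assms)
  then have "(\<lambda>n. F n / r n / K * (r n / q n)) \<longlonglongrightarrow> 1" using assms(3) by simp
  then show "(\<lambda>n. F n / (K * q n)) \<longlonglongrightarrow> 1"
    by (rule Lim_transform_eventually) (use assms(4) in \<open>eventually_elim, simp\<close>)
qed

lemma measurable_power_cdf: "(\<lambda>x. std_normal_cdf (m + x / s) ^ n - gumbel_cdf x) \<in> borel_measurable borel"
proof -
  have [measurable]: "std_normal_cdf \<in> borel_measurable borel"
    by (rule borel_measurable_mono[OF std_normal_cdf_mono])
  show ?thesis unfolding gumbel_cdf_def by measurable
qed

text \<open>
  The rate is \<open>1 / (2 b\<^sup>2)\<close> with limiting profile \<open>2 gumbel_correction\<close>; the relative error is \<open>O(1 / b\<^sup>2)\<close>.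
\<close>
lemma self_scaled_limits:
  assumes b: "normal_scale b"
  defines "f \<equiv> \<lambda>n x. std_normal_cdf (b n + x / b n) ^ n - gumbel_cdf x"
  shows "(\<lambda>n. (SUP x. \<bar>f n x\<bar>)) \<sim>[sequentially] (\<lambda>n. d1 * (1 / (4 * ln (real n))))"
    and "(\<lambda>n. (LBINT x. \<bar>f n x\<bar>)) \<sim>[sequentially]
      (\<lambda>n. ((6 * (euler_mascheroni\<^sup>2 + 2 * euler_mascheroni + 2) + pi\<^sup>2) / 6) * (1 / (4 * ln (real n))))"
proof -
  obtain C B where CB: "C > 0" "\<And>b n x. \<lbrakk>b \<ge> B; 2 * pi * b\<^sup>2 * exp (b\<^sup>2) = (real n)\<^sup>2\<rbrakk> \<Longrightarrow>
    \<bar>std_normal_cdf (b + x / b) ^ n - gumbel_cdf x - 1 / b\<^sup>2 * gumbel_correction x\<bar>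
      \<le> C / b ^ 4 * exp (- \<bar>x\<bar> / 2)" by (rule power_cdf_expansion) blast
  obtain K where K: "K > 0" "\<And>x. \<bar>gumbel_correction x\<bar> \<le> K * exp (- (3 / 4) * \<bar>x\<bar>)"
    by (rule gumbel_correction_bound) blast
  note top = normal_scale_at_top[OF b]
  have ev: "\<forall>\<^sub>F n in sequentially. b n \<ge> B \<and> b n > 0 \<and> n \<ge> 2"
    using filterlim_at_top[THEN iffD1, OF top, rule_format, of B] eventually_ge_at_top[of 2]
    by eventually_elim (use b in \<open>auto simp: normal_scale_def\<close>)
  let ?g = "\<lambda>x. 2 * gumbel_correction x"
  let ?r = "\<lambda>n. 1 / (2 * (b n)\<^sup>2)"
  have c: "(1/2::real) > 0" by simp
  have close: "\<forall>\<^sub>F n in sequentially. \<forall>x. \<bar>f n x - ?r n * ?g x\<bar> \<le> C / b n ^ 4 * exp (- (1/2) * \<bar>x\<bar>)"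
    using ev
  proof eventually_elim
    case (elim n)
    then have "2 * pi * (b n)\<^sup>2 * exp ((b n)\<^sup>2) = (real n)\<^sup>2" using b by (simp add: normal_scale_def)
    from CB(2)[OF _ this] elim show ?case by (simp add: f_def)
  qed
  have small: "(\<lambda>n. C / b n ^ 4 / ?r n) \<longlonglongrightarrow> 0"
  proof -
    have "((\<lambda>b. C / b ^ 4 / (1 / (2 * b\<^sup>2))) \<longlongrightarrow> 0) at_top" by real_asymp
    from filterlim_compose[OF this top] show ?thesis .
  qed
  have pos: "\<forall>\<^sub>F n in sequentially. ?r n > 0" using ev by eventually_elim simp
  have gm: "?g \<in> borel_measurable borel"
    unfolding gumbel_correction_def gumbel_density_def by measurable
  have gb: "\<bar>?g x\<bar> \<le> 2 * K * exp (- (1/2) * \<bar>x\<bar>)" for x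
  proof -
    have "K * exp (- (3 / 4) * \<bar>x\<bar>) \<le> K * exp (- (1/2) * \<bar>x\<bar>)" using K by (intro mult_left_mono) auto
    then show ?thesis using K(2)[of x] by (simp add: abs_mult)
  qed
  have fm: "\<forall>\<^sub>F n in sequentially. f n \<in> borel_measurable borel"
    unfolding f_def by (intro always_eventually allI measurable_power_cdf)
  note lims = sup_and_L1_limits[OF c close small pos gm gb fm]
  have rq: "(\<lambda>n. ?r n / (1 / (4 * ln (real n)))) \<longlonglongrightarrow> 1"
  proof -
    have "(\<lambda>n. inverse ((b n)\<^sup>2 / (2 * ln (real n)))) \<longlonglongrightarrow> inverse 1"
      by (intro tendsto_inverse normal_scale_square[OF b]) simp
    moreover have "inverse ((b n)\<^sup>2 / (2 * ln (real n))) = ?r n / (1 / (4 * ln (real n)))" for n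
      by (simp add: field_simps)
    ultimately show ?thesis by simp
  qed
  have g_eq: "\<bar>?g x\<bar> = (x\<^sup>2 + 2 * x + 2) * exp (- exp (- x)) * exp (- x)" for x
    using gumbel_correction_nonneg[of x]
    by (simp add: gumbel_correction_def gumbel_density_def algebra_simps)
  have sup: "(SUP x. \<bar>?g x\<bar>) = d1" unfolding g_eq d1_def ..
  have "d1 \<noteq> 0" using d1_bounds unfolding abs_less_iff by auto
  from asymp_equiv_of_limits[OF lims(1)[unfolded sup] rq this pos]
  show "(\<lambda>n. (SUP x. \<bar>f n x\<bar>)) \<sim>[sequentially] (\<lambda>n. d1 * (1 / (4 * ln (real n))))" .
  have int: "(LBINT x. \<bar>?g x\<bar>) = (6 * (euler_mascheroni\<^sup>2 + 2 * euler_mascheroni + 2) + pi\<^sup>2) / 6"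
    using integral_gumbel_correction by (simp add: abs_mult)
  have "(6 * (euler_mascheroni\<^sup>2 + 2 * euler_mascheroni + 2) + pi\<^sup>2) / 6 > (0::real)"
    using euler_mascheroni_pos by (simp add: add_pos_pos add_nonneg_pos)
  then have "(6 * (euler_mascheroni\<^sup>2 + 2 * euler_mascheroni + 2) + pi\<^sup>2) / 6 \<noteq> (0::real)" by linarith
  from asymp_equiv_of_limits[OF lims(2)[unfolded int] rq this pos]
  show "(\<lambda>n. (LBINT x. \<bar>f n x\<bar>)) \<sim>[sequentially]
      (\<lambda>n. ((6 * (euler_mascheroni\<^sup>2 + 2 * euler_mascheroni + 2) + pi\<^sup>2) / 6) * (1 / (4 * ln (real n))))" .
qed

text \<open>
  The rate is \<open>- s\<close>, where \<open>s < 0\<close> is the relative error of the scale, and the profile is \<open>- x\<close> times the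
  Gumbel density. All other contributions are of smaller order: \<open>O(1 / b\<^sup>2)\<close> from the expansion at the
  exact scale, and \<open>O(\<bar>p\<bar> + s\<^sup>2)\<close> from the linearization.
\<close>
lemma bhat_limits:
  defines "f \<equiv> \<lambda>n x. std_normal_cdf (bhat n + x / a_seq n) ^ n - gumbel_cdf x"
  shows "(\<lambda>n. (SUP x. \<bar>f n x\<bar>)) \<sim>[sequentially] (\<lambda>n. d2 * (ln (ln (real n)) / (4 * ln (real n))))"
    and "(\<lambda>n. (LBINT x. \<bar>f n x\<bar>)) \<sim>[sequentially]
      (\<lambda>n. (euler_mascheroni + 2 * E1 1) * (ln (ln (real n)) / (4 * ln (real n))))"
proof -
  obtain b where b: "normal_scale b" using normal_scale_exists by blast
  obtain C B where CB: "C > 0" "\<And>b n x. \<lbrakk>b \<ge> B; 2 * pi * b\<^sup>2 * exp (b\<^sup>2) = (real n)\<^sup>2\<rbrakk> \<Longrightarrow>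
    \<bar>std_normal_cdf (b + x / b) ^ n - gumbel_cdf x - 1 / b\<^sup>2 * gumbel_correction x\<bar>
      \<le> C / b ^ 4 * exp (- \<bar>x\<bar> / 2)" by (rule power_cdf_expansion) blast
  obtain K where K: "K > 0" "\<And>x. \<bar>gumbel_correction x\<bar> \<le> K * exp (- (3 / 4) * \<bar>x\<bar>)"
    by (rule gumbel_correction_bound) blast
  obtain D where D: "D > 0" "\<And>p s x. \<lbrakk>\<bar>p\<bar> \<le> 1; \<bar>s\<bar> \<le> 1/8\<rbrakk> \<Longrightarrow>
    \<bar>gumbel_cdf (p + (1 + s) * x) - gumbel_cdf x - s * (x * gumbel_density x)\<bar>
      \<le> D * (\<bar>p\<bar> + s\<^sup>2) * exp (- \<bar>x\<bar> / 4)" by (rule gumbel_cdf_affine_expansion) blast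
  define s where "s = rel_shift b"
  define p where "p = loc_shift b"
  note as = shifts_asymptotics[OF b, folded s_def p_def]
  note top = normal_scale_at_top[OF b]
  have p0: "p \<longlonglongrightarrow> 0"
  proof -
    have "(\<lambda>n. p n / s n * s n) \<longlonglongrightarrow> 0 * 0" by (intro tendsto_mult as)
    then show ?thesis
      by (simp add: Lim_transform_eventually[of "\<lambda>n. p n / s n * s n" 0 _ p] eventually_mono[OF as(5)])
  qed
  have "\<forall>\<^sub>F n in sequentially. \<bar>p n\<bar> < 1" "\<forall>\<^sub>F n in sequentially. \<bar>s n\<bar> < 1/8"
    using tendstoD[OF p0, of 1] tendstoD[OF as(2), of "1/8"] by auto
  with as(5) filterlim_at_top[THEN iffD1, OF top, rule_format, of B]
    filterlim_at_top[THEN iffD1, OF top, rule_format, of 1] eventually_ge_at_top[of 2]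
  have ev: "\<forall>\<^sub>F n in sequentially. n \<ge> 2 \<and> b n \<ge> B \<and> b n \<ge> 1 \<and> s n < 0 \<and> \<bar>p n\<bar> \<le> 1 \<and> \<bar>s n\<bar> \<le> 1/8"
    by eventually_elim auto
  let ?g = "\<lambda>x. - (x * gumbel_density x)"
  let ?r = "\<lambda>n. - s n"
  let ?\<rho> = "\<lambda>n. (K + C) * exp 1 * (1 / (b n)\<^sup>2) + D * (\<bar>p n\<bar> + (s n)\<^sup>2)"
  have c: "(1/4::real) > 0" by simp
  have close: "\<forall>\<^sub>F n in sequentially. \<forall>x. \<bar>f n x - ?r n * ?g x\<bar> \<le> ?\<rho> n * exp (- (1/4) * \<bar>x\<bar>)"
    using ev
  proof (eventually_elim, intro allI)
    fix n x assume n: "n \<ge> 2 \<and> b n \<ge> B \<and> b n \<ge> 1 \<and> s n < 0 \<and> \<bar>p n\<bar> \<le> 1 \<and> \<bar>s n\<bar> \<le> 1/8"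
    let ?y = "p n + (1 + s n) * x"
    let ?w = "exp (- (1/4) * \<bar>x\<bar>)"
    have bn: "2 * pi * (b n)\<^sup>2 * exp ((b n)\<^sup>2) = (real n)\<^sup>2" "b n > 0"
      using b n by (auto simp: normal_scale_def)
    have an: "a_seq n \<noteq> 0" using n by (simp add: a_seq_def)
    have repar: "bhat n + x / a_seq n = b n + ?y / b n"
      unfolding p_def s_def by (rule bhat_reparametrization) (use bn an in auto)
    have y: "7/8 * \<bar>x\<bar> - 1 \<le> \<bar>?y\<bar>"
    proof -
      have "7/8 * \<bar>x\<bar> \<le> \<bar>(1 + s n) * x\<bar>"
        unfolding abs_mult using n by (intro mult_right_mono) auto
      moreover have "\<bar>(1 + s n) * x\<bar> - \<bar>p n\<bar> \<le> \<bar>?y\<bar>"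
        using abs_triangle_ineq2[of "(1 + s n) * x" "- p n"] by (simp add: add.commute)
      moreover have "\<bar>p n\<bar> \<le> 1" using n by simp
      ultimately show ?thesis by linarith
    qed
    have wy: "exp (- \<bar>?y\<bar> / 2) \<le> exp 1 * ?w"
    proof -
      have key: "- Y / 2 \<le> 1 + - (1/4) * Z" if "7/8 * Z - 1 \<le> Y" "0 \<le> Z" for Y Z :: real
        using that by linarith
      have "- \<bar>?y\<bar> / 2 \<le> 1 + - (1/4) * \<bar>x\<bar>" by (rule key[OF y]) simp
      then show ?thesis by (simp only: exp_add[symmetric]) simp
    qed
    have "1 / b n ^ 4 = 1 / (b n)\<^sup>2 * (1 / (b n)\<^sup>2)" by (simp add: eval_nat_numeral)
    also have "\<dots> \<le> 1 / (b n)\<^sup>2 * 1" using n by (intro mult_left_mono) (auto simp: divide_le_eq_1)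
    finally have b4: "1 / b n ^ 4 \<le> 1 / (b n)\<^sup>2" by simp
    have "\<bar>std_normal_cdf (b n + ?y / b n) ^ n - gumbel_cdf ?y - 1 / (b n)\<^sup>2 * gumbel_correction ?y\<bar>
        \<le> C * (1 / b n ^ 4) * exp (- \<bar>?y\<bar> / 2)" using CB(2)[OF _ bn(1), of ?y] n by simp
    also have "\<dots> \<le> C * (1 / (b n)\<^sup>2) * exp (- \<bar>?y\<bar> / 2)"
      using b4 CB(1) by (intro mult_right_mono mult_left_mono) auto
    finally have 1: "\<bar>std_normal_cdf (b n + ?y / b n) ^ n - gumbel_cdf ?y - 1 / (b n)\<^sup>2 * gumbel_correction ?y\<bar>
        \<le> C * (1 / (b n)\<^sup>2) * exp (- \<bar>?y\<bar> / 2)" .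
    have "\<bar>gumbel_correction ?y\<bar> \<le> K * exp (- \<bar>?y\<bar> / 2)"
      by (rule order_trans[OF K(2)]) (use K(1) in auto)
    then have 2: "\<bar>1 / (b n)\<^sup>2 * gumbel_correction ?y\<bar> \<le> 1 / (b n)\<^sup>2 * (K * exp (- \<bar>?y\<bar> / 2))"
      unfolding abs_mult by (intro mult_mono) auto
    have "\<bar>std_normal_cdf (b n + ?y / b n) ^ n - gumbel_cdf ?y\<bar> \<le> (K + C) * (1 / (b n)\<^sup>2) * exp (- \<bar>?y\<bar> / 2)"
    proof -
      have key: "\<bar>P - F\<bar> \<le> (K + C) * e * W" if "\<bar>P - F - G\<bar> \<le> C * e * W" "\<bar>G\<bar> \<le> e * (K * W)"
        for P F G e W :: real
      proof -
        have "\<bar>P - F\<bar> \<le> C * e * W + e * (K * W)" using that by linarith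
        then show ?thesis by (simp add: algebra_simps)
      qed
      show ?thesis by (rule key[OF 1 2])
    qed
    also have "\<dots> \<le> (K + C) * (1 / (b n)\<^sup>2) * (exp 1 * ?w)"
      using wy K(1) CB(1) by (intro mult_left_mono) auto
    finally have 3: "\<bar>std_normal_cdf (b n + ?y / b n) ^ n - gumbel_cdf ?y\<bar> \<le> (K + C) * exp 1 * (1 / (b n)\<^sup>2) * ?w"
      by (simp add: mult_ac)
    have 4: "\<bar>gumbel_cdf ?y - gumbel_cdf x - s n * (x * gumbel_density x)\<bar> \<le> D * (\<bar>p n\<bar> + (s n)\<^sup>2) * ?w"
    proof -
      have "\<bar>p n\<bar> \<le> 1" "\<bar>s n\<bar> \<le> 1/8" using n by auto
      from D(2)[OF this, of x] show ?thesis by simp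
    qed
    have "f n x - ?r n * ?g x = (std_normal_cdf (b n + ?y / b n) ^ n - gumbel_cdf ?y) +
       (gumbel_cdf ?y - gumbel_cdf x - s n * (x * gumbel_density x))"
      unfolding f_def repar by simp
    then have "\<bar>f n x - ?r n * ?g x\<bar> \<le> \<bar>std_normal_cdf (b n + ?y / b n) ^ n - gumbel_cdf ?y\<bar> +
        \<bar>gumbel_cdf ?y - gumbel_cdf x - s n * (x * gumbel_density x)\<bar>" by simp
    also have "\<dots> \<le> (K + C) * exp 1 * (1 / (b n)\<^sup>2) * ?w + D * (\<bar>p n\<bar> + (s n)\<^sup>2) * ?w"
      by (rule add_mono[OF 3 4])
    also have "\<dots> = ?\<rho> n * ?w" by (rule distrib_right[symmetric])
    finally show "\<bar>f n x - ?r n * ?g x\<bar> \<le> ?\<rho> n * ?w" .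
  qed
  have small: "(\<lambda>n. ?\<rho> n / ?r n) \<longlonglongrightarrow> 0"
  proof -
    have "(\<lambda>n. - ((K + C) * exp 1 * (1 / (b n)\<^sup>2 / s n)) + D * (\<bar>p n / s n\<bar> + - s n))
        \<longlonglongrightarrow> - ((K + C) * exp 1 * 0) + D * (\<bar>0\<bar> + - 0)"
      by (intro tendsto_intros as)
    then have "(\<lambda>n. - ((K + C) * exp 1 * (1 / (b n)\<^sup>2 / s n)) + D * (\<bar>p n / s n\<bar> + - s n)) \<longlonglongrightarrow> 0" by simp
    then show ?thesis
    proof (rule Lim_transform_eventually)
      show "\<forall>\<^sub>F n in sequentially. - ((K + C) * exp 1 * (1 / (b n)\<^sup>2 / s n)) + D * (\<bar>p n / s n\<bar> + - s n) = ?\<rho> n / ?r n"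
        using as(5)
      proof eventually_elim
        case (elim n)
        have abs: "\<bar>p n / s n\<bar> = \<bar>p n\<bar> / (- s n)" using elim by (simp add: abs_divide)
        have key: "- (A * (e / t)) + D * (P / (- t) + - t) = (A * e + D * (P + t\<^sup>2)) / (- t)"
          if "t \<noteq> 0" for A e P t :: real
          using that by (simp add: field_simps power2_eq_square)
        show ?case unfolding abs by (rule key) (use elim in simp)
      qed
    qed
  qed
  have pos: "\<forall>\<^sub>F n in sequentially. ?r n > 0" using as(5) by eventually_elim simp
  have gm: "?g \<in> borel_measurable borel" unfolding gumbel_density_def by measurable
  have gb: "\<exists>G. \<forall>x. \<bar>?g x\<bar> \<le> G * exp (- (1/4) * \<bar>x\<bar>)"
  proof -
    have cont: "continuous_on UNIV ?g" unfolding gumbel_density_def by (intro continuous_intros)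
    have "((\<lambda>x. ?g x * exp (1/4 * x)) \<longlongrightarrow> 0) at_top" "((\<lambda>x. ?g x * exp (1/4 * x)) \<longlongrightarrow> 0) at_bot"
      "((\<lambda>x. ?g x * exp (- (1/4) * x)) \<longlongrightarrow> 0) at_top" "((\<lambda>x. ?g x * exp (- (1/4) * x)) \<longlongrightarrow> 0) at_bot"
      unfolding gumbel_density_def by real_asymp+
    from exponential_decay_bound[OF cont this] show ?thesis by blast
  qed
  then obtain G where gb: "\<And>x. \<bar>?g x\<bar> \<le> G * exp (- (1/4) * \<bar>x\<bar>)" by blast
  have fm: "\<forall>\<^sub>F n in sequentially. f n \<in> borel_measurable borel"
    unfolding f_def by (intro always_eventually allI measurable_power_cdf)
  note lims = sup_and_L1_limits[OF c close small pos gm gb fm]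
  have sup: "(SUP x. \<bar>?g x\<bar>) = d2"
    unfolding d2_def by (simp add: gumbel_density_def abs_mult mult_ac)
  have "d2 \<noteq> 0" using d2_bounds unfolding abs_less_iff by auto
  from asymp_equiv_of_limits[OF lims(1)[unfolded sup] as(1) this pos]
  show "(\<lambda>n. (SUP x. \<bar>f n x\<bar>)) \<sim>[sequentially] (\<lambda>n. d2 * (ln (ln (real n)) / (4 * ln (real n))))" .
  have int: "(LBINT x. \<bar>?g x\<bar>) = euler_mascheroni + 2 * E1 1"
    using gumbel_abs_moment(1) by simp
  have "euler_mascheroni + 2 * E1 1 \<noteq> 0" using gumbel_abs_moment_numeric unfolding abs_less_iff by auto
  from asymp_equiv_of_limits[OF lims(2)[unfolded int] as(1) this pos]
  show "(\<lambda>n. (LBINT x. \<bar>f n x\<bar>)) \<sim>[sequentially]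
      (\<lambda>n. (euler_mascheroni + 2 * E1 1) * (ln (ln (real n)) / (4 * ln (real n))))" .
qed

theorem theorem2:
  fixes M :: "'a measure" and X :: "nat \<Rightarrow> 'a \<Rightarrow> real"
  assumes "prob_space M"
    and "prob_space.indep_vars M (\<lambda>_. borel) X {1..}"
    and "\<And>i. i \<ge> 1 \<Longrightarrow> distr M borel (X i) = std_normal_distribution"
  shows
    "(\<forall>b :: nat \<Rightarrow> real.
        (\<forall>n\<ge>2. b n > 0 \<and> 2 * pi * (b n)\<^sup>2 * exp ((b n)\<^sup>2) = (real n)\<^sup>2) \<longrightarrow>
        (\<lambda>n. SUP x::real. \<bar>\<P>(\<omega> in M. sample_max X n \<omega> \<le> b n + x / b n) - exp (- exp (- x))\<bar>)
          \<sim>[sequentially] (\<lambda>n. d1 / (4 * ln (real n)))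
      \<and> (\<lambda>n. W1 (distr M borel (\<lambda>\<omega>. b n * (sample_max X n \<omega> - b n))) gumbel)
          \<sim>[sequentially]
            (\<lambda>n. (6 * (euler_mascheroni\<^sup>2 + 2 * euler_mascheroni + 2) + pi\<^sup>2) / (24 * ln (real n))))
   \<and> \<bar>d1 - 1.3\<bar> < 0.05
   \<and> (\<lambda>n. SUP x::real. \<bar>\<P>(\<omega> in M. sample_max X n \<omega> \<le> bhat n + x / a_seq n) - exp (- exp (- x))\<bar>)
        \<sim>[sequentially] (\<lambda>n. d2 * ln (ln (real n)) / (4 * ln (real n)))
   \<and> (\<lambda>n. W1 (distr M borel (\<lambda>\<omega>. a_seq n * (sample_max X n \<omega> - bhat n))) gumbel)
        \<sim>[sequentially]
          (\<lambda>n. (euler_mascheroni + 2 * E1 1) * ln (ln (real n)) / (4 * ln (real n)))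
   \<and> \<bar>d2 - 0.3\<bar> < 0.05
   \<and> euler_mascheroni + 2 * E1 1 = (LBINT t:{0<..}. exp (- t) * \<bar>ln t\<bar>)
   \<and> \<bar>euler_mascheroni + 2 * E1 1 - 1\<bar> < 0.05"
proof -
  note max_le = prob_sample_max_le[OF assms]
  note max_cdf = cdf_normalized_sample_max[OF assms]
  have sup_eq: "(SUP x::real. \<bar>\<P>(\<omega> in M. sample_max X n \<omega> \<le> m + x / t) - exp (- exp (- x))\<bar>) =
      (SUP x. \<bar>std_normal_cdf (m + x / t) ^ n - gumbel_cdf x\<bar>)" if "n \<ge> 1" for n and m t :: real
    using that by (simp add: max_le gumbel_cdf_def)
  have W1_eq: "W1 (distr M borel (\<lambda>\<omega>. t * (sample_max X n \<omega> - m))) gumbel =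
      (LBINT x. \<bar>std_normal_cdf (m + x / t) ^ n - gumbel_cdf x\<bar>)" if "n \<ge> 1" "t > 0" for n and m t :: real
    unfolding W1_def using that by (simp add: max_cdf cdf_gumbel gumbel_cdf_def)
  have part1: "(\<lambda>n. SUP x::real. \<bar>\<P>(\<omega> in M. sample_max X n \<omega> \<le> b n + x / b n) - exp (- exp (- x))\<bar>)
          \<sim>[sequentially] (\<lambda>n. d1 / (4 * ln (real n)))
      \<and> (\<lambda>n. W1 (distr M borel (\<lambda>\<omega>. b n * (sample_max X n \<omega> - b n))) gumbel)
          \<sim>[sequentially]
            (\<lambda>n. (6 * (euler_mascheroni\<^sup>2 + 2 * euler_mascheroni + 2) + pi\<^sup>2) / (24 * ln (real n)))"
    if b: "\<forall>n\<ge>2. b n > 0 \<and> 2 * pi * (b n)\<^sup>2 * exp ((b n)\<^sup>2) = (real n)\<^sup>2" for b :: "nat \<Rightarrow> real"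
  proof
    have ns: "normal_scale b" using b by (simp add: normal_scale_def)
    note lim = self_scaled_limits[OF ns]
    show "(\<lambda>n. SUP x::real. \<bar>\<P>(\<omega> in M. sample_max X n \<omega> \<le> b n + x / b n) - exp (- exp (- x))\<bar>)
          \<sim>[sequentially] (\<lambda>n. d1 / (4 * ln (real n)))"
      by (rule asymp_equiv_cong[THEN iffD1, OF _ _ lim(1)])
         (use eventually_ge_at_top[of 2] in \<open>eventually_elim, simp add: sup_eq\<close>)+
    show "(\<lambda>n. W1 (distr M borel (\<lambda>\<omega>. b n * (sample_max X n \<omega> - b n))) gumbel)
          \<sim>[sequentially]
            (\<lambda>n. (6 * (euler_mascheroni\<^sup>2 + 2 * euler_mascheroni + 2) + pi\<^sup>2) / (24 * ln (real n)))"
      by (rule asymp_equiv_cong[THEN iffD1, OF _ _ lim(2)])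
         (use eventually_ge_at_top[of 2] in \<open>eventually_elim, use b in \<open>simp add: W1_eq\<close>\<close>)+
  qed
  have part2a: "(\<lambda>n. SUP x::real. \<bar>\<P>(\<omega> in M. sample_max X n \<omega> \<le> bhat n + x / a_seq n) - exp (- exp (- x))\<bar>)
        \<sim>[sequentially] (\<lambda>n. d2 * ln (ln (real n)) / (4 * ln (real n)))"
    by (rule asymp_equiv_cong[THEN iffD1, OF _ _ bhat_limits(1)])
       (use eventually_ge_at_top[of 2] in \<open>eventually_elim, simp add: sup_eq\<close>)+
  have part2b: "(\<lambda>n. W1 (distr M borel (\<lambda>\<omega>. a_seq n * (sample_max X n \<omega> - bhat n))) gumbel)
        \<sim>[sequentially]
          (\<lambda>n. (euler_mascheroni + 2 * E1 1) * ln (ln (real n)) / (4 * ln (real n)))"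
    by (rule asymp_equiv_cong[THEN iffD1, OF _ _ bhat_limits(2)])
       (use eventually_ge_at_top[of 2] in \<open>eventually_elim, simp add: W1_eq a_seq_def\<close>)+
  show ?thesis
    using part1 part2a part2b d1_bounds d2_bounds gumbel_abs_moment(2)[symmetric] gumbel_abs_moment_numeric
    by blast
qed

end
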